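(* Let $M$ be a compact connected Riemann surface with a Kähler metric, and let $E\to M$ be a holomorphic line bundle. Let $\nabla_A=\partial_A+\bar\partial_A$ be a compatible connection on $E$ with curvature $F_A$, let $F_0=\max_M i\Lambda F_A$, and suppose $F_0\le 0$. Then every nonzero eigenvalue $\mu$ of the twisted complex Dirac operator $D_A=\sqrt2\,(\bar\partial_A+\bar\partial_A^* )$ acting on $\Omega^{0,0}(E)\oplus\Omega^{0,1}(E)$ satisfies $$|\mu|\ \ge\ \sqrt{-2F_0}.$$
   Context: Conventions. A connection $\nabla_A$ on the holomorphic line bundle $E$ is called compatible if it is unitary with respect to a Hermitian metric on $E$ and its $(0,1)$-part $\bar\partial_A$ is the Cauchy-Riemann operator of the holomorphic structure of $E$; that is, $\nabla_A$ is the Chern connection of a Hermitian metric on $E$. Write $\Omega^{0,q}(E)=\Gamma(\wedge^{0,q}M\otimes E)$. The formal adjoint $\bar\partial_A^*$ is taken with respect to the $L^2$ inner products defined by the Kähler metric of $M$ (extended to complex forms as a Hermitian inner product) and the Hermitian metric of $E$ of which $\nabla_A$ is the Chern connection. $\Lambda$ denotes contraction with the Kähler form $\omega$, i.e. the adjoint of $\alpha\mapsto\omega\wedge\alpha$; the volume form is $\omega$ and $\Lambda\omega=1$. The function $i\Lambda F_A$ is real-valued. The operator $D_A$ is the Dirac operator of the canonical $\mathrm{Spin}^{\mathbb C}$ structure of $M$ (spinor bundle $\wedge^{0,*}(M)$) twisted by $(E,\nabla_A)$; it is self-adjoint. *)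

theory Defs
  imports "HOL-Analysis.Analysis"
begin

section \<open>Calculus on open subsets of the complex plane\<close>

definition wirtinger :: "(complex \<Rightarrow> complex) \<Rightarrow> complex \<Rightarrow> complex" where
  "wirtinger f w =
     (frechet_derivative f (at w) 1 - \<i> * frechet_derivative f (at w) \<i>) / 2"

definition wirtinger_bar :: "(complex \<Rightarrow> complex) \<Rightarrow> complex \<Rightarrow> complex" where
  "wirtinger_bar f w =
     (frechet_derivative f (at w) 1 + \<i> * frechet_derivative f (at w) \<i>) / 2"

text \<open>Real differentiability of class \<open>C\<^sup>k\<close>, to be used on open sets only.\<close>

fun C_k_on :: "nat \<Rightarrow> complex set \<Rightarrow> (complex \<Rightarrow> complex) \<Rightarrow> bool" where
  "C_k_on 0 S f = continuous_on S f"
| "C_k_on (Suc k) S f =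
     ((\<forall>w\<in>S. f differentiable (at w)) \<and>
      C_k_on k S (\<lambda>w. frechet_derivative f (at w) 1) \<and>
      C_k_on k S (\<lambda>w. frechet_derivative f (at w) \<i>))"

definition smooth_on :: "complex set \<Rightarrow> (complex \<Rightarrow> complex) \<Rightarrow> bool" where
  "smooth_on S f \<longleftrightarrow> (\<forall>k. C_k_on k S f)"


section \<open>Riemann surfaces\<close>

text \<open>
  The underlying space is the whole type \<open>'m\<close>; a surface is an indexed holomorphic atlas on it.
  Values of charts outside their domain are irrelevant.
\<close>

record ('i, 'm) surface =
  dom :: "'i \<Rightarrow> 'm set"
  chart :: "'i \<Rightarrow> 'm \<Rightarrow> complex"

definition chart_inv :: "('i, 'm) surface \<Rightarrow> 'i \<Rightarrow> complex \<Rightarrow> 'm" where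
  "chart_inv M i = inv_into (dom M i) (chart M i)"

definition riemann_surface :: "('i, 'm::t2_space) surface \<Rightarrow> bool" where
  "riemann_surface M \<longleftrightarrow>
     (\<Union>i. dom M i) = UNIV \<and>
     (\<forall>i. open (dom M i) \<and> open (chart M i ` dom M i) \<and>
          homeomorphism (dom M i) (chart M i ` dom M i) (chart M i) (chart_inv M i)) \<and>
     (\<forall>i j. (chart M j \<circ> chart_inv M i) holomorphic_on chart M i ` (dom M i \<inter> dom M j))"

text \<open>The holomorphic derivative \<open>dz\<^sub>i/dz\<^sub>j\<close> at a point of \<open>dom M i \<inter> dom M j\<close>.\<close>

definition transition_deriv :: "('i, 'm) surface \<Rightarrow> 'i \<Rightarrow> 'i \<Rightarrow> 'm \<Rightarrow> complex" where
  "transition_deriv M i j p = deriv (chart M i \<circ> chart_inv M j) (chart M j p)"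

text \<open>The common value at \<open>p\<close> of a quantity that is computed in charts but independent of them.\<close>

definition chart_value :: "('i, 'm) surface \<Rightarrow> ('i \<Rightarrow> 'x) \<Rightarrow> 'm \<Rightarrow> 'x" where
  "chart_value M f p = (THE c. \<forall>i. p \<in> dom M i \<longrightarrow> f i = c)"

definition smooth_fun :: "('i, 'm) surface \<Rightarrow> 'm set \<Rightarrow> ('m \<Rightarrow> complex) \<Rightarrow> bool" where
  "smooth_fun M W f \<longleftrightarrow> (\<forall>i. smooth_on (chart M i ` (dom M i \<inter> W)) (f \<circ> chart_inv M i))"

text \<open>The derivatives of a function along the coordinate fields of the chart \<open>i\<close>.\<close>

definition del :: "('i, 'm) surface \<Rightarrow> 'i \<Rightarrow> ('m \<Rightarrow> complex) \<Rightarrow> 'm \<Rightarrow> complex" where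
  "del M i f p = wirtinger (f \<circ> chart_inv M i) (chart M i p)"

definition delbar :: "('i, 'm) surface \<Rightarrow> 'i \<Rightarrow> ('m \<Rightarrow> complex) \<Rightarrow> 'm \<Rightarrow> complex" where
  "delbar M i f p = wirtinger_bar (f \<circ> chart_inv M i) (chart M i p)"


section \<open>Kaehler metrics, area, and two-forms\<close>

text \<open>
  A Hermitian metric is given in the chart \<open>i\<close>, with \<open>z\<^sub>i = x + iy\<close>, by \<open>\<rho>\<^sub>i (dx\<^sup>2 + dy\<^sup>2)\<close>; its Kaehler
  form is \<open>\<omega> = \<rho>\<^sub>i dx \<and> dy = (i/2) \<rho>\<^sub>i dz\<^sub>i \<and> d\<close>conj\<open>(z\<^sub>i)\<close>, which is closed because the real
  dimension is two.
\<close>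

definition kaehler_metric :: "('i, 'm) surface \<Rightarrow> ('i \<Rightarrow> 'm \<Rightarrow> real) \<Rightarrow> bool" where
  "kaehler_metric M \<rho> \<longleftrightarrow>
     (\<forall>i. smooth_fun M (dom M i) (\<lambda>p. complex_of_real (\<rho> i p))) \<and>
     (\<forall>i. \<forall>p\<in>dom M i. \<rho> i p > 0) \<and>
     (\<forall>i j. \<forall>p\<in>dom M i \<inter> dom M j. \<rho> j p = (cmod (transition_deriv M i j p))\<^sup>2 * \<rho> i p)"

text \<open>The Borel measure defined by the volume form \<open>\<omega>\<close>.\<close>

definition area :: "('i, 'm::t2_space) surface \<Rightarrow> ('i \<Rightarrow> 'm \<Rightarrow> real) \<Rightarrow> 'm measure" where
  "area M \<rho> = (THE N. sets N = sets borel \<and>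
     (\<forall>i. \<forall>B\<in>sets borel. B \<subseteq> dom M i \<longrightarrow>
        emeasure N B =
          (\<integral>\<^sup>+ w \<in> chart M i ` B. ennreal (\<rho> i (chart_inv M i w)) \<partial>lborel)))"

text \<open>
  A complex two-form is the family of its coefficients with respect to
  \<open>dz\<^sub>i \<and> d\<close>conj\<open>(z\<^sub>i)\<close>. As \<open>\<bar>dx\<bar> = \<bar>dy\<bar> = \<rho>\<^sub>i\<^bsup>-1/2\<^esup>\<close>, this basis element has squared length
  \<open>4/\<rho>\<^sub>i\<^sup>2\<close>, and \<open>d\<close>conj\<open>(z\<^sub>i)\<close> has squared length \<open>2/\<rho>\<^sub>i\<close>. Inner products are linear in the first
  argument.
\<close>

definition kaehler_wedge :: "('i \<Rightarrow> 'm \<Rightarrow> real) \<Rightarrow> complex \<Rightarrow> 'i \<Rightarrow> 'm \<Rightarrow> complex" where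
  "kaehler_wedge \<rho> c i p = \<i> / 2 * of_real (\<rho> i p) * c"

definition two_form_inner ::
  "('i, 'm) surface \<Rightarrow> ('i \<Rightarrow> 'm \<Rightarrow> real) \<Rightarrow>
   ('i \<Rightarrow> 'm \<Rightarrow> complex) \<Rightarrow> ('i \<Rightarrow> 'm \<Rightarrow> complex) \<Rightarrow> 'm \<Rightarrow> complex" where
  "two_form_inner M \<rho> \<eta> \<theta> p =
     chart_value M (\<lambda>i. of_real (4 / (\<rho> i p)\<^sup>2) * \<eta> i p * cnj (\<theta> i p)) p"

definition Lambda ::
  "('i, 'm) surface \<Rightarrow> ('i \<Rightarrow> 'm \<Rightarrow> real) \<Rightarrow> ('i \<Rightarrow> 'm \<Rightarrow> complex) \<Rightarrow> 'm \<Rightarrow> complex" where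
  "Lambda M \<rho> \<eta> p =
     (THE c. \<forall>a. two_form_inner M \<rho> (kaehler_wedge \<rho> a) \<eta> p = a * cnj c)"


section \<open>Holomorphic line bundles\<close>

text \<open>
  All fibres are one-dimensional subspaces of one complex vector space with scalar multiplication
  \<open>scl\<close> (any family of fibres embeds in its direct sum). Fibres over different
  points are not required to be disjoint, since only functions \<open>p \<mapsto> s p \<in> fibre p\<close> are used. The
  holomorphic structure is given by nowhere vanishing local frames with holomorphic transition
  functions.
\<close>

record ('b, 'm, 'v) line_bundle =
  fibre :: "'m \<Rightarrow> 'v set"
  scl :: "complex \<Rightarrow> 'v \<Rightarrow> 'v"
  triv :: "'b \<Rightarrow> 'm set"
  frame :: "'b \<Rightarrow> 'm \<Rightarrow> 'v"

definition coeff :: "('b, 'm, 'v) line_bundle \<Rightarrow> 'b \<Rightarrow> ('m \<Rightarrow> 'v) \<Rightarrow> 'm \<Rightarrow> complex" where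
  "coeff E a s p = (THE c. s p = scl E c (frame E a p))"

definition holomorphic_line_bundle ::
  "('i, 'm::t2_space) surface \<Rightarrow> ('b, 'm, 'v::ab_group_add) line_bundle \<Rightarrow> bool" where
  "holomorphic_line_bundle M E \<longleftrightarrow>
     vector_space (scl E) \<and>
     (\<Union>a. triv E a) = UNIV \<and>
     (\<forall>a. open (triv E a)) \<and>
     (\<forall>a. \<forall>p\<in>triv E a. frame E a p \<noteq> 0 \<and> fibre E p = range (\<lambda>c. scl E c (frame E a p))) \<and>
     (\<forall>a b i. (coeff E a (frame E b) \<circ> chart_inv M i)
        holomorphic_on chart M i ` (dom M i \<inter> triv E a \<inter> triv E b))"

definition smooth_section ::
  "('i, 'm) surface \<Rightarrow> ('b, 'm, 'v) line_bundle \<Rightarrow> 'm set \<Rightarrow> ('m \<Rightarrow> 'v) \<Rightarrow> bool" where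
  "smooth_section M E W s \<longleftrightarrow>
     (\<forall>p\<in>W. s p \<in> fibre E p) \<and> (\<forall>a. smooth_fun M (W \<inter> triv E a) (coeff E a s))"

text \<open>
  A \<open>(1,0)\<close>-form \<open>\<alpha>\<close> with values in \<open>E\<close> is \<open>\<alpha> i dz\<^sub>i\<close> in the chart \<open>i\<close>, and a \<open>(0,1)\<close>-form \<open>\<beta>\<close> is
  \<open>\<beta> i d\<close>conj\<open>(z\<^sub>i)\<close>. Coefficients vanish outside the domain where they are defined, so that equality
  of forms is equality of functions.
\<close>

definition form10 ::
  "('i, 'm) surface \<Rightarrow> ('b, 'm, 'v::zero) line_bundle \<Rightarrow> 'm set \<Rightarrow> ('i \<Rightarrow> 'm \<Rightarrow> 'v) \<Rightarrow> bool" where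
  "form10 M E W \<alpha> \<longleftrightarrow>
     (\<forall>i. smooth_section M E (W \<inter> dom M i) (\<alpha> i)) \<and>
     (\<forall>i p. p \<notin> W \<inter> dom M i \<longrightarrow> \<alpha> i p = 0) \<and>
     (\<forall>i j. \<forall>p\<in>W \<inter> dom M i \<inter> dom M j.
        \<alpha> j p = scl E (transition_deriv M i j p) (\<alpha> i p))"

definition form01 ::
  "('i, 'm) surface \<Rightarrow> ('b, 'm, 'v::zero) line_bundle \<Rightarrow> 'm set \<Rightarrow> ('i \<Rightarrow> 'm \<Rightarrow> 'v) \<Rightarrow> bool" where
  "form01 M E W \<beta> \<longleftrightarrow>
     (\<forall>i. smooth_section M E (W \<inter> dom M i) (\<beta> i)) \<and>
     (\<forall>i p. p \<notin> W \<inter> dom M i \<longrightarrow> \<beta> i p = 0) \<and>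
     (\<forall>i j. \<forall>p\<in>W \<inter> dom M i \<inter> dom M j.
        \<beta> j p = scl E (cnj (transition_deriv M i j p)) (\<beta> i p))"

definition Omega00 ::
  "('i, 'm) surface \<Rightarrow> ('b, 'm, 'v) line_bundle \<Rightarrow> ('m \<Rightarrow> 'v) set" where
  "Omega00 M E = {s. smooth_section M E UNIV s}"

definition Omega01 ::
  "('i, 'm) surface \<Rightarrow> ('b, 'm, 'v::zero) line_bundle \<Rightarrow> ('i \<Rightarrow> 'm \<Rightarrow> 'v) set" where
  "Omega01 M E = {\<beta>. form01 M E UNIV \<beta>}"

text \<open>The coefficient in the chart \<open>i\<close> of the Cauchy-Riemann operator of \<open>E\<close> applied to \<open>s\<close>.\<close>

definition cauchy_riemann ::
  "('i, 'm) surface \<Rightarrow> ('b, 'm, 'v) line_bundle \<Rightarrow> ('m \<Rightarrow> 'v) \<Rightarrow> 'i \<Rightarrow> 'm \<Rightarrow> 'v" where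
  "cauchy_riemann M E s i p =
     (THE v. \<forall>a. p \<in> triv E a \<longrightarrow> v = scl E (delbar M i (coeff E a s) p) (frame E a p))"

definition hermitian_metric ::
  "('i, 'm::t2_space) surface \<Rightarrow> ('b, 'm, 'v::ab_group_add) line_bundle \<Rightarrow>
   ('m \<Rightarrow> 'v \<Rightarrow> 'v \<Rightarrow> complex) \<Rightarrow> bool" where
  "hermitian_metric M E h \<longleftrightarrow>
     (\<forall>p. \<forall>u\<in>fibre E p. \<forall>v\<in>fibre E p. \<forall>w\<in>fibre E p. \<forall>c.
        h p (u + v) w = h p u w + h p v w \<and>
        h p (scl E c u) w = c * h p u w \<and>
        h p v u = cnj (h p u v)) \<and>
     (\<forall>p. \<forall>u\<in>fibre E p. u \<noteq> 0 \<longrightarrow> Re (h p u u) > 0) \<and>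
     (\<forall>W s t. open W \<longrightarrow> smooth_section M E W s \<longrightarrow> smooth_section M E W t \<longrightarrow>
        smooth_fun M W (\<lambda>p. h p (s p) (t p)))"


section \<open>Connections\<close>

text \<open>
  A connection acts on local sections: for \<open>s\<close> smooth on the open set \<open>W\<close>, its value on \<open>W\<close> is
  \<open>\<nabla>s = d10 s i dz\<^sub>i + d01 s i d\<close>conj\<open>(z\<^sub>i)\<close> in the chart \<open>i\<close>; thus \<open>d10 s i\<close> and \<open>d01 s i\<close> are the
  covariant derivatives of \<open>s\<close> along \<open>\<partial>/\<partial>z\<^sub>i\<close> and \<open>\<partial>/\<partial>\<close>conj\<open>(z\<^sub>i)\<close>. Only the restriction to \<open>W\<close> is
  constrained.
\<close>

record ('i, 'm, 'v) connection =
  d10 :: "('m \<Rightarrow> 'v) \<Rightarrow> 'i \<Rightarrow> 'm \<Rightarrow> 'v"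
  d01 :: "('m \<Rightarrow> 'v) \<Rightarrow> 'i \<Rightarrow> 'm \<Rightarrow> 'v"

definition restrict_form ::
  "('i, 'm) surface \<Rightarrow> 'm set \<Rightarrow> ('i \<Rightarrow> 'm \<Rightarrow> 'v::zero) \<Rightarrow> 'i \<Rightarrow> 'm \<Rightarrow> 'v" where
  "restrict_form M W \<alpha> = (\<lambda>i p. if p \<in> W \<inter> dom M i then \<alpha> i p else 0)"

definition is_connection ::
  "('i, 'm::t2_space) surface \<Rightarrow> ('b, 'm, 'v::ab_group_add) line_bundle \<Rightarrow>
   ('i, 'm, 'v) connection \<Rightarrow> bool" where
  "is_connection M E A \<longleftrightarrow>
     (\<forall>W s. open W \<longrightarrow> smooth_section M E W s \<longrightarrow>
        form10 M E W (restrict_form M W (d10 A s)) \<and>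
        form01 M E W (restrict_form M W (d01 A s))) \<and>
     (\<forall>W s t. open W \<longrightarrow> smooth_section M E W s \<longrightarrow> (\<forall>p\<in>W. s p = t p) \<longrightarrow>
        (\<forall>i. \<forall>p\<in>W \<inter> dom M i. d10 A s i p = d10 A t i p \<and> d01 A s i p = d01 A t i p)) \<and>
     (\<forall>W s t. open W \<longrightarrow> smooth_section M E W s \<longrightarrow> smooth_section M E W t \<longrightarrow>
        (\<forall>i. \<forall>p\<in>W \<inter> dom M i.
           d10 A (\<lambda>q. s q + t q) i p = d10 A s i p + d10 A t i p \<and>
           d01 A (\<lambda>q. s q + t q) i p = d01 A s i p + d01 A t i p)) \<and>
     (\<forall>W f s. open W \<longrightarrow> smooth_fun M W f \<longrightarrow> smooth_section M E W s \<longrightarrow>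
        (\<forall>i. \<forall>p\<in>W \<inter> dom M i.
           d10 A (\<lambda>q. scl E (f q) (s q)) i p
             = scl E (del M i f p) (s p) + scl E (f p) (d10 A s i p) \<and>
           d01 A (\<lambda>q. scl E (f q) (s q)) i p
             = scl E (delbar M i f p) (s p) + scl E (f p) (d01 A s i p)))"

definition unitary ::
  "('i, 'm::t2_space) surface \<Rightarrow> ('b, 'm, 'v::ab_group_add) line_bundle \<Rightarrow>
   ('m \<Rightarrow> 'v \<Rightarrow> 'v \<Rightarrow> complex) \<Rightarrow> ('i, 'm, 'v) connection \<Rightarrow> bool" where
  "unitary M E h A \<longleftrightarrow>
     (\<forall>W s t. open W \<longrightarrow> smooth_section M E W s \<longrightarrow> smooth_section M E W t \<longrightarrow>
        (\<forall>i. \<forall>p\<in>W \<inter> dom M i.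
           del M i (\<lambda>q. h q (s q) (t q)) p
             = h p (d10 A s i p) (t p) + h p (s p) (d01 A t i p) \<and>
           delbar M i (\<lambda>q. h q (s q) (t q)) p
             = h p (d01 A s i p) (t p) + h p (s p) (d10 A t i p)))"

text \<open>\<open>A\<close> is the Chern connection of the Hermitian metric \<open>h\<close>.\<close>

definition chern_connection ::
  "('i, 'm::t2_space) surface \<Rightarrow> ('b, 'm, 'v::ab_group_add) line_bundle \<Rightarrow>
   ('m \<Rightarrow> 'v \<Rightarrow> 'v \<Rightarrow> complex) \<Rightarrow> ('i, 'm, 'v) connection \<Rightarrow> bool" where
  "chern_connection M E h A \<longleftrightarrow>
     is_connection M E A \<and> unitary M E h A \<and>
     (\<forall>W s. open W \<longrightarrow> smooth_section M E W s \<longrightarrow>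
        (\<forall>i. \<forall>p\<in>W \<inter> dom M i. d01 A s i p = cauchy_riemann M E s i p))"

text \<open>
  The coefficient of \<open>F\<^sub>A\<close> with respect to \<open>dz\<^sub>i \<and> d\<close>conj\<open>(z\<^sub>i)\<close> is \<open>F\<^sub>A(X, Y) = [\<nabla>\<^sub>X, \<nabla>\<^sub>Y]\<close> for the
  commuting fields \<open>X = \<partial>/\<partial>z\<^sub>i\<close> and \<open>Y = \<partial>/\<partial>\<close>conj\<open>(z\<^sub>i)\<close>, an endomorphism of a one-dimensional
  fibre.
\<close>

definition curvature ::
  "('i, 'm::t2_space) surface \<Rightarrow> ('b, 'm, 'v::ab_group_add) line_bundle \<Rightarrow>
   ('i, 'm, 'v) connection \<Rightarrow> 'i \<Rightarrow> 'm \<Rightarrow> complex" where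
  "curvature M E A i p =
     (THE c. \<forall>W s. open W \<longrightarrow> p \<in> W \<longrightarrow> smooth_section M E W s \<longrightarrow>
        d10 A (d01 A s i) i p - d01 A (d10 A s i) i p = scl E c (s p))"


section \<open>The twisted Dirac operator\<close>

definition L2_inner00 ::
  "('i, 'm::t2_space) surface \<Rightarrow> ('i \<Rightarrow> 'm \<Rightarrow> real) \<Rightarrow> ('m \<Rightarrow> 'v \<Rightarrow> 'v \<Rightarrow> complex) \<Rightarrow>
   ('m \<Rightarrow> 'v) \<Rightarrow> ('m \<Rightarrow> 'v) \<Rightarrow> complex" where
  "L2_inner00 M \<rho> h s t = (LINT p | area M \<rho>. h p (s p) (t p))"

definition L2_inner01 ::
  "('i, 'm::t2_space) surface \<Rightarrow> ('i \<Rightarrow> 'm \<Rightarrow> real) \<Rightarrow> ('m \<Rightarrow> 'v \<Rightarrow> 'v \<Rightarrow> complex) \<Rightarrow>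
   ('i \<Rightarrow> 'm \<Rightarrow> 'v) \<Rightarrow> ('i \<Rightarrow> 'm \<Rightarrow> 'v) \<Rightarrow> complex" where
  "L2_inner01 M \<rho> h \<beta> \<gamma> =
     (LINT p | area M \<rho>. chart_value M (\<lambda>i. of_real (2 / \<rho> i p) * h p (\<beta> i p) (\<gamma> i p)) p)"

definition dbar ::
  "('i, 'm::t2_space) surface \<Rightarrow> ('i, 'm, 'v::ab_group_add) connection \<Rightarrow>
   ('m \<Rightarrow> 'v) \<Rightarrow> 'i \<Rightarrow> 'm \<Rightarrow> 'v" where
  "dbar M A s = restrict_form M UNIV (d01 A s)"

definition dbar_adjoint ::
  "('i, 'm::t2_space) surface \<Rightarrow> ('i \<Rightarrow> 'm \<Rightarrow> real) \<Rightarrow> ('b, 'm, 'v::ab_group_add) line_bundle \<Rightarrow>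
   ('m \<Rightarrow> 'v \<Rightarrow> 'v \<Rightarrow> complex) \<Rightarrow> ('i, 'm, 'v) connection \<Rightarrow>
   ('i \<Rightarrow> 'm \<Rightarrow> 'v) \<Rightarrow> 'm \<Rightarrow> 'v" where
  "dbar_adjoint M \<rho> E h A \<beta> =
     (THE \<sigma>. \<sigma> \<in> Omega00 M E \<and>
        (\<forall>t\<in>Omega00 M E. L2_inner01 M \<rho> h (dbar M A t) \<beta> = L2_inner00 M \<rho> h t \<sigma>))"

definition dirac ::
  "('i, 'm::t2_space) surface \<Rightarrow> ('i \<Rightarrow> 'm \<Rightarrow> real) \<Rightarrow> ('b, 'm, 'v::ab_group_add) line_bundle \<Rightarrow>
   ('m \<Rightarrow> 'v \<Rightarrow> 'v \<Rightarrow> complex) \<Rightarrow> ('i, 'm, 'v) connection \<Rightarrow>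
   ('m \<Rightarrow> 'v) \<times> ('i \<Rightarrow> 'm \<Rightarrow> 'v) \<Rightarrow> ('m \<Rightarrow> 'v) \<times> ('i \<Rightarrow> 'm \<Rightarrow> 'v)" where
  "dirac M \<rho> E h A = (\<lambda>(\<phi>, \<psi>).
     (\<lambda>p. scl E (of_real (sqrt 2)) (dbar_adjoint M \<rho> E h A \<psi> p),
      \<lambda>i p. scl E (of_real (sqrt 2)) (dbar M A \<phi> i p)))"

definition dirac_eigenvalue ::
  "('i, 'm::t2_space) surface \<Rightarrow> ('i \<Rightarrow> 'm \<Rightarrow> real) \<Rightarrow> ('b, 'm, 'v::ab_group_add) line_bundle \<Rightarrow>
   ('m \<Rightarrow> 'v \<Rightarrow> 'v \<Rightarrow> complex) \<Rightarrow> ('i, 'm, 'v) connection \<Rightarrow> complex \<Rightarrow> bool" where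
  "dirac_eigenvalue M \<rho> E h A \<mu> \<longleftrightarrow>
     (\<exists>\<phi>\<in>Omega00 M E. \<exists>\<psi>\<in>Omega01 M E.
        (\<phi>, \<psi>) \<noteq> (\<lambda>p. 0, \<lambda>i p. 0) \<and>
        dirac M \<rho> E h A (\<phi>, \<psi>) = (\<lambda>p. scl E \<mu> (\<phi> p), \<lambda>i p. scl E \<mu> (\<psi> i p)))"

end

theory Submission
  imports Defs "HOL-Complex_Analysis.Cauchy_Integral_Formula"
begin

text \<open>
  If \<open>(\<phi>, \<psi>)\<close> is an eigenvector for \<open>\<mu> \<noteq> 0\<close>, then \<open>\<phi> \<noteq> 0\<close> and \<open>2 \<partial>\<close>bar\<open>\<^sup>*\<partial>\<close>bar\<open> \<phi> = \<mu>\<^sup>2 \<phi>\<close>. Interchanging the covariant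
  derivatives along \<open>\<partial>/\<partial>z\<close> and \<open>\<partial>/\<partial>\<close>conj\<open>(z)\<close> costs the curvature, which gives the Weitzenboeck formula
  \<open>\<partial>\<close>bar\<open>\<^sup>*\<partial>\<close>bar\<open> = \<partial>\<^sup>*\<partial> - i\<Lambda>F\<close> on sections of \<open>E\<close>. Pairing with \<open>\<phi>\<close> and discarding \<open>\<parallel>\<partial>\<phi>\<parallel>\<^sup>2 \<ge> 0\<close> leaves
  \<open>Re \<mu>\<^sup>2 \<parallel>\<phi>\<parallel>\<^sup>2 \<ge> -2F0 \<parallel>\<phi>\<parallel>\<^sup>2\<close>, and \<open>\<bar>\<mu>\<bar>\<^sup>2 \<ge> Re \<mu>\<^sup>2\<close> (\<open>eigensection_bound\<close>).

  Only one global fact is needed, Stokes' theorem for \<open>(1,0)\<close>-forms of class \<open>C\<^sup>1\<close>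
  (\<open>integral_divergence_eq_0\<close>). It is used twice: for \<open>h(t, \<psi>)\<close> it identifies the formal adjoint
  (\<open>adjoint_formula_L2\<close>), and for \<open>h(\<partial>\<phi>, \<phi>)\<close> it gives the estimate. Cutoff functions reduce it to a
  compactly supported function in the plane, whose derivative has integral zero by translation
  invariance of Lebesgue measure.

  The geometric objects are definite descriptions, so each has to be shown to exist uniquely before
  anything can be computed with it. The area measure is glued from the charts by the change of variables
  formula (\<open>area_exists\<close>). The formal adjoint is unique because the area of a nonempty open set is positive
  (\<open>dbar_adjoint_eq\<close>). The curvature exists by symmetry of second derivatives (\<open>commutator_eq\<close>), and its
  coefficients in different charts fit together to a two-form (\<open>curvature_transition\<close>), which
  determines \<open>\<Lambda>F\<close> (\<open>Lambda_curvature\<close>).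
\<close>

section \<open>Functions of class \<open>C\<^sup>k\<close> in the plane\<close>

lemma has_frechet:
  "f differentiable at w \<Longrightarrow> (f has_derivative frechet_derivative f (at w)) (at w)"
  by (simp add: frechet_derivative_works)

text \<open>Derivatives on an open set depend only on the values there. Local sections and functions
  are unconstrained outside their domains, so this is what allows them to be rewritten.\<close>

lemma C_k_on_cong:
  assumes "open S" and "\<And>w. w \<in> S \<Longrightarrow> f w = g w"
  shows "C_k_on k S f \<longleftrightarrow> C_k_on k S g"
proof -
  have "C_k_on k S f" if "C_k_on k S g" "\<And>w. w \<in> S \<Longrightarrow> f w = g w" for f g :: "complex \<Rightarrow> complex"
    using that
  proof (induction k arbitrary: f g)
    case 0
    then show ?case by (simp cong: continuous_on_cong)
  next
    case (Suc k)
    have d: "g differentiable at w" if "w \<in> S" for w using Suc.prems that by auto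
    have e: "frechet_derivative f (at w) = frechet_derivative g (at w)" if "w \<in> S" for w
      using frechet_derivative_transform_within_open[OF d[OF that] assms(1) that, of f] Suc.prems(2) by auto
    have "f differentiable at w" if "w \<in> S" for w
      using has_derivative_transform_within_open[OF has_frechet[OF d[OF that]] assms(1) that, of f]
        Suc.prems(2) by (auto simp: differentiable_def)
    moreover have "C_k_on k S (\<lambda>w. frechet_derivative f (at w) v)" if "v = 1 \<or> v = \<i>" for v
      by (rule Suc.IH[of "\<lambda>w. frechet_derivative g (at w) v"]) (use Suc.prems(1) e that in auto)
    ultimately show ?case by simp
  qed
  note this[of g f] this[of f g]
  with assms(2) show ?thesis by metis
qed

lemma C_k_on_subset: "C_k_on k S f \<Longrightarrow> T \<subseteq> S \<Longrightarrow> C_k_on k T f"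
  by (induction k arbitrary: f) (auto intro: continuous_on_subset)

lemma C_k_on_SucD: "C_k_on (Suc k) S f \<Longrightarrow> C_k_on k S f"
proof (induction k arbitrary: f)
  case 0
  then show ?case
    by (auto intro!: continuous_at_imp_continuous_on differentiable_imp_continuous_within)
next
  case (Suc k)
  have *: "C_k_on k S (\<lambda>w. frechet_derivative f (at w) v)"
    if "C_k_on (Suc k) S (\<lambda>w. frechet_derivative f (at w) v)" for v by (rule Suc.IH[OF that])
  show ?case using Suc.prems unfolding C_k_on.simps(2)[of "Suc k"] C_k_on.simps(2)[of k S f]
    by (blast intro: *)
qed

lemma C_k_on_imp_continuous: "C_k_on k S f \<Longrightarrow> continuous_on S f"
  by (induction k) (auto dest: C_k_on_SucD simp del: C_k_on.simps(2))

lemma C_k_on_const: "C_k_on k S (\<lambda>w. c)"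
  by (induction k arbitrary: c) auto

lemma frechet_derivative_eqI:
  "(f has_derivative f') (at w) \<Longrightarrow> frechet_derivative f (at w) = f'"
  using frechet_derivative_at by metis

text \<open>With an explicit formula for the derivative, the closure properties below follow by induction on
  \<open>k\<close>: the formula is built from functions that are already known to be of class \<open>C\<^sup>k\<close>.\<close>

lemma C_k_on_SucI:
  assumes "open S" and "\<And>w. w \<in> S \<Longrightarrow> (f has_derivative f' w) (at w)"
    and "C_k_on k S (\<lambda>w. f' w 1)" and "C_k_on k S (\<lambda>w. f' w \<i>)"
  shows "C_k_on (Suc k) S f"
proof -
  have "frechet_derivative f (at w) = f' w" if "w \<in> S" for w
    using assms(2)[OF that] by (rule frechet_derivative_eqI)
  moreover have "f differentiable at w" if "w \<in> S" for w
    using assms(2)[OF that] by (auto simp: differentiable_def)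
  ultimately show ?thesis using assms(3,4)
    C_k_on_cong[OF assms(1), of "\<lambda>w. frechet_derivative f (at w) 1" "\<lambda>w. f' w 1" k]
    C_k_on_cong[OF assms(1), of "\<lambda>w. frechet_derivative f (at w) \<i>" "\<lambda>w. f' w \<i>" k] by auto
qed

lemma C_k_on_add:
  assumes "open S" "C_k_on k S f" "C_k_on k S g"
  shows "C_k_on k S (\<lambda>w. f w + g w)"
  using assms(2,3)
proof (induction k arbitrary: f g)
  case 0
  then show ?case by (auto intro: continuous_intros)
next
  case (Suc k)
  show ?case
    by (rule C_k_on_SucI[OF assms(1) has_derivative_add[OF has_frechet has_frechet]])
       (use Suc in auto)
qed

lemma C_k_on_mult:
  assumes "open S" "C_k_on k S f" "C_k_on k S g"
  shows "C_k_on k S (\<lambda>w. f w * g w)"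
  using assms(2,3)
proof (induction k arbitrary: f g)
  case 0
  then show ?case by (auto intro: continuous_intros)
next
  case (Suc k)
  have "C_k_on k S f" "C_k_on k S g" using Suc.prems C_k_on_SucD by blast+
  then show ?case
    by (intro C_k_on_SucI[OF assms(1), where f' = "\<lambda>w v. f w * frechet_derivative g (at w) v +
          frechet_derivative f (at w) v * g w"] C_k_on_add assms(1) Suc.IH)
       (use Suc.prems in \<open>auto intro!: has_derivative_mult has_frechet\<close>)
qed

lemma C_k_on_cnj:
  assumes "open S" "C_k_on k S f"
  shows "C_k_on k S (\<lambda>w. cnj (f w))"
  using assms(2)
proof (induction k arbitrary: f)
  case 0
  then show ?case by (auto intro: continuous_intros)
next
  case (Suc k)
  show ?case
    by (rule C_k_on_SucI[OF assms(1) has_derivative_cnj[OF has_frechet]])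
       (use Suc in auto)
qed

lemma C_k_on_inverse:
  assumes "open S" "C_k_on k S f" "\<And>w. w \<in> S \<Longrightarrow> f w \<noteq> 0"
  shows "C_k_on k S (\<lambda>w. inverse (f w))"
  using assms(2,3)
proof (induction k arbitrary: f)
  case 0
  then show ?case by (auto intro: continuous_intros)
next
  case (Suc k)
  have i: "C_k_on k S (\<lambda>w. inverse (f w))"
    by (rule Suc.IH) (use Suc.prems C_k_on_SucD in blast)+
  have d: "C_k_on k S (\<lambda>w. frechet_derivative f (at w) v)" if "v = 1 \<or> v = \<i>" for v
    using Suc.prems that by auto
  have "C_k_on k S (\<lambda>w. - 1 * (inverse (f w) * frechet_derivative f (at w) v * inverse (f w)))"
    if "v = 1 \<or> v = \<i>" for v
    by (intro C_k_on_mult assms(1) i d[OF that] C_k_on_const)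
  then show ?case
    by (intro C_k_on_SucI[OF assms(1) Deriv.has_derivative_inverse[OF _ has_frechet]])
       (use Suc.prems in simp_all)
qed

lemma holomorphic_imp_C_k_on:
  assumes "open S" "f holomorphic_on S"
  shows "C_k_on k S f"
  using assms(2)
proof (induction k arbitrary: f)
  case 0
  then show ?case by (auto intro: holomorphic_on_imp_continuous_on)
next
  case (Suc k)
  have "C_k_on k S (deriv f)" using Suc assms(1) by (blast intro: holomorphic_deriv)
  then show ?case using Suc.prems assms(1)
    by (intro C_k_on_SucI[OF assms(1), where f' = "\<lambda>w v. deriv f w * v"] C_k_on_mult C_k_on_const)
       (use holomorphic_derivI[OF Suc.prems assms(1), of _ UNIV] in \<open>simp_all add: has_field_derivative_def\<close>)
qed

section \<open>Wirtinger derivatives\<close>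

lemma wirtinger_eqI:
  assumes "(f has_derivative f') (at w)"
  shows "wirtinger f w = (f' 1 - \<i> * f' \<i>) / 2" "wirtinger_bar f w = (f' 1 + \<i> * f' \<i>) / 2"
  using assms by (simp_all add: wirtinger_def wirtinger_bar_def frechet_derivative_eqI)

lemma wirtinger_cong:
  assumes "open S" "w \<in> S" "\<And>u. u \<in> S \<Longrightarrow> f u = g u"
  shows "wirtinger f w = wirtinger g w" "wirtinger_bar f w = wirtinger_bar g w"
proof -
  have "(f has_derivative d) (at w) \<longleftrightarrow> (g has_derivative d) (at w)" for d
    using has_derivative_transform_within_open[OF _ assms(1,2), of f d UNIV g]
      has_derivative_transform_within_open[OF _ assms(1,2), of g d UNIV f] assms(3) by auto
  then have "frechet_derivative f (at w) = frechet_derivative g (at w)"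
    by (simp add: frechet_derivative_def)
  then show "wirtinger f w = wirtinger g w" "wirtinger_bar f w = wirtinger_bar g w"
    by (simp_all add: wirtinger_def wirtinger_bar_def)
qed

lemma wirtinger_add:
  assumes "f differentiable at w" "g differentiable at w"
  shows "wirtinger (\<lambda>u. f u + g u) w = wirtinger f w + wirtinger g w"
    "wirtinger_bar (\<lambda>u. f u + g u) w = wirtinger_bar f w + wirtinger_bar g w"
  using wirtinger_eqI[OF has_derivative_add[OF has_frechet[OF assms(1)] has_frechet[OF assms(2)]]]
  unfolding wirtinger_def[of f] wirtinger_def[of g] wirtinger_bar_def[of f] wirtinger_bar_def[of g]
  by (simp_all add: algebra_simps add_divide_distrib diff_divide_distrib)

lemma wirtinger_mult:
  assumes "f differentiable at w" "g differentiable at w"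
  shows "wirtinger (\<lambda>u. f u * g u) w = wirtinger f w * g w + f w * wirtinger g w"
    "wirtinger_bar (\<lambda>u. f u * g u) w = wirtinger_bar f w * g w + f w * wirtinger_bar g w"
  using wirtinger_eqI[OF has_derivative_mult[OF has_frechet[OF assms(1)] has_frechet[OF assms(2)]]]
  unfolding wirtinger_def[of f] wirtinger_def[of g] wirtinger_bar_def[of f] wirtinger_bar_def[of g]
  by (simp_all add: algebra_simps add_divide_distrib diff_divide_distrib)

lemma wirtinger_cnj_holomorphic:
  assumes "open S" "w \<in> S" "f holomorphic_on S"
  shows "wirtinger (\<lambda>u. cnj (f u)) w = 0"
proof -
  have "(f has_derivative (\<lambda>v. deriv f w * v)) (at w)"
    using holomorphic_derivI[OF assms(3,1,2), of UNIV] by (simp add: has_field_derivative_def)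
  from wirtinger_eqI(1)[OF has_derivative_cnj[OF this]] show ?thesis
    by (simp add: algebra_simps)
qed

lemma wirtinger_bar_holomorphic:
  assumes "open S" "w \<in> S" "f holomorphic_on S"
  shows "wirtinger_bar f w = 0"
proof -
  have "(f has_derivative (\<lambda>v. deriv f w * v)) (at w)"
    using holomorphic_derivI[OF assms(3,1,2), of UNIV] by (simp add: has_field_derivative_def)
  from wirtinger_eqI(2)[OF this] show ?thesis
    by (simp add: algebra_simps)
qed

lemma linear_complex_eq:
  assumes "linear (f :: complex \<Rightarrow> complex)"
  shows "f v = of_real (Re v) * f 1 + of_real (Im v) * f \<i>"
proof -
  have "v = Re v *\<^sub>R 1 + Im v *\<^sub>R \<i>" by (simp add: complex_eq_iff)
  then have "f v = f (Re v *\<^sub>R 1) + f (Im v *\<^sub>R \<i>)" using linear_add[OF assms] by metis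
  also have "\<dots> = Re v *\<^sub>R f 1 + Im v *\<^sub>R f \<i>" by (simp only: linear_scale[OF assms])
  finally show ?thesis by (simp add: scaleR_conv_of_real)
qed

text \<open>A holomorphic change of coordinates only rescales \<open>\<partial>/\<partial>\<close>conj\<open>(z)\<close>, because the inner function has no
  antiholomorphic derivative.\<close>

lemma wirtinger_bar_compose_holomorphic:
  assumes "(g has_field_derivative g') (at w)" "f differentiable at (g w)"
  shows "wirtinger_bar (f \<circ> g) w = cnj g' * wirtinger_bar f (g w)"
proof -
  let ?F = "frechet_derivative f (at (g w))"
  have l: "linear ?F" using assms(2) linear_frechet_derivative by blast
  have "((f \<circ> g) has_derivative ?F \<circ> (\<lambda>v. g' * v)) (at w)"
    using assms by (intro diff_chain_at has_frechet) (auto simp: has_field_derivative_def)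
  from wirtinger_eqI(2)[OF this]
  have "wirtinger_bar (f \<circ> g) w = (?F g' + \<i> * ?F (g' * \<i>)) / 2" by simp
  also have "\<dots> = cnj g' * wirtinger_bar f (g w)"
    unfolding wirtinger_bar_def linear_complex_eq[OF l, of g'] linear_complex_eq[OF l, of "g' * \<i>"]
    by (simp add: complex_eq_iff algebra_simps)
  finally show ?thesis .
qed

section \<open>Symmetry of second derivatives\<close>

text \<open>The second difference of \<open>f\<close> along \<open>t v\<close> and \<open>t w\<close> is symmetric in \<open>v\<close> and \<open>w\<close>; the mean value
  inequality identifies its leading term with the iterated derivative.\<close>

lemma second_difference_bound:
  fixes f :: "complex \<Rightarrow> complex"
  assumes S: "open S" "a \<in> S" and f': "\<forall>u\<in>S. f differentiable at u"
    and L: "((\<lambda>u. frechet_derivative f (at u) v) has_derivative L) (at a)"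
    and n: "norm v = 1" "norm w = 1" and e: "e > 0"
  shows "\<forall>\<^sub>F t in at_right 0.
    norm (f (a + of_real t * v + of_real t * w) - f (a + of_real t * v) - f (a + of_real t * w) + f a
      - of_real (t ^ 2) * L w) \<le> e * t ^ 2"
proof -
  have f: "f differentiable at u" if "u \<in> S" for u using f' that by blast
  have "\<exists>d>0. \<forall>y. norm (y - a) < d \<longrightarrow> norm (frechet_derivative f (at y) v - frechet_derivative f (at a) v
      - L (y - a)) \<le> e / 3 * norm (y - a)"
    using L e unfolding has_derivative_at_alt by (elim conjE allE[of _ "e / 3"]) simp
  then obtain d where d: "d > 0"
    "\<And>y. norm (y - a) < d \<Longrightarrow> norm (frechet_derivative f (at y) v - frechet_derivative f (at a) v - L (y - a))
        \<le> e / 3 * norm (y - a)"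
    by blast
  obtain r where r: "r > 0" "ball a r \<subseteq> S" using S open_contains_ball by blast
  have lin: "linear L" using L has_derivative_linear by blast
  define \<delta> where "\<delta> = min d r / 2"
  have \<delta>: "\<delta> > 0" using d r by (simp add: \<delta>_def)
  have "norm (f (a + of_real t * v + of_real t * w) - f (a + of_real t * v) - f (a + of_real t * w) + f a
      - of_real (t ^ 2) * L w) \<le> e * t ^ 2" if t: "0 < t" "t < \<delta>" for t
  proof -
    define G where "G s = f (a + of_real s * v + of_real t * w) - f (a + of_real s * v) - of_real (s * t) * L w" for s
    have s_norm: "norm (of_real s * v + of_real t * w) \<le> 2 * t" "norm (of_real s * v) \<le> t"
      if "s \<in> {0..t}" for s
      using that n norm_triangle_ineq[of "of_real s * v" "of_real t * w"] t by (auto simp: norm_mult)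
    have 2: "2 * t < d" "2 * t < r" using t by (auto simp: \<delta>_def)
    have inS: "a + of_real s * v + of_real t * w \<in> S" "a + of_real s * v \<in> S" if "s \<in> {0..t}" for s
      using s_norm[OF that] 2 t
      by (auto intro!: subsetD[OF r(2)] simp: mem_ball dist_commute[of a])
         (auto simp: dist_norm add.assoc)
    have der: "(G has_derivative (\<lambda>h. of_real h * (frechet_derivative f (at (a + of_real s * v + of_real t * w)) v
         - frechet_derivative f (at (a + of_real s * v)) v - of_real t * L w))) (at s)"
      if "s \<in> {0..t}" for s
    proof -
      have l: "linear (frechet_derivative f (at u))" if "u \<in> S" for u
        using f[OF that] linear_frechet_derivative by blast
      have sc: "frechet_derivative f (at u) (of_real h * v) = of_real h * frechet_derivative f (at u) v"
        if "u \<in> S" for u h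
        using linear_scale[OF l[OF that], of h v] by (simp add: scaleR_conv_of_real)
      have c: "((\<lambda>s. f (b + of_real s * v)) has_derivative (\<lambda>h. of_real h * frechet_derivative f (at (b + of_real s * v)) v)) (at s)"
        if "b + of_real s * v \<in> S" for b
      proof -
        have "((\<lambda>s. b + of_real s * v) has_derivative (\<lambda>h. of_real h * v)) (at s)"
          by (auto intro!: derivative_eq_intros)
        from diff_chain_at[OF this has_frechet[OF f[OF that]]] show ?thesis
          by (simp add: o_def sc[OF that])
      qed
      have "((\<lambda>s. f ((a + of_real t * w) + of_real s * v) - f (a + of_real s * v) - of_real s * (of_real t * L w)) has_derivative
         (\<lambda>h. of_real h * frechet_derivative f (at (a + of_real t * w + of_real s * v)) v - of_real h * frechet_derivative f (at (a + of_real s * v)) v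
            - of_real h * (of_real t * L w))) (at s)"
        by (intro has_derivative_diff c has_derivative_mult_left has_derivative_of_real has_derivative_ident) (use inS[OF that] in \<open>auto simp: algebra_simps\<close>)
      then show ?thesis by (simp add: G_def[abs_def] algebra_simps)
    qed
    have bnd: "norm (frechet_derivative f (at (a + of_real s * v + of_real t * w)) v
         - frechet_derivative f (at (a + of_real s * v)) v - of_real t * L w) \<le> e * t"
      if "s \<in> {0..t}" for s
    proof -
      have "L (of_real t * w) = of_real t * L w"
        using linear_scale[OF lin, of t w] by (simp add: scaleR_conv_of_real)
      then have eq: "frechet_derivative f (at (a + of_real s * v + of_real t * w)) v
         - frechet_derivative f (at (a + of_real s * v)) v - of_real t * L w
        = (frechet_derivative f (at (a + of_real s * v + of_real t * w)) v - frechet_derivative f (at a) v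
             - L (of_real s * v + of_real t * w))
         - (frechet_derivative f (at (a + of_real s * v)) v - frechet_derivative f (at a) v - L (of_real s * v))"
        by (simp add: linear_add[OF lin])
      have "norm (frechet_derivative f (at (a + of_real s * v + of_real t * w)) v - frechet_derivative f (at a) v
             - L (of_real s * v + of_real t * w)) \<le> e / 3 * (2 * t)"
        using d(2)[of "a + of_real s * v + of_real t * w"] s_norm(1)[OF that] 2 e
        by (intro order_trans[OF _ mult_left_mono[OF s_norm(1)[OF that]]]) (simp_all add: add.assoc)
      moreover have "norm (frechet_derivative f (at (a + of_real s * v)) v - frechet_derivative f (at a) v
             - L (of_real s * v)) \<le> e / 3 * t"
        using d(2)[of "a + of_real s * v"] s_norm(2)[OF that] 2 e t
        by (intro order_trans[OF _ mult_left_mono[OF s_norm(2)[OF that]]]) simp_all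
      ultimately show ?thesis unfolding eq
        by (intro order_trans[OF norm_triangle_ineq4]) (simp add: field_simps)
    qed
    have "norm (G t - G 0) \<le> e * t * norm (t - 0)"
    proof (rule differentiable_bound[where S = "{0..t}"])
      show "convex {0..t}" by simp
      show "(G has_derivative (\<lambda>h. of_real h * (frechet_derivative f (at (a + of_real s * v + of_real t * w)) v
         - frechet_derivative f (at (a + of_real s * v)) v - of_real t * L w))) (at s within {0..t})"
        if "s \<in> {0..t}" for s using der[OF that] has_derivative_at_withinI by blast
      show "onorm (\<lambda>h. of_real h * (frechet_derivative f (at (a + of_real s * v + of_real t * w)) v
         - frechet_derivative f (at (a + of_real s * v)) v - of_real t * L w)) \<le> e * t"
        if "s \<in> {0..t}" for s
        using bnd[OF that] by (intro onorm_le) (simp add: norm_mult mult.commute mult_left_mono)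
    qed (use t in auto)
    then show ?thesis using t by (simp add: G_def power2_eq_square algebra_simps)
  qed
  then show ?thesis using \<delta> by (auto simp: eventually_at_right_field)
qed

text \<open>Both iterated derivatives are limits of the same second difference divided by \<open>t\<^sup>2\<close>.\<close>

lemma frechet_derivative_symmetric:
  fixes f :: "complex \<Rightarrow> complex"
  assumes S: "open S" "a \<in> S" and f: "\<forall>u\<in>S. f differentiable at u"
    and d: "(\<lambda>u. frechet_derivative f (at u) v) differentiable at a"
      "(\<lambda>u. frechet_derivative f (at u) w) differentiable at a"
    and n: "norm v = 1" "norm w = 1"
  shows "frechet_derivative (\<lambda>u. frechet_derivative f (at u) v) (at a) w =
    frechet_derivative (\<lambda>u. frechet_derivative f (at u) w) (at a) v" (is "?A = ?B")
proof -
  have "norm (?A - ?B) \<le> e" if e: "e > 0" for e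
  proof -
    have e2: "e / 2 > 0" using e by simp
    have "\<forall>\<^sub>F t::real in at_right 0. norm (?A - ?B) \<le> e"
      using second_difference_bound[OF S f has_frechet[OF d(1)] n e2]
        second_difference_bound[OF S f has_frechet[OF d(2)] n(2,1) e2]
        eventually_at_right_less[of "0::real"]
    proof eventually_elim
      case (elim t)
      have "norm (of_real (t ^ 2) * (?A - ?B)) \<le> e / 2 * t ^ 2 + e / 2 * t ^ 2"
        using norm_triangle_le_diff[OF add_mono[OF elim(2,1)]] by (simp add: algebra_simps)
      then have "t ^ 2 * norm (?A - ?B) \<le> t ^ 2 * e"
        unfolding norm_mult norm_of_real by (simp add: mult.commute)
      then show ?case using elim(3) by simp
    qed
    then show ?thesis by simp
  qed
  then have "norm (?A - ?B) \<le> 0" by (rule field_le_epsilon) (simp)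
  then show ?thesis by simp
qed

lemma wirtinger_commute:
  assumes "open S" "a \<in> S" "C_k_on 2 S f"
  shows "wirtinger (wirtinger_bar f) a = wirtinger_bar (wirtinger f) a"
proof -
  have f: "\<forall>u\<in>S. f differentiable at u" using assms by (auto simp: numeral_2_eq_2)
  let ?x = "\<lambda>u. frechet_derivative f (at u) 1" and ?y = "\<lambda>u. frechet_derivative f (at u) \<i>"
  have d: "?x differentiable at a" "?y differentiable at a"
    using assms by (auto simp: numeral_2_eq_2)
  have "frechet_derivative ?x (at a) \<i> = frechet_derivative ?y (at a) 1"
    by (intro frechet_derivative_symmetric[OF assms(1,2) f] d) auto
  moreover have "(wirtinger f has_derivative (\<lambda>v. (frechet_derivative ?x (at a) v - \<i> * frechet_derivative ?y (at a) v) / 2)) (at a)"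
    unfolding wirtinger_def[abs_def] using has_frechet[OF d(1)] has_frechet[OF d(2)]
    by (auto intro!: derivative_eq_intros)
  moreover have "(wirtinger_bar f has_derivative (\<lambda>v. (frechet_derivative ?x (at a) v + \<i> * frechet_derivative ?y (at a) v) / 2)) (at a)"
    unfolding wirtinger_bar_def[abs_def] using has_frechet[OF d(1)] has_frechet[OF d(2)]
    by (auto intro!: derivative_eq_intros)
  ultimately show ?thesis
    by (simp add: wirtinger_eqI field_simps)
qed

section \<open>Change of variables in the plane\<close>

text \<open>The change of variables theorem speaks of the gauge integral, whereas the area is defined by the
  extended nonnegative Lebesgue integral.\<close>

lemma has_integral_iff_nn_integral_on:
  fixes g :: "'a::euclidean_space \<Rightarrow> real"
  assumes "(\<lambda>x. indicator \<Omega> x * g x) \<in> borel_measurable borel" "\<And>x. x \<in> \<Omega> \<Longrightarrow> 0 \<le> g x" "0 \<le> r"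
  shows "(g has_integral r) \<Omega> \<longleftrightarrow> (\<integral>\<^sup>+ x \<in> \<Omega>. ennreal (g x) \<partial>lborel) = ennreal r"
proof
  show "(\<integral>\<^sup>+ x \<in> \<Omega>. ennreal (g x) \<partial>lborel) = ennreal r" if "(g has_integral r) \<Omega>"
    using nn_integral_has_integral_lebesgue'[OF assms(2) that] .
  assume r: "(\<integral>\<^sup>+ x \<in> \<Omega>. ennreal (g x) \<partial>lborel) = ennreal r"
  have "(\<integral>\<^sup>+ x. ennreal (indicator \<Omega> x * g x) \<partial>lborel) = (\<integral>\<^sup>+ x \<in> \<Omega>. ennreal (g x) \<partial>lborel)"
    by (intro nn_integral_cong) (auto simp: indicator_def)
  then have "((\<lambda>x. indicator \<Omega> x * g x) has_integral r) UNIV"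
    using r assms by (intro nn_integral_has_integral) (auto simp: indicator_def)
  also have "(\<lambda>x. indicator \<Omega> x * g x) = (\<lambda>x. if x \<in> \<Omega> then g x else 0)"
    by (auto simp: indicator_def)
  finally show "(g has_integral r) \<Omega>" by (simp add: has_integral_restrict_UNIV)
qed

text \<open>These maps carry the change of variables theorem from \<open>real ^ 2\<close> to the complex plane.\<close>

definition plane_vec :: "complex \<Rightarrow> real ^ 2" where
  "plane_vec z = (\<chi> k. if k = 1 then Re z else Im z)"

definition vec_plane :: "real ^ 2 \<Rightarrow> complex" where
  "vec_plane v = Complex (v $ 1) (v $ 2)"

lemma vec_plane_inverse [simp]: "vec_plane (plane_vec z) = z" "plane_vec (vec_plane v) = v"
  by (auto simp: plane_vec_def vec_plane_def vec_eq_iff forall_2)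

lemma bounded_linear_plane_vec: "bounded_linear plane_vec"
  by (rule linear_conv_bounded_linear[THEN iffD1], rule linearI) (auto simp: plane_vec_def vec_eq_iff)

lemma bounded_linear_vec_plane: "bounded_linear vec_plane"
  by (rule linear_conv_bounded_linear[THEN iffD1], rule linearI) (auto simp: vec_plane_def complex_eq_iff)

lemma vec_plane_measurable [measurable]: "vec_plane \<in> borel_measurable borel"
  by (intro borel_measurable_continuous_onI linear_continuous_on bounded_linear_vec_plane)

lemma prod_Basis_vec2: "(\<Prod>b\<in>Basis. f b) = f (axis 1 1 :: real ^ 2) * f (axis 2 1)"
proof -
  have 1: "(Basis :: (real ^ 2) set) = {axis 1 1, axis 2 1}"
    by (auto simp: Basis_vec_def UNIV_2)
  have 2: "axis 1 1 \<noteq> (axis 2 1 :: real ^ 2)" by (simp add: axis_eq_axis)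
  show ?thesis unfolding 1 using 2 by simp
qed

lemma distr_vec_plane: "distr lborel borel vec_plane = lborel"
proof (rule lborel_eqI[symmetric])
  fix l u :: complex
  assume le: "\<And>b. b \<in> Basis \<Longrightarrow> l \<bullet> b \<le> u \<bullet> b"
  have "vec_plane -` box l u = box (plane_vec l) (plane_vec u)"
    by (auto simp: box_def vec_plane_def plane_vec_def Basis_complex_def Basis_vec_def inner_axis UNIV_2)
  then show "emeasure (distr lborel borel vec_plane) (box l u) = (\<Prod>b\<in>Basis. (u - l) \<bullet> b)"
    using le[of 1] le[of \<i>]
    by (simp add: emeasure_distr emeasure_lborel_box_eq prod_Basis_vec2 Basis_complex_def)
       (simp add: Basis_vec_def inner_axis UNIV_2 plane_vec_def)
qed simp

lemma nn_integral_vec_plane: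
  assumes "f \<in> borel_measurable borel"
  shows "(\<integral>\<^sup>+ z. f z \<partial>lborel) = (\<integral>\<^sup>+ v. f (vec_plane v) \<partial>lborel)"
  using assms by (subst distr_vec_plane[symmetric], subst nn_integral_distr) auto

text \<open>The real Jacobian of a complex map with derivative \<open>c\<close> is \<open>\<bar>c\<bar>\<^sup>2\<close>.\<close>

lemma det_complex_mult: "det (matrix (plane_vec \<circ> (\<lambda>z. c * z) \<circ> vec_plane)) = (cmod c)\<^sup>2"
  by (simp add: det_2 matrix_def plane_vec_def vec_plane_def axis_def cmod_power2)
     (simp add: power2_eq_square)

text \<open>By the change of variables theorem in \<open>real ^ 2\<close> the two integrals have the same finite values, hence
  they are also infinite together.\<close>

lemma nn_integral_change_of_variables_complex:
  fixes f :: "complex \<Rightarrow> real"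
  assumes g: "\<And>w. w \<in> S \<Longrightarrow> (g has_field_derivative g' w) (at w)"
    and k: "\<And>z. z \<in> T \<Longrightarrow> (k has_field_derivative k' z) (at z)"
    and gk: "\<And>w. w \<in> S \<Longrightarrow> g w \<in> T \<and> k (g w) = w" "\<And>z. z \<in> T \<Longrightarrow> k z \<in> S \<and> g (k z) = z"
    and inv: "\<And>z. z \<in> T \<Longrightarrow> k' z * g' (k z) = 1"
    and f: "\<And>z. z \<in> T \<Longrightarrow> 0 \<le> f z"
    and m: "(\<lambda>z. indicator T z * f z) \<in> borel_measurable borel"
      "(\<lambda>w. indicator S w * ((cmod (g' w))\<^sup>2 * f (g w))) \<in> borel_measurable borel"
  shows "(\<integral>\<^sup>+ z \<in> T. ennreal (f z) \<partial>lborel) = (\<integral>\<^sup>+ w \<in> S. ennreal ((cmod (g' w))\<^sup>2 * f (g w)) \<partial>lborel)"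
proof -
  have lift: "((plane_vec \<circ> \<phi> \<circ> vec_plane) has_derivative (plane_vec \<circ> (\<lambda>z. d * z) \<circ> vec_plane)) (at v)"
    if "(\<phi> has_field_derivative d) (at (vec_plane v))" for \<phi> d v
    using diff_chain_at[OF bounded_linear_imp_has_derivative[OF bounded_linear_vec_plane]
        diff_chain_at[OF that[unfolded has_field_derivative_def]
          bounded_linear_imp_has_derivative[OF bounded_linear_plane_vec]]]
    by (simp add: o_def)
  let ?S = "vec_plane -` S" and ?T = "vec_plane -` T"
  let ?h = "\<lambda>w. (cmod (g' w))\<^sup>2 * f (g w)"
  have cov: "((\<lambda>v. ?h (vec_plane v)) has_integral r) ?S \<longleftrightarrow> ((\<lambda>v. f (vec_plane v)) has_integral r) ?T" for r
  proof -
    have "((\<lambda>v. \<bar>det (matrix (plane_vec \<circ> (\<lambda>z. g' (vec_plane v) * z) \<circ> vec_plane))\<bar> *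
        f (vec_plane ((plane_vec \<circ> g \<circ> vec_plane) v))) has_integral r) ?S \<longleftrightarrow>
      ((\<lambda>v. f (vec_plane v)) has_integral r) ?T"
    proof (rule cov_invertible_nonneg_eq[where f = "\<lambda>v. f (vec_plane v)" and g = "plane_vec \<circ> g \<circ> vec_plane"
            and g' = "\<lambda>v. plane_vec \<circ> (\<lambda>z. g' (vec_plane v) * z) \<circ> vec_plane" and h = "plane_vec \<circ> k \<circ> vec_plane"
            and h' = "\<lambda>v. plane_vec \<circ> (\<lambda>z. k' (vec_plane v) * z) \<circ> vec_plane"])
      fix v assume "v \<in> ?S"
      then show "(plane_vec \<circ> g \<circ> vec_plane has_derivative plane_vec \<circ> (*) (g' (vec_plane v)) \<circ> vec_plane) (at v within ?S)"
        by (auto intro: has_derivative_at_withinI[OF lift] g)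
    next
      fix v assume "v \<in> ?T"
      then show "(plane_vec \<circ> k \<circ> vec_plane has_derivative plane_vec \<circ> (*) (k' (vec_plane v)) \<circ> vec_plane) (at v within ?T)"
        by (auto intro: has_derivative_at_withinI[OF lift] k)
    next
      fix v assume "v \<in> ?T"
      then have e: "k' (vec_plane v) * (g' (k (vec_plane v)) * z) = z" for z
        using inv[of "vec_plane v"] by (simp add: mult.assoc[symmetric])
      show "plane_vec \<circ> (*) (k' (vec_plane v)) \<circ> vec_plane \<circ>
          (plane_vec \<circ> (*) (g' (vec_plane ((plane_vec \<circ> k \<circ> vec_plane) v))) \<circ> vec_plane) = id"
        by (simp add: fun_eq_iff e del: mult_cancel_right2)
    qed (use gk f in auto)
    then show ?thesis by (simp add: det_complex_mult)
  qed
  have plane: "(\<integral>\<^sup>+ z \<in> \<Omega>. ennreal (F z) \<partial>lborel) = (\<integral>\<^sup>+ v \<in> vec_plane -` \<Omega>. ennreal (F (vec_plane v)) \<partial>lborel)"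
    "(\<lambda>v. indicator (vec_plane -` \<Omega>) v * F (vec_plane v)) \<in> borel_measurable borel"
    if M: "(\<lambda>z. indicator \<Omega> z * F z) \<in> borel_measurable borel" for F :: "complex \<Rightarrow> real" and \<Omega>
  proof -
    have e: "(\<integral>\<^sup>+ z \<in> \<Omega>. ennreal (F z) \<partial>lborel) = (\<integral>\<^sup>+ z. ennreal (indicator \<Omega> z * F z) \<partial>lborel)"
      "(\<integral>\<^sup>+ v \<in> vec_plane -` \<Omega>. ennreal (F (vec_plane v)) \<partial>lborel) =
        (\<integral>\<^sup>+ v. ennreal (indicator \<Omega> (vec_plane v) * F (vec_plane v)) \<partial>lborel)"
      by (auto intro!: nn_integral_cong simp: indicator_def)
    show "(\<integral>\<^sup>+ z \<in> \<Omega>. ennreal (F z) \<partial>lborel) = (\<integral>\<^sup>+ v \<in> vec_plane -` \<Omega>. ennreal (F (vec_plane v)) \<partial>lborel)"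
      unfolding e by (rule nn_integral_vec_plane) (use M in measurable)
    have "(\<lambda>v. indicator \<Omega> (vec_plane v) * F (vec_plane v)) \<in> borel_measurable borel"
      using measurable_compose[OF vec_plane_measurable M] .
    then show "(\<lambda>v. indicator (vec_plane -` \<Omega>) v * F (vec_plane v)) \<in> borel_measurable borel"
      by (simp add: indicator_def)
  qed
  have eq: "(\<integral>\<^sup>+ z \<in> T. ennreal (f z) \<partial>lborel) = ennreal r \<longleftrightarrow>
      (\<integral>\<^sup>+ w \<in> S. ennreal (?h w) \<partial>lborel) = ennreal r" if "r \<ge> 0" for r
    unfolding plane(1)[OF m(1)] plane(1)[OF m(2)]
    using cov[of r] has_integral_iff_nn_integral_on[OF plane(2)[OF m(1)] _ that]
      has_integral_iff_nn_integral_on[OF plane(2)[OF m(2)] _ that] f gk by simp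
  show ?thesis
  proof (cases "\<integral>\<^sup>+ z \<in> T. ennreal (f z) \<partial>lborel")
    case (real r)
    then show ?thesis using eq[of r] by simp
  next
    case top
    then show ?thesis using eq
      by (cases "\<integral>\<^sup>+ w \<in> S. ennreal (?h w) \<partial>lborel") auto
  qed
qed

section \<open>Integrals of derivatives over the plane\<close>

lemma integral_translate_lborel:
  fixes g :: "complex \<Rightarrow> complex"
  assumes "integrable lborel g"
  shows "integrable lborel (\<lambda>w. g (c + w))" "(\<integral>w. g (c + w) \<partial>lborel) = (\<integral>w. g w \<partial>lborel)"
proof -
  have g: "g \<in> borel_measurable borel" using assms by auto
  show "integrable lborel (\<lambda>w. g (c + w))"
    using assms integrable_distr_eq[of "(+) c" lborel borel g] g by (simp add: lborel_distr_plus)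
  show "(\<integral>w. g (c + w) \<partial>lborel) = (\<integral>w. g w \<partial>lborel)"
    using integral_distr[of "(+) c" lborel borel g] g by (simp add: lborel_distr_plus)
qed

lemma integrable_continuous_compact_support:
  fixes g :: "complex \<Rightarrow> complex"
  assumes "continuous_on UNIV g" "compact K" "\<And>w. w \<notin> K \<Longrightarrow> g w = 0"
  shows "integrable lborel g"
proof -
  have "integrable lborel (\<lambda>w. indicator K w *\<^sub>R g w)"
    using assms by (intro borel_integrable_compact) (auto intro: continuous_on_subset)
  moreover have "(\<lambda>w. indicator K w *\<^sub>R g w) = g" using assms(3) by (auto simp: indicator_def)
  ultimately show ?thesis by simp
qed

text \<open>Translation invariance of Lebesgue measure makes the integrals of all difference quotients
  vanish; compact support gives a common bound, so the derivative also has integral zero.\<close>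

lemma integral_directional_derivative_eq_0:
  fixes g :: "complex \<Rightarrow> complex"
  assumes g: "\<And>w. g differentiable at w" and K: "compact K" "\<And>w. w \<notin> K \<Longrightarrow> g w = 0"
    and cont: "continuous_on UNIV (\<lambda>w. frechet_derivative g (at w) v)" and v: "norm v = 1"
  shows "integrable lborel (\<lambda>w. frechet_derivative g (at w) v)"
    "(\<integral>w. frechet_derivative g (at w) v \<partial>lborel) = 0"
proof -
  let ?d = "\<lambda>w. frechet_derivative g (at w) v"
  have d0: "?d w = 0" if "w \<notin> K" for w
  proof -
    have "(g has_derivative (\<lambda>_. 0)) (at w)"
      by (rule has_derivative_transform_within_open[OF has_derivative_const[of 0], of "- K"])
         (use K that in \<open>auto simp: compact_imp_closed open_Compl\<close>)
    then show ?thesis by (simp add: frechet_derivative_eqI)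
  qed
  show int: "integrable lborel ?d"
    by (rule integrable_continuous_compact_support[OF cont K(1) d0])
  have gc: "continuous_on UNIV g"
    using g by (auto intro!: continuous_at_imp_continuous_on differentiable_imp_continuous_within)
  have gi: "integrable lborel g"
    by (rule integrable_continuous_compact_support[OF gc K])
  have "bounded (?d ` K)"
    using K(1) cont by (intro compact_imp_bounded compact_continuous_image) (auto intro: continuous_on_subset)
  then obtain B where "B > 0" "\<And>w. w \<in> K \<Longrightarrow> norm (?d w) \<le> B" by (auto simp: bounded_pos)
  then have B: "B \<ge> 0" "\<And>w. norm (?d w) \<le> B" using d0 by (metis less_imp_le norm_zero)+
  obtain R where R: "\<And>w. w \<in> K \<Longrightarrow> norm w \<le> R" using compact_imp_bounded[OF K(1)] by (auto simp: bounded_iff)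
  have der: "((\<lambda>t. g (of_real t * v + w)) has_vector_derivative ?d (of_real t * v + w)) (at t)" for t w
  proof -
    have l: "linear (frechet_derivative g (at u))" for u using g linear_frechet_derivative by blast
    have "((\<lambda>t. of_real t * v + w) has_derivative (\<lambda>h. of_real h * v)) (at t)"
      by (auto intro!: derivative_eq_intros)
    from diff_chain_at[OF this has_frechet[OF g]] linear_scale[OF l, of "of_real t * v + w" _ v] show ?thesis
      by (simp add: has_vector_derivative_def o_def scaleR_conv_of_real)
  qed
  define q where "q n w = of_nat (Suc n) * (g (of_real (1 / Suc n) * v + w) - g w)" for n w
  have "(\<lambda>n. integral\<^sup>L lborel (q n)) \<longlonglongrightarrow> integral\<^sup>L lborel ?d"
  proof (rule integral_dominated_convergence[where w = "\<lambda>w. B * indicator (cball 0 (R + 1)) w"])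
    show "?d \<in> borel_measurable lborel" using int by auto
    show "q n \<in> borel_measurable lborel" for n
      using integral_translate_lborel(1)[OF gi] gi unfolding q_def[abs_def]
      by (intro borel_measurable_times borel_measurable_diff borel_measurable_const) auto
    show "integrable lborel (\<lambda>w. B * indicator (cball 0 (R + 1)) w :: real)"
      by (intro integrable_mult_right integrable_real_indicator)
         (use emeasure_bounded_finite[of "cball 0 (R + 1)"] in auto)
    show "AE w in lborel. (\<lambda>n. q n w) \<longlonglongrightarrow> ?d w"
    proof (intro AE_I2)
      fix w
      let ?F = "\<lambda>h. norm (g (of_real (0 + h) * v + w) - g (of_real 0 * v + w) - h *\<^sub>R ?d (of_real 0 * v + w)) / norm h"
      have "(?F \<longlongrightarrow> 0) (at 0)"
        using der[of w 0] unfolding has_vector_derivative_def has_derivative_at by blast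
      moreover have "filterlim (\<lambda>n. 1 / real (Suc n)) (at 0) sequentially"
        unfolding filterlim_at using LIMSEQ_inverse_real_of_nat by (auto simp: inverse_eq_divide)
      ultimately have F: "(\<lambda>n. ?F (1 / real (Suc n))) \<longlonglongrightarrow> 0" by (rule filterlim_compose)
      have eq: "?F (1 / real (Suc n)) = norm (q n w - ?d w)" for n
      proof -
        let ?t = "1 / real (Suc n)"
        have "q n w - ?d w = of_nat (Suc n) * (g (of_real ?t * v + w) - g w - ?t *\<^sub>R ?d w)"
          by (simp add: q_def scaleR_conv_of_real field_simps del: of_nat_Suc)
        then show ?thesis by (simp add: norm_mult del: of_nat_Suc)
      qed
      show "(\<lambda>n. q n w) \<longlonglongrightarrow> ?d w"
        using F unfolding eq by (rule LIM_zero_cancel[OF tendsto_norm_zero_cancel])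
    qed
    show "AE w in lborel. norm (q n w) \<le> B * indicator (cball 0 (R + 1)) w" for n
    proof (intro AE_I2)
      fix w
      let ?t = "1 / real (Suc n)"
      have t: "0 < ?t" "?t \<le> 1" by auto
      have "norm (g (of_real ?t * v + w) - g (of_real 0 * v + w)) \<le> B * norm (?t - 0)"
      proof (rule differentiable_bound[where S = "{0..?t}" and f = "\<lambda>t. g (of_real t * v + w)"])
        show "((\<lambda>t. g (of_real t * v + w)) has_derivative (\<lambda>h. h *\<^sub>R ?d (of_real t * v + w))) (at t within {0..?t})" for t
          using der[of w t] by (simp add: has_vector_derivative_def has_derivative_at_withinI)
        show "onorm (\<lambda>h. h *\<^sub>R ?d (of_real t * v + w)) \<le> B" for t
          using mult_right_mono[OF B(2) abs_ge_zero] by (intro onorm_le) (simp add: mult.commute)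
      qed (use t in auto)
      then have "norm (q n w) \<le> B"
        unfolding q_def norm_mult norm_of_nat by (simp add: pos_le_divide_eq mult.commute del: of_nat_Suc)
      moreover have "q n w = 0" if "norm w > R + 1"
      proof -
        have "norm w \<le> norm (of_real ?t * v + w) + norm (of_real ?t * v)"
          by (metis add_diff_cancel_left' norm_triangle_ineq4)
        moreover have "norm (of_real ?t * v) \<le> 1"
          unfolding norm_mult norm_of_real v using t by simp
        ultimately have "norm (of_real ?t * v + w) > R" using that by linarith
        then have "of_real ?t * v + w \<notin> K" "w \<notin> K" using R that by force+
        then show ?thesis using K(2) by (simp add: q_def)
      qed
      ultimately show "norm (q n w) \<le> B * indicator (cball 0 (R + 1)) w"
        by (auto simp: indicator_def dist_norm)
    qed
  qed
  moreover have "integral\<^sup>L lborel (q n) = 0" for n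
    unfolding q_def[abs_def] using integral_translate_lborel[OF gi] gi by simp
  ultimately show "integral\<^sup>L lborel ?d = 0"
    by (simp add: LIMSEQ_const_iff)
qed

lemma integral_wirtinger_bar_eq_0:
  assumes "C_k_on 1 UNIV g" "compact K" "\<And>w. w \<notin> K \<Longrightarrow> g w = 0"
  shows "(\<integral>w. wirtinger_bar g w \<partial>lborel) = 0"
proof -
  have g: "\<And>w. g differentiable at w" "continuous_on UNIV (\<lambda>w. frechet_derivative g (at w) 1)"
     "continuous_on UNIV (\<lambda>w. frechet_derivative g (at w) \<i>)" using assms(1) by auto
  note 1 = integral_directional_derivative_eq_0[OF g(1) assms(2,3) g(2)]
    and 2 = integral_directional_derivative_eq_0[OF g(1) assms(2,3) g(3)]
  show ?thesis unfolding wirtinger_bar_def using 1 2 by simp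
qed

section \<open>Cutoff functions and Borel preimages\<close>

lemma C_k_on_open_Un:
  assumes "open S" "open T" "C_k_on k S f" "C_k_on k T f"
  shows "C_k_on k (S \<union> T) f"
  using assms(3,4)
proof (induction k arbitrary: f)
  case 0
  then show ?case using continuous_on_open_Un assms(1,2) by auto
next
  case (Suc k)
  then show ?case by (auto simp: ball_Un)
qed

text \<open>The function \<open>x \<mapsto> max(0, x)\<^sup>2\<close> is of class \<open>C\<^sup>1\<close>. Stokes' theorem below is for forms of
  that class, so composing this function with polynomials gives sufficiently regular cutoffs.\<close>

lemma has_derivative_max0_square:
  "((\<lambda>x::real. (max 0 x)\<^sup>2) has_field_derivative 2 * max 0 x) (at x)"
proof -
  consider "x < 0" | "x > 0" | "x = 0" by linarith
  then show ?thesis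
  proof cases
    case 1
    have "((\<lambda>x::real. (max 0 x)\<^sup>2) has_field_derivative 0) (at x)"
      by (rule has_field_derivative_transform_within_open[OF DERIV_const[of 0], of "{..<0}"])
         (use 1 in auto)
    then show ?thesis using 1 by simp
  next
    case 2
    have "((\<lambda>x::real. x\<^sup>2) has_field_derivative 2 * x) (at x)"
      by (auto intro!: derivative_eq_intros)
    then have "((\<lambda>x::real. (max 0 x)\<^sup>2) has_field_derivative 2 * x) (at x)"
      by (rule has_field_derivative_transform_within_open[of _ _ _ "{0<..}"]) (use 2 in auto)
    then show ?thesis using 2 by simp
  next
    case 3
    have "((\<lambda>y::real. max 0 y) \<longlongrightarrow> max 0 0) (at 0)"
      by (intro tendsto_max tendsto_const tendsto_ident_at)
    moreover have "(max 0 y)\<^sup>2 / y = max 0 y" for y :: real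
      by (simp add: max_def power2_eq_square)
    ultimately show ?thesis unfolding 3 by (simp add: DERIV_def)
  qed
qed

lemma C_1_on_max0_square:
  assumes "open S" "C_k_on 1 S f"
  shows "C_k_on 1 S (\<lambda>w. of_real ((max 0 (Re (f w)))\<^sup>2))"
proof -
  have f: "f differentiable at w" if "w \<in> S" for w using assms that by auto
  have der: "((\<lambda>w. complex_of_real ((max 0 (Re (f w)))\<^sup>2)) has_derivative
     (\<lambda>v. of_real (2 * max 0 (Re (f w)) * Re (frechet_derivative f (at w) v)))) (at w)"
    if "w \<in> S" for w
    using has_derivative_of_real[OF has_derivative_compose[OF has_derivative_Re[OF has_frechet[OF f[OF that]]]
       has_derivative_max0_square[unfolded has_field_derivative_def]], where 'a = complex] by simp
  have c: "continuous_on S f" using assms(2) by (rule C_k_on_imp_continuous)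
  show ?thesis unfolding One_nat_def
    by (rule C_k_on_SucI[OF assms(1) der]) (use assms c in \<open>auto intro!: continuous_intros\<close>)
qed

lemma borel_Int_vimage_continuous_on:
  assumes "continuous_on A f" "A \<in> sets borel" "B \<in> sets borel"
  shows "A \<inter> f -` B \<in> sets borel"
proof -
  have "f -` B \<inter> space (restrict_space borel A) \<in> sets (restrict_space borel A)"
    by (rule measurable_sets[OF borel_measurable_continuous_on_restrict[OF assms(1)] assms(3)])
  then have "f -` B \<inter> A \<in> sets (restrict_space borel A)" by (simp add: space_restrict_space)
  then have "f -` B \<inter> A \<in> sets borel"
    using assms(2) by (subst (asm) sets_restrict_space_iff) auto
  then show ?thesis by (simp add: Int_commute)
qed

section \<open>Charts and transition functions\<close>

locale compact_kaehler_surface =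
  fixes M :: "('i, 'm::t2_space) surface" and \<rho> :: "'i \<Rightarrow> 'm \<Rightarrow> real"
  assumes surface: "riemann_surface M" and kaehler: "kaehler_metric M \<rho>"
    and compact_M: "compact (UNIV :: 'm set)"
begin

text \<open>The chart \<open>z i\<close> maps \<open>D i\<close> onto an open set with inverse \<open>zinv i\<close>, and \<open>T i j\<close> is \<open>dz\<^sub>i/dz\<^sub>j\<close>.\<close>

abbreviation "D \<equiv> dom M"
abbreviation "z \<equiv> chart M"
abbreviation "zinv \<equiv> chart_inv M"
abbreviation "T \<equiv> transition_deriv M"

lemma open_dom: "open (D i)" and open_chart: "open (z i ` D i)"
  and ex_dom: "\<exists>i. p \<in> D i"
  using surface unfolding riemann_surface_def by auto

lemma chart_homeomorphism: "homeomorphism (D i) (z i ` D i) (z i) (zinv i)"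
  using surface unfolding riemann_surface_def by blast

lemma chart_inv_chart [simp]: "p \<in> D i \<Longrightarrow> zinv i (z i p) = p"
  using chart_homeomorphism[of i] by (simp add: homeomorphism_def)

lemma continuous_chart: "continuous_on (D i) (z i)"
  and continuous_chart_inv: "continuous_on (z i ` D i) (zinv i)"
  using chart_homeomorphism[of i] by (auto simp: homeomorphism_def)

lemma chart_image_eq: "z i ` (D i \<inter> W) = z i ` D i \<inter> zinv i -` W"
  by auto

lemma open_chart_image: "open W \<Longrightarrow> open (z i ` (D i \<inter> W))"
  unfolding chart_image_eq
  by (rule continuous_open_preimage[OF continuous_chart_inv open_chart])

lemma transition_holomorphic: "(z j \<circ> zinv i) holomorphic_on z i ` (D i \<inter> D j)"
  using surface unfolding riemann_surface_def by blast

lemma transition_has_derivative: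
  assumes "p \<in> D i" "p \<in> D j"
  shows "((z i \<circ> zinv j) has_field_derivative T i j p) (at (z j p))"
  unfolding transition_deriv_def using assms
  by (intro holomorphic_derivI[OF transition_holomorphic open_chart_image[OF open_dom]]) auto

lemma transition_deriv_inverse:
  assumes "p \<in> D i" "p \<in> D j"
  shows "T i j p * T j i p = 1"
proof -
  have "((z i \<circ> zinv j) \<circ> (z j \<circ> zinv i) has_field_derivative T i j p * T j i p) (at (z i p))"
    using assms transition_has_derivative[OF assms] transition_has_derivative[OF assms(2,1)]
    by (intro DERIV_chain) auto
  moreover have "((z i \<circ> zinv j) \<circ> (z j \<circ> zinv i) has_field_derivative 1) (at (z i p))"
    using assms
    by (intro has_field_derivative_transform_within_open[OF DERIV_ident open_chart_image[OF open_dom, of i j]])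
       auto
  ultimately show ?thesis by (rule DERIV_unique)
qed

lemma transition_deriv_nonzero: "p \<in> D i \<Longrightarrow> p \<in> D j \<Longrightarrow> T i j p \<noteq> 0"
  using transition_deriv_inverse by fastforce

lemma transition_deriv_holomorphic: "(T i j \<circ> zinv j) holomorphic_on z j ` (D j \<inter> D i)"
proof -
  have "deriv (z i \<circ> zinv j) holomorphic_on z j ` (D j \<inter> D i)"
    by (intro holomorphic_deriv transition_holomorphic open_chart_image open_dom)
  then show ?thesis
    by (rule holomorphic_transform) (auto simp: transition_deriv_def)
qed

lemma rho_pos: "p \<in> D i \<Longrightarrow> \<rho> i p > 0"
  using kaehler unfolding kaehler_metric_def by blast

lemma rho_transition: "p \<in> D i \<Longrightarrow> p \<in> D j \<Longrightarrow> \<rho> j p = (cmod (T i j p))\<^sup>2 * \<rho> i p"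
  using kaehler unfolding kaehler_metric_def by blast

lemma chart_value_eq:
  assumes "p \<in> D i" "\<And>j. p \<in> D j \<Longrightarrow> f j = f i"
  shows "chart_value M f p = f i"
  unfolding chart_value_def using assms by (intro the_equality) metis+

section \<open>Functions on the surface\<close>

definition C_fun :: "nat \<Rightarrow> 'm set \<Rightarrow> ('m \<Rightarrow> complex) \<Rightarrow> bool" where
  "C_fun k W f \<longleftrightarrow> (\<forall>i. C_k_on k (z i ` (D i \<inter> W)) (f \<circ> zinv i))"

lemma smooth_fun_iff: "smooth_fun M W f \<longleftrightarrow> (\<forall>k. C_fun k W f)"
  by (auto simp: smooth_fun_def C_fun_def smooth_on_def)

lemma C_fun_cong:
  assumes "open W" "\<And>p. p \<in> W \<Longrightarrow> f p = g p" "C_fun k W g"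
  shows "C_fun k W f"
  unfolding C_fun_def
proof
  fix i
  show "C_k_on k (z i ` (D i \<inter> W)) (f \<circ> zinv i)"
    by (rule C_k_on_cong[OF open_chart_image[OF assms(1)], THEN iffD2, of i "f \<circ> zinv i" "g \<circ> zinv i"])
       (use assms(2,3) in \<open>auto simp: C_fun_def\<close>)
qed

lemma C_fun_subset: "C_fun k W f \<Longrightarrow> V \<subseteq> W \<Longrightarrow> C_fun k V f"
  unfolding C_fun_def by (meson C_k_on_subset image_mono Int_mono order_refl)

lemma C_fun_const: "C_fun k W (\<lambda>p. c)"
  by (simp add: C_fun_def o_def C_k_on_const)

lemma C_fun_add: "open W \<Longrightarrow> C_fun k W f \<Longrightarrow> C_fun k W g \<Longrightarrow> C_fun k W (\<lambda>p. f p + g p)"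
  using C_k_on_add[OF open_chart_image] by (auto simp: C_fun_def o_def)

lemma C_fun_mult: "open W \<Longrightarrow> C_fun k W f \<Longrightarrow> C_fun k W g \<Longrightarrow> C_fun k W (\<lambda>p. f p * g p)"
  using C_k_on_mult[OF open_chart_image] by (auto simp: C_fun_def o_def)

lemma C_fun_cnj: "open W \<Longrightarrow> C_fun k W f \<Longrightarrow> C_fun k W (\<lambda>p. cnj (f p))"
  using C_k_on_cnj[OF open_chart_image] by (auto simp: C_fun_def o_def)

lemma C_fun_inverse:
  assumes "open W" "C_fun k W f" "\<And>p. p \<in> W \<Longrightarrow> f p \<noteq> 0"
  shows "C_fun k W (\<lambda>p. inverse (f p))"
  unfolding C_fun_def
proof
  fix i
  show "C_k_on k (z i ` (D i \<inter> W)) ((\<lambda>p. inverse (f p)) \<circ> zinv i)"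
    unfolding o_def
    by (rule C_k_on_inverse[OF open_chart_image[OF assms(1)]]) (use assms in \<open>auto simp: C_fun_def o_def\<close>)
qed

lemma C_fun_continuous:
  assumes "open W" "C_fun k W f"
  shows "continuous_on W f"
proof -
  have "isCont f p" if "p \<in> W" for p
  proof -
    obtain i where i: "p \<in> D i" using ex_dom by blast
    have "continuous_on (z i ` (D i \<inter> W)) (f \<circ> zinv i)"
      using assms(2) unfolding C_fun_def by (blast intro: C_k_on_imp_continuous)
    moreover have "continuous_on (D i \<inter> W) (z i)"
      using continuous_chart by (rule continuous_on_subset) auto
    ultimately have "continuous_on (D i \<inter> W) ((f \<circ> zinv i) \<circ> z i)"
      by (rule continuous_on_compose[rotated])
    then have "continuous_on (D i \<inter> W) f" by (rule continuous_on_eq) simp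
    then show ?thesis
      using i that assms(1) open_dom by (simp add: continuous_on_eq_continuous_at open_Int)
  qed
  then show ?thesis by (simp add: continuous_at_imp_continuous_on)
qed

lemma C_fun_differentiable:
  assumes "C_fun 1 W f" "p \<in> W" "p \<in> D i"
  shows "(f \<circ> zinv i) differentiable at (z i p)"
  using assms by (auto simp: C_fun_def)

lemma del_cong:
  assumes "open W" "p \<in> W" "p \<in> D i" "\<And>q. q \<in> W \<Longrightarrow> f q = g q"
  shows "del M i f p = del M i g p" "delbar M i f p = delbar M i g p"
  unfolding del_def delbar_def
  by (rule wirtinger_cong[OF open_chart_image[OF assms(1), of i]]; use assms in auto)+

lemma del_add:
  assumes "(f \<circ> zinv i) differentiable at (z i p)" "(g \<circ> zinv i) differentiable at (z i p)"
  shows "del M i (\<lambda>q. f q + g q) p = del M i f p + del M i g p"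
    "delbar M i (\<lambda>q. f q + g q) p = delbar M i f p + delbar M i g p"
  using wirtinger_add[OF assms] by (simp_all add: del_def delbar_def o_def)

lemma del_mult:
  assumes "(f \<circ> zinv i) differentiable at (z i p)" "(g \<circ> zinv i) differentiable at (z i p)" "p \<in> D i"
  shows "del M i (\<lambda>q. f q * g q) p = del M i f p * g p + f p * del M i g p"
    "delbar M i (\<lambda>q. f q * g q) p = delbar M i f p * g p + f p * delbar M i g p"
  using wirtinger_mult[OF assms(1,2)] assms(3) by (simp_all add: del_def delbar_def o_def)

lemma delbar_const: "delbar M i (\<lambda>q. c) p = 0"
  by (simp add: delbar_def wirtinger_bar_def o_def)

text \<open>Differentiability in one chart gives it in every chart, and \<open>\<partial>f/\<partial>\<close>conj\<open>(z\<^sub>i)\<close> transforms like the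
  coefficient of a \<open>(0,1)\<close>-form.\<close>

lemma delbar_transition:
  assumes p: "p \<in> D i" "p \<in> D j" and f: "(f \<circ> zinv i) differentiable at (z i p)"
  shows "(f \<circ> zinv j) differentiable at (z j p)" "delbar M j f p = cnj (T i j p) * delbar M i f p"
proof -
  have e: "((f \<circ> zinv i) \<circ> (z i \<circ> zinv j)) w = (f \<circ> zinv j) w" if "w \<in> z j ` (D j \<inter> D i)" for w
    using that by auto
  have w: "z j p \<in> z j ` (D j \<inter> D i)" using p by auto
  have d: "((f \<circ> zinv i) \<circ> (z i \<circ> zinv j)) differentiable at (z j p)"
  proof (rule differentiable_chain_at)
    show "(z i \<circ> zinv j) differentiable at (z j p)"
      using transition_has_derivative[OF p] unfolding has_field_derivative_def differentiable_def by blast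
  qed (use f p in simp)
  show "(f \<circ> zinv j) differentiable at (z j p)"
    unfolding differentiable_def
    by (rule exI, rule has_derivative_transform_within_open[OF has_frechet[OF d] open_chart_image[OF open_dom] w])
       (simp only: e)
  have "delbar M j f p = wirtinger_bar ((f \<circ> zinv i) \<circ> (z i \<circ> zinv j)) (z j p)"
    unfolding delbar_def
    by (rule wirtinger_cong(2)[OF open_chart_image[OF open_dom] w]) (simp only: e)
  also have "\<dots> = cnj (T i j p) * delbar M i f p"
    using wirtinger_bar_compose_holomorphic[OF transition_has_derivative[OF p], of "f \<circ> zinv i"] f p
    by (simp add: delbar_def)
  finally show "delbar M j f p = cnj (T i j p) * delbar M i f p" .
qed

lemma holomorphic_imp_C_fun:
  assumes "open W" "\<And>i. (f \<circ> zinv i) holomorphic_on z i ` (D i \<inter> W)"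
  shows "C_fun k W f"
  unfolding C_fun_def using assms holomorphic_imp_C_k_on[OF open_chart_image[OF assms(1)]] by blast

lemma C_fun_transition_deriv: "C_fun k (D i \<inter> D j) (T i j)"
proof (rule holomorphic_imp_C_fun)
  fix l
  have "((T i j \<circ> zinv j) \<circ> (z j \<circ> zinv l)) holomorphic_on z l ` (D l \<inter> (D i \<inter> D j))"
    by (rule holomorphic_on_compose_gen[OF _ transition_deriv_holomorphic])
       (auto intro: holomorphic_on_subset[OF transition_holomorphic])
  then show "(T i j \<circ> zinv l) holomorphic_on z l ` (D l \<inter> (D i \<inter> D j))"
    by (rule holomorphic_transform) auto
qed (simp add: open_dom open_Int)

lemma delbar_transition_deriv:
  assumes "p \<in> D i" "p \<in> D j"
  shows "delbar M j (T i j) p = 0"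
  unfolding delbar_def
  by (rule wirtinger_bar_holomorphic[OF open_chart_image[OF open_dom] _
        transition_deriv_holomorphic]) (use assms in auto)

lemma del_cnj_transition_deriv:
  assumes "p \<in> D i" "p \<in> D j"
  shows "del M j (\<lambda>q. cnj (T i j q)) p = 0"
  unfolding del_def o_def
  by (rule wirtinger_cnj_holomorphic[OF open_chart_image[OF open_dom] _
        transition_deriv_holomorphic[unfolded o_def]]) (use assms in auto)

lemma smooth_funI: "(\<And>k. C_fun k W f) \<Longrightarrow> smooth_fun M W f"
  by (simp add: smooth_fun_iff)

lemma smooth_fun_subset: "smooth_fun M W f \<Longrightarrow> V \<subseteq> W \<Longrightarrow> smooth_fun M V f"
  unfolding smooth_fun_iff using C_fun_subset by blast

lemma smooth_fun_differentiable:
  "smooth_fun M W f \<Longrightarrow> p \<in> W \<Longrightarrow> p \<in> D i \<Longrightarrow> (f \<circ> zinv i) differentiable at (z i p)"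
  using C_fun_differentiable unfolding smooth_fun_iff by blast

lemma del_delbar_commute:
  assumes f: "smooth_fun M W f" and W: "open W" "p \<in> W" "p \<in> D i"
  shows "(del M i f \<circ> zinv i) differentiable at (z i p)" "(delbar M i f \<circ> zinv i) differentiable at (z i p)"
    "del M i (delbar M i f) p = delbar M i (del M i f) p"
proof -
  let ?S = "z i ` (D i \<inter> W)" and ?f = "f \<circ> zinv i"
  have S: "open ?S" "z i p \<in> ?S" using open_chart_image[OF W(1)] W by auto
  have c2: "C_k_on 2 ?S ?f" using f unfolding smooth_fun_iff C_fun_def by blast
  have e: "del M i f (zinv i w) = wirtinger ?f w" "delbar M i f (zinv i w) = wirtinger_bar ?f w"
    if "w \<in> ?S" for w using that by (auto simp: del_def delbar_def)
  have d: "(\<lambda>w. frechet_derivative ?f (at w) v) differentiable at (z i p)" if "v = 1 \<or> v = \<i>" for v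
    using c2 S(2) that by (auto simp: numeral_2_eq_2)
  have w: "wirtinger ?f differentiable at (z i p)" "wirtinger_bar ?f differentiable at (z i p)"
    unfolding wirtinger_def[abs_def] wirtinger_bar_def[abs_def] using d[of 1] d[of \<i>]
    by (auto intro!: derivative_intros)
  have tr: "g' differentiable at (z i p)" if "g differentiable at (z i p)" "\<And>w. w \<in> ?S \<Longrightarrow> g w = g' w"
    for g g' :: "complex \<Rightarrow> complex"
    using has_derivative_transform_within_open[OF has_frechet[OF that(1)] S that(2)]
    unfolding differentiable_def by blast
  show "(del M i f \<circ> zinv i) differentiable at (z i p)" "(delbar M i f \<circ> zinv i) differentiable at (z i p)"
    by (rule tr[OF w(1)], simp only: e o_apply, rule tr[OF w(2)], simp only: e o_apply)
  have "del M i (delbar M i f) p = wirtinger (wirtinger_bar ?f) (z i p)"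
    unfolding del_def by (rule wirtinger_cong(1)[OF S]) (simp only: e o_apply)
  also have "\<dots> = wirtinger_bar (wirtinger ?f) (z i p)" by (rule wirtinger_commute[OF S c2])
  also have "\<dots> = delbar M i (del M i f) p"
    unfolding delbar_def[of M i "del M i f"] by (rule wirtinger_cong(2)[OF S]) (simp only: e o_apply)
  finally show "del M i (delbar M i f) p = delbar M i (del M i f) p" .
qed

section \<open>The area measure\<close>

lemma borel_dom: "D i \<in> sets borel" and borel_chart: "z i ` D i \<in> sets borel"
  using open_dom open_chart by auto

lemma borel_chart_image: "B \<in> sets borel \<Longrightarrow> z i ` (D i \<inter> B) \<in> sets borel"
  unfolding chart_image_eq
  by (rule borel_Int_vimage_continuous_on[OF continuous_chart_inv borel_chart])

lemma continuous_rho: "continuous_on (z i ` D i) (\<lambda>w. \<rho> i (zinv i w))"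
proof -
  have "C_fun 0 (D i) (\<lambda>p. complex_of_real (\<rho> i p))"
    using kaehler unfolding kaehler_metric_def smooth_fun_iff by blast
  then have "continuous_on (z i ` (D i \<inter> D i)) ((\<lambda>p. complex_of_real (\<rho> i p)) \<circ> zinv i)"
    unfolding C_fun_def C_k_on.simps by blast
  then have "continuous_on (z i ` D i) (\<lambda>w. Re (complex_of_real (\<rho> i (zinv i w))))"
    by (intro continuous_on_Re) (simp add: o_def)
  then show ?thesis by simp
qed

lemma borel_rho [measurable]:
  "B \<in> sets borel \<Longrightarrow> (\<lambda>w. indicator (z i ` (D i \<inter> B)) w * \<rho> i (zinv i w)) \<in> borel_measurable borel"
  using borel_measurable_continuous_on_indicator[OF borel_chart_image
     continuous_on_subset[OF continuous_rho], of B i] by auto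

text \<open>The density vanishes off the image of the chart, so the value \<open>undefined\<close> carries no mass.\<close>

definition chart_area :: "'i \<Rightarrow> 'm measure" where
  "chart_area i = distr (density lborel (\<lambda>w. ennreal (indicator (z i ` D i) w * \<rho> i (zinv i w)))) borel
     (\<lambda>w. if w \<in> z i ` D i then zinv i w else undefined)"

lemma measurable_chart_inv [measurable]:
  "(\<lambda>w. if w \<in> z i ` D i then zinv i w else undefined) \<in> borel_measurable borel"
  by (rule borel_measurable_continuous_on_if[OF borel_chart continuous_chart_inv]) (rule continuous_on_const)

lemma borel_rho' [measurable]: "(\<lambda>w. indicator (z i ` D i) w * \<rho> i (zinv i w)) \<in> borel_measurable borel"
  using borel_rho[of UNIV i] by simp

lemma sets_chart_area [simp]: "sets (chart_area i) = sets borel"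
  by (simp add: chart_area_def)

lemma emeasure_chart_area:
  assumes "B \<in> sets borel"
  shows "emeasure (chart_area i) B = (\<integral>\<^sup>+ w \<in> z i ` (D i \<inter> B). ennreal (\<rho> i (zinv i w)) \<partial>lborel)"
proof -
  let ?v = "\<lambda>w. if w \<in> z i ` D i then zinv i w else undefined"
  have v: "?v -` B \<inter> space borel \<in> sets borel"
    by (rule measurable_sets[OF measurable_chart_inv assms])
  have "emeasure (chart_area i) B =
      (\<integral>\<^sup>+ w. ennreal (indicator (z i ` D i) w * \<rho> i (zinv i w)) * indicator (?v -` B) w \<partial>lborel)"
    unfolding chart_area_def using v assms
    by (subst emeasure_distr) (auto simp: emeasure_density)
  also have "\<dots> = (\<integral>\<^sup>+ w \<in> z i ` (D i \<inter> B). ennreal (\<rho> i (zinv i w)) \<partial>lborel)"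
    by (intro nn_integral_cong) (auto simp: indicator_def)
  finally show ?thesis .
qed

text \<open>The Jacobian \<open>\<bar>T j i\<bar>\<^sup>2\<close> of a transition map is exactly the factor by which the densities \<open>\<rho>\<close> differ,
  so the measures of two charts agree on the overlap.\<close>

lemma chart_area_transition:
  assumes B: "B \<in> sets borel" "B \<subseteq> D i" "B \<subseteq> D j"
  shows "emeasure (chart_area i) B = emeasure (chart_area j) B"
proof -
  have e: "D i \<inter> B = B" "D j \<inter> B = B" using B by auto
  have pt: "\<exists>q. q \<in> B \<and> q \<in> D i \<and> q \<in> D j \<and> w = z l q" if "w \<in> z l ` B" for w l
    using that B by auto
  have rho: "(cmod (T j i (zinv i w)))\<^sup>2 * \<rho> j (zinv j ((z j \<circ> zinv i) w)) = \<rho> i (zinv i w)" if "w \<in> z i ` B" for w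
    using pt[OF that] by (auto simp flip: rho_transition)
  have "emeasure (chart_area j) B = (\<integral>\<^sup>+ w \<in> z j ` B. ennreal (\<rho> j (zinv j w)) \<partial>lborel)"
    using emeasure_chart_area[OF B(1), of j] by (simp add: e)
  also have "\<dots> = (\<integral>\<^sup>+ w \<in> z i ` B. ennreal ((cmod (T j i (zinv i w)))\<^sup>2 * \<rho> j (zinv j ((z j \<circ> zinv i) w))) \<partial>lborel)"
  proof (rule nn_integral_change_of_variables_complex[where k = "z i \<circ> zinv j" and k' = "\<lambda>u. T i j (zinv j u)"])
    show "((z j \<circ> zinv i) has_field_derivative T j i (zinv i w)) (at w)" if "w \<in> z i ` B" for w
      using pt[OF that] by (auto intro: transition_has_derivative)
    show "((z i \<circ> zinv j) has_field_derivative T i j (zinv j w)) (at w)" if "w \<in> z j ` B" for w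
      using pt[OF that] by (auto intro: transition_has_derivative)
    show "(z j \<circ> zinv i) w \<in> z j ` B \<and> (z i \<circ> zinv j) ((z j \<circ> zinv i) w) = w" if "w \<in> z i ` B" for w
      using pt[OF that] by auto
    show "(z i \<circ> zinv j) w \<in> z i ` B \<and> (z j \<circ> zinv i) ((z i \<circ> zinv j) w) = w" if "w \<in> z j ` B" for w
      using pt[OF that] by auto
    show "T i j (zinv j w) * T j i (zinv i ((z i \<circ> zinv j) w)) = 1" if "w \<in> z j ` B" for w
      using pt[OF that] by (auto intro: transition_deriv_inverse)
    show "0 \<le> \<rho> j (zinv j w)" if "w \<in> z j ` B" for w
      using pt[OF that] by (auto intro: rho_pos[THEN less_imp_le])
    show "(\<lambda>w. indicator (z j ` B) w * \<rho> j (zinv j w)) \<in> borel_measurable borel"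
      using borel_rho[OF B(1), of j] by (simp add: e)
    have "(\<lambda>w. indicator (z i ` B) w * ((cmod (T j i (zinv i w)))\<^sup>2 * \<rho> j (zinv j ((z j \<circ> zinv i) w)))) =
        (\<lambda>w. indicator (z i ` B) w * \<rho> i (zinv i w))"
      using rho by (auto simp: indicator_def)
    then show "(\<lambda>w. indicator (z i ` B) w * ((cmod (T j i (zinv i w)))\<^sup>2 * \<rho> j (zinv j ((z j \<circ> zinv i) w)))) \<in> borel_measurable borel"
      using borel_rho[OF B(1), of i] by (simp only: e)
  qed
  also have "\<dots> = (\<integral>\<^sup>+ w \<in> z i ` B. ennreal (\<rho> i (zinv i w)) \<partial>lborel)"
    using rho by (intro nn_integral_cong) (auto simp: indicator_def)
  also have "\<dots> = emeasure (chart_area i) B"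
    using emeasure_chart_area[OF B(1), of i] by (simp add: e)
  finally show ?thesis ..
qed

lemma finite_subcover:
  fixes U :: "'a \<Rightarrow> 'm set"
  assumes "\<And>x. open (U x)" "\<And>p. \<exists>x. p \<in> U x"
  shows "\<exists>I. finite I \<and> (\<Union>x\<in>I. U x) = UNIV"
proof (rule compactE_image[OF compact_M, of UNIV U])
  show "UNIV \<subseteq> (\<Union>x\<in>UNIV. U x)" using assms(2) by auto
  fix I assume "finite I" "UNIV \<subseteq> (\<Union>x\<in>I. U x)"
  then show ?thesis by blast
qed (use assms(1) in simp)

lemma finite_chart_partition:
  "\<exists>(n::nat) (e :: nat \<Rightarrow> 'i) (P :: nat \<Rightarrow> 'm set). disjoint_family P \<and> (\<forall>k. P k \<in> sets borel) \<and>
     (\<forall>k. P k \<subseteq> D (e k)) \<and> (\<Union>k<n. P k) = UNIV"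
proof -
  obtain I where I: "finite I" "(\<Union>i\<in>I. D i) = UNIV"
    using finite_subcover[OF open_dom ex_dom] by blast
  have "\<exists>n::nat. \<exists>e. I = e ` {i. i < n}"
    using finite_imp_nat_seg_image_inj_on[OF I(1)] by fast
  then obtain n :: nat and e where ne: "I = e ` {i. i < n}" by (elim exE)
  show ?thesis
  proof (intro exI conjI)
    show "\<forall>k. disjointed (\<lambda>k. D (e k)) k \<in> sets borel"
      unfolding disjointed_def using borel_dom by auto
    show "\<forall>k. disjointed (\<lambda>k. D (e k)) k \<subseteq> D (e k)"
      unfolding disjointed_def by auto
    show "(\<Union>k<n. disjointed (\<lambda>k. D (e k)) k) = UNIV"
      using I(2) ne finite_UN_disjointed_eq[of "\<lambda>k. D (e k)" n] by (auto simp: atLeast0LessThan)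
  qed (rule disjoint_family_disjointed)
qed

text \<open>A finite partition into Borel pieces, each inside one chart domain, glues the chart measures. The
  partition also forces uniqueness, since a measure is determined by its values inside the pieces.
  This justifies the definite description that defines the area.\<close>

lemma area_exists:
  "\<exists>!N. sets N = sets borel \<and> (\<forall>i. \<forall>B\<in>sets borel. B \<subseteq> D i \<longrightarrow>
     emeasure N B = (\<integral>\<^sup>+ w \<in> z i ` B. ennreal (\<rho> i (zinv i w)) \<partial>lborel))"
proof -
  obtain n :: nat and e P where P: "disjoint_family P" "\<forall>k. P k \<in> sets borel" "\<forall>k. P k \<subseteq> D (e k)"
    "(\<Union>k<n. P k) = UNIV" using finite_chart_partition by blast
  have split: "emeasure N B = (\<Sum>k<n. emeasure N (B \<inter> P k))"
    if "sets N = sets borel" "B \<in> sets borel" for N B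
  proof (rule sum_emeasure_cover)
    show "disjoint_family_on P {..<n}" using P(1) by (rule disjoint_family_on_mono[rotated]) simp
  qed (use that P in auto)
  have image: "(\<integral>\<^sup>+ w \<in> z i ` B. ennreal (\<rho> i (zinv i w)) \<partial>lborel) = emeasure (chart_area i) B"
    if "B \<in> sets borel" "B \<subseteq> D i" for B i
    using emeasure_chart_area[OF that(1), of i] that(2) by (simp add: Int_absorb1)
  define \<mu> where "\<mu> B = (\<Sum>k<n. emeasure (chart_area (e k)) (B \<inter> P k))" for B
  define N where "N = measure_of UNIV (sets borel) \<mu>"
  have sN: "sets N = sets borel" unfolding N_def using sets.sigma_sets_eq[of borel] by simp
  have N: "emeasure N B = \<mu> B" if "B \<in> sets borel" for B
    unfolding N_def
  proof (rule emeasure_measure_of[OF refl])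
    show "positive (sets (measure_of UNIV (sets borel) \<mu>)) \<mu>"
      by (simp add: positive_def \<mu>_def)
    show "countably_additive (sets (measure_of UNIV (sets borel) \<mu>)) \<mu>"
    proof (rule countably_additiveI)
      fix A :: "nat \<Rightarrow> 'm set"
      assume A: "range A \<subseteq> sets (measure_of UNIV (sets borel) \<mu>)" "disjoint_family A"
      then have A': "A l \<in> sets borel" for l using sN by (auto simp: N_def)
      have "(\<Sum>l. \<mu> (A l)) = (\<Sum>k<n. \<Sum>l. emeasure (chart_area (e k)) (A l \<inter> P k))"
        unfolding \<mu>_def by (rule suminf_sum) simp
      also have "\<dots> = (\<Sum>k<n. emeasure (chart_area (e k)) (\<Union>l. A l \<inter> P k))"
      proof (intro sum.cong refl suminf_emeasure)
        fix k
        show "range (\<lambda>l. A l \<inter> P k) \<subseteq> sets (chart_area (e k))" using A' P(2) by auto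
        show "disjoint_family (\<lambda>l. A l \<inter> P k)" using A(2) by (auto simp: disjoint_family_on_def)
      qed
      also have "\<dots> = \<mu> (\<Union>l. A l)" by (simp add: \<mu>_def)
      finally show "(\<Sum>l. \<mu> (A l)) = \<mu> (\<Union>l. A l)" .
    qed
  qed (use that sN in \<open>auto simp: N_def\<close>)
  have "emeasure N B = (\<integral>\<^sup>+ w \<in> z i ` B. ennreal (\<rho> i (zinv i w)) \<partial>lborel)"
    if B: "B \<in> sets borel" "B \<subseteq> D i" for i B
  proof -
    have "\<mu> B = (\<Sum>k<n. emeasure (chart_area i) (B \<inter> P k))"
      unfolding \<mu>_def
    proof (rule sum.cong[OF refl], rule chart_area_transition)
      fix k show "B \<inter> P k \<in> sets borel" "B \<inter> P k \<subseteq> D (e k)" "B \<inter> P k \<subseteq> D i"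
        using B P(2,3) by auto
    qed
    also have "\<dots> = emeasure (chart_area i) B" using split[of "chart_area i" B] B by simp
    finally show ?thesis using N[OF B(1)] image[OF B] by simp
  qed
  note spec = this
  show ?thesis
  proof (rule ex1I[of _ N])
    show "sets N = sets borel \<and> (\<forall>i. \<forall>B\<in>sets borel. B \<subseteq> D i \<longrightarrow>
       emeasure N B = (\<integral>\<^sup>+ w \<in> z i ` B. ennreal (\<rho> i (zinv i w)) \<partial>lborel))"
      using spec sN by blast
    fix N' assume N': "sets N' = sets borel \<and> (\<forall>i. \<forall>B\<in>sets borel. B \<subseteq> D i \<longrightarrow>
       emeasure N' B = (\<integral>\<^sup>+ w \<in> z i ` B. ennreal (\<rho> i (zinv i w)) \<partial>lborel))"
    show "N' = N"
    proof (rule measure_eqI)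
      show "sets N' = sets N" using sN N' by simp
      fix B assume "B \<in> sets N'"
      then have B: "B \<in> sets borel" using N' by simp
      have "emeasure N' (B \<inter> P k) = emeasure N (B \<inter> P k)" for k
      proof -
        have "B \<inter> P k \<in> sets borel" "B \<inter> P k \<subseteq> D (e k)" using B P(2,3) by auto
        then show ?thesis using N' spec by metis
      qed
      then show "emeasure N' B = emeasure N B"
        using split[of N' B] split[of N B] N' sN B by simp
    qed
  qed
qed

abbreviation "dA \<equiv> area M \<rho>"

lemma sets_area [simp, measurable_cong]: "sets dA = sets borel"
  and emeasure_area: "B \<in> sets borel \<Longrightarrow> B \<subseteq> D i \<Longrightarrow>
     emeasure dA B = (\<integral>\<^sup>+ w \<in> z i ` B. ennreal (\<rho> i (zinv i w)) \<partial>lborel)"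
  using theI'[OF area_exists] unfolding area_def[symmetric] by blast+

lemma space_area [simp]: "space dA = UNIV"
  using sets_eq_imp_space_eq[OF sets_area] by simp

lemma chart_area_eq: "chart_area i = density dA (indicator (D i))"
proof (rule measure_eqI)
  fix B assume "B \<in> sets (chart_area i)"
  then have B: "B \<in> sets borel" by simp
  have "emeasure (density dA (indicator (D i))) B = emeasure dA (D i \<inter> B)"
    using B borel_dom[of i] by (simp add: emeasure_density indicator_inter_arith[symmetric])
  then show "emeasure (chart_area i) B = emeasure (density dA (indicator (D i))) B"
    using emeasure_area[of "D i \<inter> B" i] emeasure_chart_area[OF B, of i] B borel_dom[of i] by simp
qed simp

lemma integral_area_chart:
  fixes f :: "'m \<Rightarrow> complex"
  assumes f: "f \<in> borel_measurable borel" "\<And>p. p \<notin> D i \<Longrightarrow> f p = 0"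
  shows "(LINT p|dA. f p) = (\<integral>w. indicator (z i ` D i) w *\<^sub>R (\<rho> i (zinv i w) *\<^sub>R f (zinv i w)) \<partial>lborel)"
proof -
  let ?v = "\<lambda>w. if w \<in> z i ` D i then zinv i w else undefined"
  have "(LINT p|dA. f p) = (LINT p|dA. indicator (D i) p *\<^sub>R f p)"
    using f(2) by (intro Bochner_Integration.integral_cong) (auto simp: indicator_def)
  also have "\<dots> = (LINT p|density dA (\<lambda>p. ennreal (indicator (D i) p)). f p)"
    using f(1) borel_dom[of i] by (subst integral_density) auto
  also have "\<dots> = (LINT p|chart_area i. f p)" by (simp add: chart_area_eq ennreal_indicator)
  also have "\<dots> = (\<integral>w. f (?v w) \<partial>density lborel (\<lambda>w. ennreal (indicator (z i ` D i) w * \<rho> i (zinv i w))))"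
    unfolding chart_area_def using f(1) by (subst integral_distr) auto
  also have "\<dots> = (\<integral>w. (indicator (z i ` D i) w * \<rho> i (zinv i w)) *\<^sub>R f (?v w) \<partial>lborel)"
  proof (subst integral_density)
    show "(\<lambda>w. f (?v w)) \<in> borel_measurable lborel"
      using measurable_compose[OF measurable_chart_inv f(1)] by simp
    show "AE w in lborel. 0 \<le> indicator (z i ` D i) w * \<rho> i (zinv i w)"
      using rho_pos by (auto simp: indicator_def less_imp_le)
  qed auto
  also have "\<dots> = (\<integral>w. indicator (z i ` D i) w *\<^sub>R (\<rho> i (zinv i w) *\<^sub>R f (zinv i w)) \<partial>lborel)"
    by (intro Bochner_Integration.integral_cong) (auto simp: indicator_def)
  finally show ?thesis .
qed

lemma chart_disc:
  assumes "p \<in> D i"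
  obtains r where "r > 0" "cball (z i p) r \<subseteq> z i ` D i"
  using open_chart[of i] assms by (meson imageI open_contains_cball_eq)

text \<open>The density may be unbounded near the boundary of a chart; it is bounded on a disc whose closure
  lies in the chart, and finitely many such discs cover the surface.\<close>

lemma finite_measure_area: "finite_measure dA"
proof (rule finite_measureI)
  have "\<exists>U. open U \<and> p \<in> U \<and> emeasure dA U < \<infinity>" for p
  proof -
    obtain i where i: "p \<in> D i" using ex_dom by blast
    obtain r where r: "r > 0" "cball (z i p) r \<subseteq> z i ` D i" using chart_disc[OF i] .
    define U where "U = D i \<inter> z i -` ball (z i p) r"
    have U: "open U" "p \<in> U" "U \<subseteq> D i"
      unfolding U_def using continuous_open_preimage[OF continuous_chart open_dom open_ball] i r by auto
    have "continuous_on (cball (z i p) r) (\<lambda>w. \<rho> i (zinv i w))"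
      using continuous_rho r(2) by (rule continuous_on_subset)
    then have "compact ((\<lambda>w. \<rho> i (zinv i w)) ` cball (z i p) r)"
      by (rule compact_continuous_image) simp
    then obtain C where C: "\<forall>w\<in>cball (z i p) r. \<bar>\<rho> i (zinv i w)\<bar> \<le> C"
      using compact_imp_bounded[of "(\<lambda>w. \<rho> i (zinv i w)) ` cball (z i p) r"] by (auto simp: bounded_iff)
    have "emeasure dA U = (\<integral>\<^sup>+ w \<in> z i ` U. ennreal (\<rho> i (zinv i w)) \<partial>lborel)"
      using U by (intro emeasure_area) auto
    also have "\<dots> \<le> (\<integral>\<^sup>+ w. ennreal C * indicator (cball (z i p) r) w \<partial>lborel)"
    proof (rule nn_integral_mono)
      fix w
      have "w \<in> cball (z i p) r" if "w \<in> z i ` U" using that by (auto simp: U_def)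
      then show "ennreal (\<rho> i (zinv i w)) * indicator (z i ` U) w \<le> ennreal C * indicator (cball (z i p) r) w"
        using C by (auto simp: indicator_def intro!: ennreal_leI dest: abs_le_D1)
    qed
    also have "\<dots> < \<infinity>"
      using emeasure_bounded_finite[of "cball (z i p) r"]
      by (simp add: nn_integral_cmult_indicator ennreal_mult_less_top)
    finally show ?thesis using U(1,2) by blast
  qed
  then have "\<forall>p. \<exists>U. open U \<and> p \<in> U \<and> emeasure dA U < \<infinity>" by simp
  from choice[OF this] obtain U where
    U: "\<And>p. open (U p)" "\<And>p. p \<in> U p" "\<And>p. emeasure dA (U p) < \<infinity>" by blast
  have "\<exists>q. p \<in> U q" for p using U(2) by blast
  from finite_subcover[OF U(1) this] obtain I where I: "finite I" "(\<Union>p\<in>I. U p) = UNIV"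
    by blast
  have "emeasure dA UNIV \<le> emeasure dA (\<Union>p\<in>I. U p)"
    by (simp only: I(2) order_refl)
  also have "\<dots> \<le> (\<Sum>p\<in>I. emeasure dA (U p))"
    using I(1) U(1) by (intro emeasure_subadditive_finite) auto
  also have "\<dots> < \<infinity>" using U(3) I(1) by (simp add: less_top)
  finally show "emeasure dA (space dA) \<noteq> \<infinity>" by simp
qed

lemma integrable_continuous:
  fixes f :: "'m \<Rightarrow> complex"
  assumes "continuous_on UNIV f"
  shows "integrable dA f"
proof -
  interpret finite_measure dA by (rule finite_measure_area)
  have "compact (range f)" using assms compact_M by (rule compact_continuous_image)
  then obtain C where "\<And>p. norm (f p) \<le> C"
    using compact_imp_bounded[of "range f"] by (auto simp: bounded_iff)
  moreover have "f \<in> borel_measurable dA"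
    using borel_measurable_continuous_onI[OF assms] by (simp cong: measurable_cong_sets)
  ultimately show ?thesis by (intro integrable_const_bound) auto
qed

text \<open>The \<open>L\<^sup>2\<close> inner products are definite, because a nonempty open set has positive area.\<close>

lemma continuous_nonneg_integral_0:
  assumes f: "continuous_on UNIV f" "\<And>p. 0 \<le> Re (f p)" and "Re (LINT p|dA. f p) = 0"
  shows "Re (f p) = 0"
proof (rule ccontr)
  assume "Re (f p) \<noteq> 0"
  have int: "integrable dA (\<lambda>p. Re (f p))" "(LINT p|dA. Re (f p)) = 0"
    using integrable_continuous[OF f(1)] assms(3) by auto
  have "AE p in dA. Re (f p) = 0"
    using integral_nonneg_eq_0_iff_AE[OF int(1)] int(2) f(2) by simp
  then have ae: "AE p in dA. p \<notin> {p. Re (f p) \<noteq> 0}" by simp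
  have op: "open {p. Re (f p) \<noteq> 0}"
    by (intro open_Collect_neq continuous_on_Re f(1) continuous_on_const)
  obtain i where i: "p \<in> D i" using ex_dom by blast
  define U where "U = D i \<inter> {p. Re (f p) \<noteq> 0}"
  have U: "open U" "p \<in> U" "U \<subseteq> D i" "U \<in> sets borel"
    using op i \<open>Re (f p) \<noteq> 0\<close> open_dom by (auto simp: U_def)
  have "emeasure dA U = 0"
    using ae U(4) by (subst (asm) AE_iff_measurable[where N = "{p. Re (f p) \<noteq> 0}"])
       (use op in \<open>auto simp: U_def intro!: emeasure_eq_0[of "{p. Re (f p) \<noteq> 0}"]\<close>)
  then have "(\<integral>\<^sup>+ w \<in> z i ` U. ennreal (\<rho> i (zinv i w)) \<partial>lborel) = 0"
    using emeasure_area[OF U(4,3)] by simp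
  moreover have "(\<lambda>w. ennreal (\<rho> i (zinv i w)) * indicator (z i ` U) w) \<in> borel_measurable lborel"
  proof -
    have "(\<lambda>w. ennreal (indicator (z i ` (D i \<inter> U)) w * \<rho> i (zinv i w))) \<in> borel_measurable lborel"
      using borel_rho[OF U(4), of i] by simp
    also have "(\<lambda>w. ennreal (indicator (z i ` (D i \<inter> U)) w * \<rho> i (zinv i w))) =
        (\<lambda>w. ennreal (\<rho> i (zinv i w)) * indicator (z i ` U) w)"
      using U(3) by (auto simp: indicator_def Int_absorb1)
    finally show ?thesis .
  qed
  ultimately have "AE w in lborel. ennreal (\<rho> i (zinv i w)) * indicator (z i ` U) w = 0"
    by (simp add: nn_integral_0_iff_AE)
  then have "AE w in lborel. w \<notin> z i ` U"
  proof (rule AE_mp, intro AE_I2 impI notI)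
    fix w assume "ennreal (\<rho> i (zinv i w)) * indicator (z i ` U) w = 0" "w \<in> z i ` U"
    then show False using U(3) rho_pos[of "zinv i w" i] by (auto simp: ennreal_eq_0_iff)
  qed
  moreover have oz: "open (z i ` U)" using open_chart_image[OF U(1), of i] U(3) by (simp add: Int_absorb1)
  ultimately have "emeasure lborel (z i ` U) = 0"
    by (subst (asm) AE_iff_measurable[where N = "z i ` U"]) auto
  then have "negligible (z i ` U)"
    using oz by (simp add: negligible_iff_null_sets null_sets_completionI null_sets_def)
  then show False using open_not_negligible[OF oz] U(2) by blast
qed

section \<open>Stokes' theorem\<close>

text \<open>A \<open>(1,0)\<close>-form \<open>\<xi>\<close> of class \<open>C\<^sup>1\<close>; up to a constant factor its divergence is the density of
  \<open>d\<xi>\<close> with respect to the area.\<close>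

definition C1_form10 :: "('i \<Rightarrow> 'm \<Rightarrow> complex) \<Rightarrow> bool" where
  "C1_form10 \<xi> \<longleftrightarrow> (\<forall>i. C_k_on 1 (z i ` D i) (\<xi> i \<circ> zinv i)) \<and>
     (\<forall>i j. \<forall>p\<in>D i \<inter> D j. \<xi> j p = T i j p * \<xi> i p)"

definition divergence :: "('i \<Rightarrow> 'm \<Rightarrow> complex) \<Rightarrow> 'm \<Rightarrow> complex" where
  "divergence \<xi> p = chart_value M (\<lambda>i. delbar M i (\<xi> i) p / of_real (\<rho> i p)) p"

lemma form_differentiable:
  "C1_form10 \<xi> \<Longrightarrow> p \<in> D i \<Longrightarrow> (\<xi> i \<circ> zinv i) differentiable at (z i p)"
  by (auto simp: C1_form10_def)

text \<open>Numerator and denominator both transform by \<open>\<bar>T i j\<bar>\<^sup>2\<close>: one factor comes from the \<open>(1,0)\<close>-form, and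
  its conjugate from \<open>\<partial>/\<partial>\<close>conj\<open>(z)\<close>.\<close>

lemma divergence_eq:
  assumes \<xi>: "C1_form10 \<xi>" and p: "p \<in> D i"
  shows "divergence \<xi> p = delbar M i (\<xi> i) p / of_real (\<rho> i p)"
  unfolding divergence_def
proof (rule chart_value_eq[OF p])
  fix j assume j: "p \<in> D j"
  have T: "(T i j \<circ> zinv j) differentiable at (z j p)"
    using C_fun_differentiable[OF C_fun_transition_deriv _ j] p j by simp
  note dt = delbar_transition[OF p j form_differentiable[OF \<xi> p]]
  have "delbar M j (\<xi> j) p = delbar M j (\<lambda>q. T i j q * \<xi> i q) p"
    by (rule del_cong(2)[of "D i \<inter> D j"]) (use \<xi> p j open_dom in \<open>auto simp: C1_form10_def\<close>)
  also have "\<dots> = T i j p * cnj (T i j p) * delbar M i (\<xi> i) p"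
    using del_mult(2)[OF T dt(1) j] dt(2) delbar_transition_deriv[OF p j] by simp
  also have "T i j p * cnj (T i j p) = of_real ((cmod (T i j p))\<^sup>2)"
    using complex_norm_square[of "T i j p"] by simp
  finally show "delbar M j (\<xi> j) p / of_real (\<rho> j p) = delbar M i (\<xi> i) p / of_real (\<rho> i p)"
    using rho_transition[OF p j] transition_deriv_nonzero[OF p j] rho_pos[OF p] by simp
qed

lemma continuous_on_charts:
  assumes "\<And>i. continuous_on (D i) f"
  shows "continuous_on UNIV f"
proof -
  have "continuous_on (\<Union>i. D i) f" by (rule continuous_on_open_UN) (use assms open_dom in auto)
  moreover have "(\<Union>i. D i) = UNIV" using ex_dom by auto
  ultimately show ?thesis by simp
qed

lemma continuous_divergence:
  assumes \<xi>: "C1_form10 \<xi>"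
  shows "continuous_on UNIV (divergence \<xi>)"
proof (rule continuous_on_charts)
  fix i
  have "continuous_on (z i ` D i) (wirtinger_bar (\<xi> i \<circ> zinv i))"
    unfolding wirtinger_bar_def[abs_def] using \<xi>
    by (intro continuous_intros) (auto simp: C1_form10_def)
  then have "continuous_on (z i ` D i) (\<lambda>w. wirtinger_bar (\<xi> i \<circ> zinv i) w / of_real (\<rho> i (zinv i w)))"
    using rho_pos[of _ i] continuous_rho[of i] by (intro continuous_intros) (auto simp: less_imp_neq[THEN not_sym])
  from continuous_on_compose[OF continuous_chart this]
  have "continuous_on (D i) (\<lambda>p. wirtinger_bar (\<xi> i \<circ> zinv i) (z i p) / of_real (\<rho> i (zinv i (z i p))))"
    by (simp add: o_def)
  then show "continuous_on (D i) (divergence \<xi>)"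
    by (rule continuous_on_eq) (use divergence_eq[OF \<xi>] in \<open>simp add: delbar_def\<close>)
qed

text \<open>In the chart \<open>l\<close> the density \<open>\<rho>\<close> cancels, which leaves the plane integral of a derivative with
  compact support.\<close>

lemma integral_divergence_chart:
  assumes \<xi>: "C1_form10 \<xi>" and K: "compact K" "K \<subseteq> D l"
    and supp: "\<And>i p. p \<in> D i \<Longrightarrow> p \<notin> K \<Longrightarrow> \<xi> i p = 0"
  shows "(LINT p|dA. divergence \<xi> p) = 0"
proof -
  have K': "open (- K)" using compact_imp_closed[OF K(1)] by (simp add: open_Compl)
  have d0: "divergence \<xi> p = 0" if "p \<notin> K" for p
  proof -
    obtain i where i: "p \<in> D i" using ex_dom by blast
    have "delbar M i (\<xi> i) p = delbar M i (\<lambda>_. 0) p"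
      by (rule del_cong(2)[of "D i \<inter> - K"]) (use supp i that open_dom K' in auto)
    then show ?thesis using divergence_eq[OF \<xi> i] by (simp add: delbar_const)
  qed
  define g where "g w = (if w \<in> z l ` D l then \<xi> l (zinv l w) else 0)" for w
  have KZ: "compact (z l ` K)" "z l ` K \<subseteq> z l ` D l"
    using K continuous_chart[of l] by (auto intro!: compact_continuous_image intro: continuous_on_subset)
  have g0: "g w = 0" if "w \<notin> z l ` K" for w
  proof (cases "w \<in> z l ` D l")
    case True
    then obtain q where q: "q \<in> D l" "w = z l q" by blast
    then have "q \<notin> K" using that by blast
    then show ?thesis using supp q by (simp add: g_def)
  qed (simp add: g_def)
  have oK: "open (- z l ` K)" using compact_imp_closed[OF KZ(1)] by (simp add: open_Compl)
  have "C_k_on 1 (z l ` D l \<union> - z l ` K) g"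
  proof (rule C_k_on_open_Un[OF open_chart oK])
    show "C_k_on 1 (z l ` D l) g"
      by (rule C_k_on_cong[OF open_chart, THEN iffD2, of l g "\<xi> l \<circ> zinv l"])
         (use \<xi> in \<open>auto simp: g_def C1_form10_def\<close>)
    show "C_k_on 1 (- z l ` K) g"
      by (rule C_k_on_cong[OF oK, THEN iffD2, of g "\<lambda>_. 0"]) (use g0 C_k_on_const in auto)
  qed
  moreover have "z l ` D l \<union> - z l ` K = UNIV" using KZ(2) by auto
  ultimately have g1: "C_k_on 1 UNIV g" by simp
  have "(LINT p|dA. divergence \<xi> p) =
      (\<integral>w. indicator (z l ` D l) w *\<^sub>R (\<rho> l (zinv l w) *\<^sub>R divergence \<xi> (zinv l w)) \<partial>lborel)"
    by (rule integral_area_chart)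
       (use borel_measurable_continuous_onI[OF continuous_divergence[OF \<xi>]] d0 K(2) in auto)
  also have "\<dots> = (\<integral>w. wirtinger_bar g w \<partial>lborel)"
  proof (intro Bochner_Integration.integral_cong refl)
    fix w
    show "indicator (z l ` D l) w *\<^sub>R (\<rho> l (zinv l w) *\<^sub>R divergence \<xi> (zinv l w)) = wirtinger_bar g w"
    proof (cases "w \<in> z l ` D l")
      case True
      then obtain p where p: "p \<in> D l" "w = z l p" by blast
      have "wirtinger_bar g w = wirtinger_bar (\<xi> l \<circ> zinv l) w"
        by (rule wirtinger_cong(2)[OF open_chart True]) (auto simp: g_def)
      then show ?thesis using p divergence_eq[OF \<xi> p(1)] rho_pos[OF p(1)]
        by (simp add: delbar_def scaleR_conv_of_real)
    next
      case False
      have "wirtinger_bar g w = wirtinger_bar (\<lambda>_. 0) w"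
        by (rule wirtinger_cong(2)[OF oK]) (use False KZ(2) g0 in auto)
      then show ?thesis using False by (simp add: wirtinger_bar_def)
    qed
  qed
  also have "\<dots> = 0" by (rule integral_wirtinger_bar_eq_0[OF g1 KZ(1) g0])
  finally show ?thesis .
qed

text \<open>Multiplication by \<open>1 - \<theta>\<close> localises a form to one chart, multiplication by \<open>\<theta>\<close> kills it on \<open>U\<close>.\<close>

definition chart_cutoff :: "('m \<Rightarrow> complex) \<Rightarrow> 'm set \<Rightarrow> bool" where
  "chart_cutoff \<theta> U \<longleftrightarrow> C_fun 1 UNIV \<theta> \<and> (\<forall>q\<in>U. \<theta> q = 0) \<and>
     (\<exists>l K. compact K \<and> K \<subseteq> D l \<and> (\<forall>q. q \<notin> K \<longrightarrow> \<theta> q = 1))"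

lemma ex_cutoff: "\<exists>\<theta> U. open U \<and> p \<in> U \<and> chart_cutoff \<theta> U"
proof -
  obtain i where i: "p \<in> D i" using ex_dom by blast
  obtain r where r: "r > 0" "cball (z i p) r \<subseteq> z i ` D i" using chart_disc[OF i] .
  define a where "a = z i p"
  \<comment> \<open>With \<open>m x = max(0, x)\<^sup>2\<close> the cutoff is \<open>m (1 - 2 m (1 - \<bar>u - a\<bar>\<^sup>2/r\<^sup>2))\<close>: the inner \<open>m\<close> vanishes outside
    the disc of radius \<open>r\<close>, and exceeds \<open>1/2\<close> on the disc of radius \<open>r/2\<close>, where it is at least \<open>9/16\<close>.\<close>
  define f1 where "f1 u = 1 + of_real (- 1 / r\<^sup>2) * ((u - a) * cnj (u - a))" for u
  define f2 where "f2 u = 1 + (- 2) * complex_of_real ((max 0 (Re (f1 u)))\<^sup>2)" for u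
  define c where "c u = complex_of_real ((max 0 (Re (f2 u)))\<^sup>2)" for u
  have Re1: "Re (f1 u) = 1 - (cmod (u - a))\<^sup>2 / r\<^sup>2" for u
    unfolding f1_def complex_norm_square[symmetric] by simp
  have Re2: "Re (f2 u) = 1 - 2 * (max 0 (Re (f1 u)))\<^sup>2" for u by (simp add: f2_def)
  have c0: "c u = 0" if "dist a u < r / 2" for u
  proof -
    have "(cmod (u - a))\<^sup>2 \<le> (r / 2)\<^sup>2"
      using that by (intro power_mono) (auto simp: dist_norm norm_minus_commute)
    then have "Re (f1 u) \<ge> 3 / 4" using r(1) by (simp add: Re1 field_simps power2_eq_square)
    then have "(max 0 (Re (f1 u)))\<^sup>2 \<ge> (3 / 4)\<^sup>2" by (intro power_mono) auto
    then have "Re (f2 u) \<le> 0" by (simp add: Re2 power2_eq_square)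
    then show ?thesis by (simp add: c_def)
  qed
  have c1: "c u = 1" if "dist a u > r" for u
  proof -
    have "(cmod (u - a))\<^sup>2 \<ge> r\<^sup>2"
      using that r(1) by (intro power_mono) (auto simp: dist_norm norm_minus_commute)
    then have "Re (f1 u) \<le> 0" using r(1) by (simp add: Re1 field_simps)
    then have "Re (f2 u) = 1" by (simp add: Re2)
    then show ?thesis by (simp add: c_def)
  qed
  define \<theta> where "\<theta> q = (if q \<in> D i then c (z i q) else 1)" for q
  define U where "U = D i \<inter> z i -` ball a (r / 2)"
  define K where "K = zinv i ` cball a r"
  have r': "cball a r \<subseteq> z i ` D i" using r(2) by (simp add: a_def)
  have K: "compact K" "K \<subseteq> D i"
    unfolding K_def using r'
    by (auto intro!: compact_continuous_image continuous_on_subset[OF continuous_chart_inv])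
  have \<theta>1: "\<theta> q = 1" if "q \<notin> K" for q
  proof (cases "q \<in> D i")
    case True
    then have "z i q \<notin> cball a r" using that unfolding K_def by (metis chart_inv_chart image_eqI)
    then show ?thesis using True c1 by (simp add: \<theta>_def)
  qed (simp add: \<theta>_def)
  have K': "open (- K)" using compact_imp_closed[OF K(1)] by (simp add: open_Compl)
  have "C_fun 1 UNIV \<theta>"
    unfolding C_fun_def
  proof
    fix j
    have oS: "open (z j ` (D j \<inter> D i))" and oT: "open (z j ` (D j \<inter> - K))"
      using open_chart_image open_dom K' by auto
    have "C_k_on 1 (z j ` (D j \<inter> D i) \<union> z j ` (D j \<inter> - K)) (\<theta> \<circ> zinv j)"
    proof (rule C_k_on_open_Un[OF oS oT])
      have h: "C_k_on 1 (z j ` (D j \<inter> D i)) (\<lambda>w. (z i \<circ> zinv j) w + (- a))"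
        by (intro C_k_on_add C_k_on_const oS holomorphic_imp_C_k_on transition_holomorphic)
      have "C_k_on 1 (z j ` (D j \<inter> D i)) (\<lambda>w. 1 + of_real (- 1 / r\<^sup>2) *
          (((z i \<circ> zinv j) w + (- a)) * cnj ((z i \<circ> zinv j) w + (- a))))"
        by (intro C_k_on_add C_k_on_mult C_k_on_const C_k_on_cnj oS h)
      then have "C_k_on 1 (z j ` (D j \<inter> D i)) (\<lambda>w. f1 ((z i \<circ> zinv j) w))"
        by (simp add: f1_def)
      then have "C_k_on 1 (z j ` (D j \<inter> D i)) (\<lambda>w. f2 ((z i \<circ> zinv j) w))"
        unfolding f2_def by (intro C_k_on_add C_k_on_mult C_k_on_const C_1_on_max0_square oS)
      then have "C_k_on 1 (z j ` (D j \<inter> D i)) (\<lambda>w. c ((z i \<circ> zinv j) w))"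
        unfolding c_def by (intro C_1_on_max0_square oS)
      then show "C_k_on 1 (z j ` (D j \<inter> D i)) (\<theta> \<circ> zinv j)"
        by (rule C_k_on_cong[OF oS, THEN iffD2, rotated]) (auto simp: \<theta>_def)
      show "C_k_on 1 (z j ` (D j \<inter> - K)) (\<theta> \<circ> zinv j)"
        by (rule C_k_on_cong[OF oT, THEN iffD2, of _ "\<lambda>_. 1"]) (use \<theta>1 C_k_on_const in auto)
    qed
    moreover have "z j ` (D j \<inter> D i) \<union> z j ` (D j \<inter> - K) = z j ` (D j \<inter> UNIV)" using K(2) by auto
    ultimately show "C_k_on 1 (z j ` (D j \<inter> UNIV)) (\<theta> \<circ> zinv j)" by simp
  qed
  moreover have "open U" unfolding U_def
    by (rule continuous_open_preimage[OF continuous_chart open_dom open_ball])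
  moreover have "p \<in> U" using i r(1) by (simp add: U_def a_def)
  moreover have "\<theta> q = 0" if "q \<in> U" for q using that c0 by (simp add: \<theta>_def U_def)
  ultimately have "chart_cutoff \<theta> U"
    unfolding chart_cutoff_def using K \<theta>1 by blast
  then show ?thesis using \<open>open U\<close> \<open>p \<in> U\<close> by blast
qed

lemma C1_form10_mult:
  assumes \<xi>: "C1_form10 \<xi>" and f: "C_fun 1 UNIV f"
  shows "C1_form10 (\<lambda>i p. f p * \<xi> i p)"
  unfolding C1_form10_def
proof (intro conjI allI ballI)
  fix i
  have "C_k_on 1 (z i ` D i) (\<lambda>w. (f \<circ> zinv i) w * (\<xi> i \<circ> zinv i) w)"
    using \<xi> f open_chart[of i] unfolding C1_form10_def C_fun_def Int_UNIV_right
    by (intro C_k_on_mult) blast+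
  then show "C_k_on 1 (z i ` D i) ((\<lambda>p. f p * \<xi> i p) \<circ> zinv i)" by (simp add: o_def)
next
  fix i j p assume "p \<in> D i \<inter> D j"
  then have "\<xi> j p = T i j p * \<xi> i p" using \<xi> by (simp add: C1_form10_def)
  then show "f p * \<xi> j p = T i j p * (f p * \<xi> i p)" by simp
qed

text \<open>Stokes' theorem on a closed surface. Multiplying successively by cutoffs that vanish on the
  members of a finite cover turns \<open>\<xi>\<close> into the zero form; each step discards a form supported in a single chart.\<close>

lemma integral_divergence_eq_0:
  assumes \<xi>: "C1_form10 \<xi>"
  shows "(LINT p|dA. divergence \<xi> p) = 0"
proof -
  have "\<exists>\<theta>. \<forall>p. \<exists>U. open U \<and> p \<in> U \<and> chart_cutoff (\<theta> p) U"
    by (rule choice) (use ex_cutoff in blast)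
  then obtain \<theta> where \<theta>: "\<forall>p. \<exists>U. open U \<and> p \<in> U \<and> chart_cutoff (\<theta> p) U" by blast
  from choice[OF this] obtain U where U: "\<And>p. open (U p) \<and> p \<in> U p \<and> chart_cutoff (\<theta> p) (U p)"
    by blast
  have oU: "open (U p)" for p using U by blast
  have exU: "\<exists>q. p \<in> U q" for p using U by blast
  from finite_subcover[OF oU exU] obtain I where I: "finite I" "(\<Union>p\<in>I. U p) = UNIV" by blast
  have "\<exists>\<xi>'. C1_form10 \<xi>' \<and> (\<forall>i. \<forall>q\<in>(\<Union>p\<in>J. U p). \<xi>' i q = 0) \<and>
      (LINT p|dA. divergence \<xi>' p) = (LINT p|dA. divergence \<xi> p)" if "finite J" for J
    using that
  proof (induction J)
    case empty
    then show ?case using \<xi> by auto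
  next
    case (insert a J)
    then obtain \<eta> where \<eta>: "C1_form10 \<eta>" "\<forall>i. \<forall>q\<in>(\<Union>p\<in>J. U p). \<eta> i q = 0"
      "(LINT p|dA. divergence \<eta> p) = (LINT p|dA. divergence \<xi> p)" by blast
    obtain l K where K: "compact K" "K \<subseteq> D l" "C_fun 1 UNIV (\<theta> a)" "\<forall>q\<in>U a. \<theta> a q = 0"
      "\<forall>q. q \<notin> K \<longrightarrow> \<theta> a q = 1" using U[of a] unfolding chart_cutoff_def by blast
    define \<xi>1 where "\<xi>1 i p = \<theta> a p * \<eta> i p" for i p
    define \<xi>2 where "\<xi>2 i p = (1 + (-1) * \<theta> a p) * \<eta> i p" for i p
    have f: "C1_form10 \<xi>1" "C1_form10 \<xi>2"
      unfolding \<xi>1_def[abs_def] \<xi>2_def[abs_def]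
      by (intro C1_form10_mult \<eta>(1) K(3) C_fun_add C_fun_mult C_fun_const open_UNIV)+
    have "divergence \<eta> p = divergence \<xi>1 p + divergence \<xi>2 p" for p
    proof -
      obtain i where i: "p \<in> D i" using ex_dom by blast
      have "\<eta> i = (\<lambda>q. \<xi>1 i q + \<xi>2 i q)" by (simp add: fun_eq_iff \<xi>1_def \<xi>2_def algebra_simps)
      then have "delbar M i (\<eta> i) p = delbar M i (\<xi>1 i) p + delbar M i (\<xi>2 i) p"
        using del_add(2)[OF form_differentiable[OF f(1) i] form_differentiable[OF f(2) i]] by simp
      then show ?thesis
        using divergence_eq[OF \<eta>(1) i] divergence_eq[OF f(1) i] divergence_eq[OF f(2) i]
        by (simp add: add_divide_distrib)
    qed
    then have "(LINT p|dA. divergence \<eta> p) = (LINT p|dA. divergence \<xi>1 p) + (LINT p|dA. divergence \<xi>2 p)"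
      using f by (simp add: integrable_continuous continuous_divergence)
    moreover have "(LINT p|dA. divergence \<xi>2 p) = 0"
      by (rule integral_divergence_chart[OF f(2) K(1,2)]) (use K(5) in \<open>simp add: \<xi>2_def\<close>)
    moreover have "\<forall>i. \<forall>q\<in>(\<Union>p\<in>insert a J. U p). \<xi>1 i q = 0"
      using K(4) \<eta>(2) by (auto simp: \<xi>1_def)
    ultimately show ?case using f(1) \<eta>(3) by (intro exI[of _ \<xi>1]) simp
  qed
  from this[OF I(1)] obtain \<xi>' where \<xi>': "C1_form10 \<xi>'" "\<And>i q. \<xi>' i q = 0"
    "(LINT p|dA. divergence \<xi>' p) = (LINT p|dA. divergence \<xi> p)" unfolding I(2) by blast
  have "divergence \<xi>' p = 0" for p
  proof -
    obtain i where i: "p \<in> D i" using ex_dom by blast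
    have "\<xi>' i = (\<lambda>_. 0)" using \<xi>'(2) by auto
    then show ?thesis using divergence_eq[OF \<xi>'(1) i] delbar_const[of i 0 p] by simp
  qed
  then show ?thesis using \<xi>'(3) by simp
qed

end

section \<open>Hermitian line bundles with a unitary connection\<close>

locale hermitian_line_bundle = compact_kaehler_surface M \<rho>
  for M :: "('i, 'm::t2_space) surface" and \<rho> :: "'i \<Rightarrow> 'm \<Rightarrow> real" +
  fixes E :: "('b, 'm, 'v::ab_group_add) line_bundle"
    and h :: "'m \<Rightarrow> 'v \<Rightarrow> 'v \<Rightarrow> complex"
    and A :: "('i, 'm, 'v) connection"
  assumes line_bundle_E: "holomorphic_line_bundle M E" and metric: "hermitian_metric M E h"
    and connection: "is_connection M E A" and unitary_connection: "unitary M E h A"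
begin

sublocale fibres: vector_space "scl E"
  using line_bundle_E by (simp add: holomorphic_line_bundle_def)

abbreviation "sec \<equiv> smooth_section M E"

section \<open>Sections of the line bundle\<close>

lemma ex_triv: "\<exists>a. p \<in> triv E a"
  using line_bundle_E[unfolded holomorphic_line_bundle_def] by blast

lemma open_triv: "open (triv E a)"
  using line_bundle_E[unfolded holomorphic_line_bundle_def] by blast

lemma frame_nonzero: "p \<in> triv E a \<Longrightarrow> frame E a p \<noteq> 0"
  using line_bundle_E[unfolded holomorphic_line_bundle_def] by blast

lemma fibre_eq: "p \<in> triv E a \<Longrightarrow> fibre E p = range (\<lambda>c. scl E c (frame E a p))"
  using line_bundle_E[unfolded holomorphic_line_bundle_def] by blast

lemma frame_transition_holomorphic:
  "(coeff E a (frame E b) \<circ> zinv i) holomorphic_on z i ` (D i \<inter> triv E a \<inter> triv E b)"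
  using line_bundle_E[unfolded holomorphic_line_bundle_def] by blast

lemma coeff_eq:
  assumes "p \<in> triv E a" "s p = scl E c (frame E a p)"
  shows "coeff E a s p = c"
  unfolding coeff_def assms(2) using frame_nonzero[OF assms(1)]
  by (intro the_equality) (auto simp: fibres.scale_cancel_right)

lemma section_eq:
  assumes "p \<in> triv E a" "s p \<in> fibre E p"
  shows "s p = scl E (coeff E a s p) (frame E a p)"
proof -
  obtain c where "s p = scl E c (frame E a p)" using assms fibre_eq by auto
  moreover from coeff_eq[of p a s, OF assms(1) this] have "coeff E a s p = c" .
  ultimately show ?thesis by simp
qed

lemma fibre_scl: "v \<in> fibre E p \<Longrightarrow> scl E c v \<in> fibre E p"
proof -
  assume v: "v \<in> fibre E p"
  obtain a where a: "p \<in> triv E a" using ex_triv by blast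
  obtain d where "v = scl E d (frame E a p)" using v fibre_eq[OF a] by blast
  then have "scl E c v = scl E (c * d) (frame E a p)" by simp
  then show ?thesis using fibre_eq[OF a] by blast
qed

lemma fibre_add: "u \<in> fibre E p \<Longrightarrow> v \<in> fibre E p \<Longrightarrow> u + v \<in> fibre E p"
proof -
  assume uv: "u \<in> fibre E p" "v \<in> fibre E p"
  obtain a where a: "p \<in> triv E a" using ex_triv by blast
  obtain c d where "u = scl E c (frame E a p)" "v = scl E d (frame E a p)"
    using uv fibre_eq[OF a] by blast
  then have "u + v = scl E (c + d) (frame E a p)" by (simp add: fibres.scale_left_distrib)
  then show ?thesis using fibre_eq[OF a] by blast
qed

lemma sec_fibre: "sec W s \<Longrightarrow> p \<in> W \<Longrightarrow> s p \<in> fibre E p"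
  by (simp add: smooth_section_def)

lemma sec_coeff: "sec W s \<Longrightarrow> smooth_fun M (W \<inter> triv E a) (coeff E a s)"
  by (simp add: smooth_section_def)

lemma sec_subset: "sec W s \<Longrightarrow> V \<subseteq> W \<Longrightarrow> sec V s"
  unfolding smooth_section_def by (meson smooth_fun_subset Int_mono order_refl subsetD)

lemma sec_cong:
  assumes W: "open W" and eq: "\<And>p. p \<in> W \<Longrightarrow> s p = t p" and t: "sec W t"
  shows "sec W s"
  unfolding smooth_section_def
proof (intro conjI ballI allI)
  show "s p \<in> fibre E p" if "p \<in> W" for p using sec_fibre[OF t that] eq[OF that] by simp
  fix a
  show "smooth_fun M (W \<inter> triv E a) (coeff E a s)"
  proof (rule smooth_funI, rule C_fun_cong)
    show "open (W \<inter> triv E a)" using W open_triv by blast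
    show "coeff E a s p = coeff E a t p" if "p \<in> W \<inter> triv E a" for p
      using eq that by (simp add: coeff_def)
    show "C_fun k (W \<inter> triv E a) (coeff E a t)" for k
      using sec_coeff[OF t] by (simp add: smooth_fun_iff)
  qed
qed

lemma sec_scl:
  assumes W: "open W" and f: "smooth_fun M W f" and s: "sec W s"
  shows "sec W (\<lambda>p. scl E (f p) (s p))"
  unfolding smooth_section_def
proof (intro conjI ballI allI)
  show "scl E (f p) (s p) \<in> fibre E p" if "p \<in> W" for p using fibre_scl sec_fibre[OF s that] by blast
  fix a
  show "smooth_fun M (W \<inter> triv E a) (coeff E a (\<lambda>p. scl E (f p) (s p)))"
  proof (rule smooth_funI, rule C_fun_cong)
    show o: "open (W \<inter> triv E a)" using W open_triv by blast
    show "coeff E a (\<lambda>p. scl E (f p) (s p)) p = f p * coeff E a s p" if "p \<in> W \<inter> triv E a" for p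
    proof (rule coeff_eq)
      show "scl E (f p) (s p) = scl E (f p * coeff E a s p) (frame E a p)"
        using section_eq[of p a s] sec_fibre[OF s] that by (metis IntE fibres.scale_scale)
    qed (use that in simp)
    show "C_fun k (W \<inter> triv E a) (\<lambda>p. f p * coeff E a s p)" for k
      using sec_coeff[OF s, of a] f C_fun_subset[of k W f "W \<inter> triv E a"]
      by (intro C_fun_mult o) (auto simp: smooth_fun_iff)
  qed
qed

lemma sec_add:
  assumes W: "open W" and s: "sec W s" and t: "sec W t"
  shows "sec W (\<lambda>p. s p + t p)"
  unfolding smooth_section_def
proof (intro conjI ballI allI)
  show "s p + t p \<in> fibre E p" if "p \<in> W" for p
    using fibre_add sec_fibre[OF s that] sec_fibre[OF t that] by blast
  fix a
  show "smooth_fun M (W \<inter> triv E a) (coeff E a (\<lambda>p. s p + t p))"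
  proof (rule smooth_funI, rule C_fun_cong)
    show o: "open (W \<inter> triv E a)" using W open_triv by blast
    show "coeff E a (\<lambda>p. s p + t p) p = coeff E a s p + coeff E a t p" if "p \<in> W \<inter> triv E a" for p
    proof (rule coeff_eq)
      show "s p + t p = scl E (coeff E a s p + coeff E a t p) (frame E a p)"
        using section_eq[of p a s] section_eq[of p a t] sec_fibre[OF s] sec_fibre[OF t] that
        by (simp add: fibres.scale_left_distrib)
    qed (use that in simp)
    show "C_fun k (W \<inter> triv E a) (\<lambda>p. coeff E a s p + coeff E a t p)" for k
      using sec_coeff[OF s, of a] sec_coeff[OF t, of a]
      by (intro C_fun_add o) (auto simp: smooth_fun_iff)
  qed
qed

lemma sec_frame: "sec (triv E a) (frame E a)"
  unfolding smooth_section_def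
proof (intro conjI ballI allI)
  show "frame E a p \<in> fibre E p" if "p \<in> triv E a" for p
    unfolding fibre_eq[OF that] by (rule range_eqI[of _ _ 1]) simp
  fix b
  show "smooth_fun M (triv E a \<inter> triv E b) (coeff E b (frame E a))"
    by (intro smooth_funI holomorphic_imp_C_fun)
       (use open_triv frame_transition_holomorphic[of b a] in \<open>auto simp: Int_ac\<close>)
qed

text \<open>In the chart \<open>i\<close> only the restriction to \<open>D i\<close> is visible, so locally given sections that agree glue
  without passing to another chart.\<close>

lemma sec_UNIV:
  assumes "\<And>i. sec (D i) s"
  shows "sec UNIV s"
  unfolding smooth_section_def
proof (intro conjI ballI allI)
  show "s p \<in> fibre E p" for p using ex_dom[of p] sec_fibre[OF assms] by blast
  fix a
  show "smooth_fun M (UNIV \<inter> triv E a) (coeff E a s)"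
  proof (rule smooth_funI)
    fix k
    have "C_k_on k (z i ` (D i \<inter> (D i \<inter> triv E a))) (coeff E a s \<circ> zinv i)" for i
      using sec_coeff[OF assms[of i], of a] unfolding smooth_fun_iff C_fun_def by blast
    then show "C_fun k (UNIV \<inter> triv E a) (coeff E a s)" by (simp add: C_fun_def)
  qed
qed

section \<open>The metric and the connection\<close>

lemma h_add:
  "\<lbrakk>u \<in> fibre E p; v \<in> fibre E p; w \<in> fibre E p\<rbrakk> \<Longrightarrow> h p (u + v) w = h p u w + h p v w"
  and h_scl: "\<lbrakk>u \<in> fibre E p; w \<in> fibre E p\<rbrakk> \<Longrightarrow> h p (scl E c u) w = c * h p u w"
  and h_cnj: "\<lbrakk>u \<in> fibre E p; v \<in> fibre E p\<rbrakk> \<Longrightarrow> h p v u = cnj (h p u v)"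
  using metric[unfolded hermitian_metric_def, THEN conjunct1] by blast+

lemma h_pos: "u \<in> fibre E p \<Longrightarrow> u \<noteq> 0 \<Longrightarrow> Re (h p u u) > 0"
  using metric[unfolded hermitian_metric_def] by blast

lemma h_smooth: "open W \<Longrightarrow> sec W s \<Longrightarrow> sec W t \<Longrightarrow> smooth_fun M W (\<lambda>p. h p (s p) (t p))"
  using metric[unfolded hermitian_metric_def] by blast

lemma h_add_right:
  assumes "u \<in> fibre E p" "v \<in> fibre E p" "w \<in> fibre E p"
  shows "h p w (u + v) = h p w u + h p w v"
  using h_cnj[OF fibre_add[OF assms(1,2)] assms(3)] h_add[OF assms]
    h_cnj[OF assms(1,3)] h_cnj[OF assms(2,3)] by simp

lemma h_scl_right:
  assumes "u \<in> fibre E p" "w \<in> fibre E p"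
  shows "h p w (scl E c u) = cnj c * h p w u"
  using h_cnj[OF fibre_scl[OF assms(1)] assms(2)] h_scl[OF assms] h_cnj[OF assms] by simp

lemma h_real: "u \<in> fibre E p \<Longrightarrow> Im (h p u u) = 0"
  using h_cnj[of u p u] by (simp add: complex_eq_iff)

lemma h_nonneg: "u \<in> fibre E p \<Longrightarrow> Re (h p u u) \<ge> 0"
proof (cases "u = 0")
  case True
  assume "u \<in> fibre E p"
  then show ?thesis using h_scl[of u p u 0] True by simp
qed (use h_pos[of u p] in simp)

lemma d_forms:
  assumes "open W" "sec W s"
  shows "form10 M E W (restrict_form M W (d10 A s))" "form01 M E W (restrict_form M W (d01 A s))"
  using connection[unfolded is_connection_def, THEN conjunct1] assms by blast+

lemma d_sec:
  assumes W: "open W" and s: "sec W s"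
  shows "sec (W \<inter> D i) (d10 A s i)" "sec (W \<inter> D i) (d01 A s i)"
proof -
  have o: "open (W \<inter> D i)" using W open_dom by blast
  have "sec (W \<inter> D i) (restrict_form M W (d10 A s) i)" "sec (W \<inter> D i) (restrict_form M W (d01 A s) i)"
    using d_forms[OF W s] unfolding form10_def form01_def by blast+
  then show "sec (W \<inter> D i) (d10 A s i)" "sec (W \<inter> D i) (d01 A s i)"
    using sec_cong[OF o, of "d10 A s i" "restrict_form M W (d10 A s) i"]
      sec_cong[OF o, of "d01 A s i" "restrict_form M W (d01 A s) i"]
    by (auto simp: restrict_form_def)
qed

lemma d_transition:
  assumes W: "open W" and s: "sec W s" and p: "p \<in> W" "p \<in> D i" "p \<in> D j"
  shows "d10 A s j p = scl E (T i j p) (d10 A s i p)"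
    "d01 A s j p = scl E (cnj (T i j p)) (d01 A s i p)"
proof -
  have m: "p \<in> W \<inter> D i \<inter> D j" using p by blast
  have "restrict_form M W (d10 A s) j p = scl E (T i j p) (restrict_form M W (d10 A s) i p)"
    "restrict_form M W (d01 A s) j p = scl E (cnj (T i j p)) (restrict_form M W (d01 A s) i p)"
    using d_forms[OF W s] m unfolding form10_def form01_def by blast+
  then show "d10 A s j p = scl E (T i j p) (d10 A s i p)"
    "d01 A s j p = scl E (cnj (T i j p)) (d01 A s i p)"
    using p by (simp_all add: restrict_form_def)
qed

lemma d_local:
  assumes "open W" "sec W s" "\<forall>q\<in>W. s q = t q" "p \<in> W" "p \<in> D i"
  shows "d10 A s i p = d10 A t i p" "d01 A s i p = d01 A t i p"
  using connection[unfolded is_connection_def, THEN conjunct2, THEN conjunct1] assms by blast+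

lemma d_leibniz:
  assumes "open W" "smooth_fun M W f" "sec W s" "p \<in> W" "p \<in> D i"
  shows "d10 A (\<lambda>q. scl E (f q) (s q)) i p = scl E (del M i f p) (s p) + scl E (f p) (d10 A s i p)"
    "d01 A (\<lambda>q. scl E (f q) (s q)) i p = scl E (delbar M i f p) (s p) + scl E (f p) (d01 A s i p)"
  using connection[unfolded is_connection_def, THEN conjunct2, THEN conjunct2, THEN conjunct2] assms
  by blast+

lemma delbar_h:
  assumes "open W" "sec W s" "sec W t" "p \<in> W" "p \<in> D i"
  shows "delbar M i (\<lambda>q. h q (s q) (t q)) p = h p (d01 A s i p) (t p) + h p (s p) (d10 A t i p)"
  using unitary_connection[unfolded unitary_def] assms by blast

lemma smooth_fun_const: "smooth_fun M W (\<lambda>_. c)"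
  by (simp add: smooth_fun_iff C_fun_const)

lemma del_const: "del M i (\<lambda>_. c) p = 0"
  by (simp add: del_def wirtinger_def o_def)

lemma d_const_scl:
  assumes "open W" "sec W s" "p \<in> W" "p \<in> D i"
  shows "d10 A (\<lambda>q. scl E c (s q)) i p = scl E c (d10 A s i p)"
    "d01 A (\<lambda>q. scl E c (s q)) i p = scl E c (d01 A s i p)"
  using d_leibniz[OF assms(1) smooth_fun_const[of W c] assms(2-4)] delbar_const[of i c p] del_const[of i c p]
  by simp_all

section \<open>Curvature\<close>

lemma d_coeff:
  assumes W: "open W" and s: "sec W s" and p: "p \<in> W" "p \<in> D i" "p \<in> triv E a"
  shows "coeff E a (d10 A s i) p = del M i (coeff E a s) p + coeff E a s p * coeff E a (d10 A (frame E a) i) p"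
    "coeff E a (d01 A s i) p = delbar M i (coeff E a s) p + coeff E a s p * coeff E a (d01 A (frame E a) i) p"
proof -
  let ?V = "W \<inter> triv E a" and ?f = "coeff E a s" and ?e = "frame E a"
  have V: "open ?V" "p \<in> ?V" using W open_triv p by blast+
  have sV: "sec ?V s" using s by (rule sec_subset) simp
  have eV: "sec ?V ?e" using sec_frame by (rule sec_subset) simp
  have eq: "\<forall>q\<in>?V. s q = scl E (?f q) (?e q)"
    using section_eq[of _ a s] sec_fibre[OF s] by simp
  have e: "d10 A ?e i p = scl E (coeff E a (d10 A ?e i) p) (?e p)" "d01 A ?e i p = scl E (coeff E a (d01 A ?e i) p) (?e p)"
    using d_sec[OF open_triv sec_frame, of a i] p by (auto intro!: section_eq dest: sec_fibre)
  have "d10 A s i p = scl E (del M i ?f p + ?f p * coeff E a (d10 A ?e i) p) (?e p)"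
    unfolding d_local(1)[OF V(1) sV eq V(2) p(2)] d_leibniz(1)[OF V(1) sec_coeff[OF s] eV V(2) p(2)]
    by (subst e(1)) (simp add: fibres.scale_left_distrib)
  then show "coeff E a (d10 A s i) p = del M i ?f p + ?f p * coeff E a (d10 A ?e i) p"
    by (rule coeff_eq[OF p(3)])
  have "d01 A s i p = scl E (delbar M i ?f p + ?f p * coeff E a (d01 A ?e i) p) (?e p)"
    unfolding d_local(2)[OF V(1) sV eq V(2) p(2)] d_leibniz(2)[OF V(1) sec_coeff[OF s] eV V(2) p(2)]
    by (subst e(2)) (simp add: fibres.scale_left_distrib)
  then show "coeff E a (d01 A s i) p = delbar M i ?f p + ?f p * coeff E a (d01 A ?e i) p"
    by (rule coeff_eq[OF p(3)])
qed

text \<open>In a frame the connection is \<open>d + \<theta>\<close>; symmetry of second derivatives makes the commutator of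
  covariant derivatives multiplication by \<open>d\<theta>\<close>.\<close>

lemma commutator_eq:
  assumes W: "open W" and s: "sec W s" and p: "p \<in> W" "p \<in> D i" "p \<in> triv E a"
  shows "d10 A (d01 A s i) i p - d01 A (d10 A s i) i p =
    scl E (del M i (coeff E a (d01 A (frame E a) i)) p - delbar M i (coeff E a (d10 A (frame E a) i)) p) (s p)"
proof -
  let ?V = "W \<inter> D i" and ?N = "W \<inter> D i \<inter> triv E a"
  let ?f = "coeff E a s" and ?\<theta> = "coeff E a (d10 A (frame E a) i)" and ?\<theta>' = "coeff E a (d01 A (frame E a) i)"
  have V: "open ?V" "p \<in> ?V" and N: "open ?N" "p \<in> ?N" using W open_triv open_dom p by blast+
  note d = d_sec[OF W s, of i]
  have f: "smooth_fun M ?N ?f" using sec_coeff[OF s, of a] by (rule smooth_fun_subset) blast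
  have \<theta>: "smooth_fun M ?N ?\<theta>" "smooth_fun M ?N ?\<theta>'"
    using d_sec[OF open_triv sec_frame, of a i, THEN sec_coeff, of a]
    by (auto elim!: smooth_fun_subset)
  note diff = smooth_fun_differentiable[OF _ N(2) p(2)]
  note fd = del_delbar_commute[OF f N p(2)]
  have mult_d: "(\<lambda>q. ?f q * ?\<theta>' q) \<circ> zinv i differentiable at (z i p)" "(\<lambda>q. ?f q * ?\<theta> q) \<circ> zinv i differentiable at (z i p)"
    using differentiable_mult[OF diff[OF f] diff[OF \<theta>(2)]] differentiable_mult[OF diff[OF f] diff[OF \<theta>(1)]]
    by (simp_all add: o_def)
  have 1: "del M i (coeff E a (d01 A s i)) p = del M i (delbar M i ?f) p + (del M i ?f p * ?\<theta>' p + ?f p * del M i ?\<theta>' p)"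
  proof -
    have "del M i (coeff E a (d01 A s i)) p = del M i (\<lambda>q. delbar M i ?f q + ?f q * ?\<theta>' q) p"
      by (rule del_cong(1)[OF N p(2)]) (use d_coeff(2)[OF W s] in blast)
    then show ?thesis
      using del_add(1)[OF fd(2) mult_d(1)] del_mult(1)[OF diff[OF f] diff[OF \<theta>(2)] p(2)] by simp
  qed
  have 2: "delbar M i (coeff E a (d10 A s i)) p = delbar M i (del M i ?f) p + (delbar M i ?f p * ?\<theta> p + ?f p * delbar M i ?\<theta> p)"
  proof -
    have "delbar M i (coeff E a (d10 A s i)) p = delbar M i (\<lambda>q. del M i ?f q + ?f q * ?\<theta> q) p"
      by (rule del_cong(2)[OF N p(2)]) (use d_coeff(1)[OF W s] in blast)
    then show ?thesis
      using del_add(2)[OF fd(1) mult_d(2)] del_mult(2)[OF diff[OF f] diff[OF \<theta>(1)] p(2)] by simp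
  qed
  have fib: "d10 A (d01 A s i) i p \<in> fibre E p" "d01 A (d10 A s i) i p \<in> fibre E p"
    using sec_fibre[OF d_sec(1)[OF V(1) d(2), of i]] sec_fibre[OF d_sec(2)[OF V(1) d(1), of i]] p by blast+
  have "d10 A (d01 A s i) i p - d01 A (d10 A s i) i p =
      scl E (coeff E a (d10 A (d01 A s i) i) p - coeff E a (d01 A (d10 A s i) i) p) (frame E a p)"
    using section_eq[of p a "d10 A (d01 A s i) i", OF p(3) fib(1)] section_eq[of p a "d01 A (d10 A s i) i", OF p(3) fib(2)]
    by (metis fibres.scale_left_diff_distrib)
  also have "coeff E a (d10 A (d01 A s i) i) p - coeff E a (d01 A (d10 A s i) i) p =
      (del M i ?\<theta>' p - delbar M i ?\<theta> p) * ?f p"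
    unfolding d_coeff(1)[OF V(1) d(2) V(2) p(2,3)] d_coeff(2)[OF V(1) d(1) V(2) p(2,3)] 1 2
      d_coeff(1)[OF W s p] d_coeff(2)[OF W s p] fd(3) by (simp add: algebra_simps)
  also have "scl E ((del M i ?\<theta>' p - delbar M i ?\<theta> p) * ?f p) (frame E a p) =
      scl E (del M i ?\<theta>' p - delbar M i ?\<theta> p) (s p)"
    using section_eq[of p a s, OF p(3) sec_fibre[OF s p(1)]] by (metis fibres.scale_scale)
  finally show ?thesis .
qed

text \<open>The curvature coefficient exists by the formula in a frame, and is unique because the frame itself is a nowhere vanishing local section.\<close>

lemma curvature_eq:
  assumes i: "p \<in> D i" and W: "open W" "p \<in> W" "sec W s"
  shows "d10 A (d01 A s i) i p - d01 A (d10 A s i) i p = scl E (curvature M E A i p) (s p)"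
proof -
  obtain a where a: "p \<in> triv E a" using ex_triv by blast
  let ?P = "\<lambda>c. \<forall>W s. open W \<longrightarrow> p \<in> W \<longrightarrow> sec W s \<longrightarrow>
        d10 A (d01 A s i) i p - d01 A (d10 A s i) i p = scl E c (s p)"
  have "\<exists>c. ?P c" using commutator_eq[OF _ _ _ i a] by blast
  moreover have "c = c'" if "?P c" "?P c'" for c c'
  proof -
    have "scl E c (frame E a p) = scl E c' (frame E a p)"
      using that open_triv[of a] sec_frame[of a] a by metis
    then show ?thesis using frame_nonzero[OF a] by (simp add: fibres.scale_cancel_right)
  qed
  ultimately have "\<exists>!c. ?P c" by (intro ex_ex1I)
  from theI'[OF this] have "?P (curvature M E A i p)" unfolding curvature_def .
  from this[rule_format, OF W] show ?thesis .
qed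

text \<open>The functions \<open>T i j\<close> and conj\<open>(T i j)\<close> that relate the two charts are annihilated by the derivatives
  \<open>\<partial>/\<partial>\<close>conj\<open>(z\<^sub>j)\<close> and \<open>\<partial>/\<partial>z\<^sub>j\<close> respectively, so no lower-order terms appear.\<close>

lemma curvature_transition:
  assumes p: "p \<in> D i" "p \<in> D j"
  shows "curvature M E A j p = of_real ((cmod (T i j p))\<^sup>2) * curvature M E A i p"
proof -
  obtain a where a: "p \<in> triv E a" using ex_triv by blast
  let ?s = "frame E a" and ?N = "triv E a \<inter> D i \<inter> D j" and ?T = "T i j p"
  have N: "open ?N" "p \<in> ?N" using open_triv open_dom a p by blast+
  have Tn: "smooth_fun M ?N (T i j)" "smooth_fun M ?N (\<lambda>q. cnj (T i j q))"
  proof -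
    have "C_fun k ?N (T i j)" for k by (rule C_fun_subset[OF C_fun_transition_deriv]) blast
    then show "smooth_fun M ?N (T i j)" "smooth_fun M ?N (\<lambda>q. cnj (T i j q))"
      using C_fun_cnj[OF N(1)] by (auto simp: smooth_fun_iff)
  qed
  note di = d_sec[OF open_triv sec_frame, of a i] and dj = d_sec[OF open_triv sec_frame, of a j]
  have iN: "sec ?N (d10 A ?s i)" "sec ?N (d01 A ?s i)" and jN: "sec ?N (d10 A ?s j)" "sec ?N (d01 A ?s j)"
    by (rule sec_subset[OF di(1)], blast, rule sec_subset[OF di(2)], blast,
        rule sec_subset[OF dj(1)], blast, rule sec_subset[OF dj(2)], blast)
  have tr: "\<forall>q\<in>?N. d10 A ?s j q = scl E (T i j q) (d10 A ?s i q)"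
    "\<forall>q\<in>?N. d01 A ?s j q = scl E (cnj (T i j q)) (d01 A ?s i q)"
    using d_transition[OF open_triv sec_frame] by blast+
  have "d10 A (d01 A ?s j) j p = scl E (cnj ?T * ?T) (d10 A (d01 A ?s i) i p)"
    unfolding d_local(1)[OF N(1) jN(2) tr(2) N(2) p(2)] d_leibniz(1)[OF N(1) Tn(2) iN(2) N(2) p(2)]
      d_transition(1)[OF N(1) iN(2) N(2) p] del_cnj_transition_deriv[OF p] by simp
  moreover have "d01 A (d10 A ?s j) j p = scl E (cnj ?T * ?T) (d01 A (d10 A ?s i) i p)"
    unfolding d_local(2)[OF N(1) jN(1) tr(1) N(2) p(2)] d_leibniz(2)[OF N(1) Tn(1) iN(1) N(2) p(2)]
      d_transition(2)[OF N(1) iN(1) N(2) p] delbar_transition_deriv[OF p] by (simp add: mult.commute)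
  ultimately have "scl E (curvature M E A j p) (?s p) = scl E (cnj ?T * ?T) (scl E (curvature M E A i p) (?s p))"
    unfolding curvature_eq[OF p(1) open_triv a sec_frame, symmetric] curvature_eq[OF p(2) open_triv a sec_frame, symmetric]
    by (simp only: fibres.scale_right_diff_distrib)
  then have "curvature M E A j p = cnj ?T * ?T * curvature M E A i p"
    using frame_nonzero[OF a] by (simp add: fibres.scale_cancel_right)
  also have "cnj ?T * ?T = of_real ((cmod ?T)\<^sup>2)" using complex_norm_square[of ?T] by (simp add: mult.commute)
  finally show ?thesis .
qed

text \<open>Since \<open>dz\<^sub>i \<and> d\<close>conj\<open>(z\<^sub>i) = (2/(i\<rho>\<^sub>i)) \<omega>\<close> and \<open>\<Lambda>\<omega> = 1\<close>.\<close>

lemma Lambda_curvature: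
  assumes p: "p \<in> D i"
  shows "\<i> * Lambda M \<rho> (curvature M E A) p = of_real (2 / \<rho> i p) * curvature M E A i p"
proof -
  let ?F = "curvature M E A"
  have r: "\<rho> i p > 0" using rho_pos[OF p] .
  have inner: "two_form_inner M \<rho> (kaehler_wedge \<rho> a) ?F p = 2 * \<i> / of_real (\<rho> i p) * a * cnj (?F i p)" for a
  proof -
    have val: "of_real (4 / (\<rho> j p)\<^sup>2) * kaehler_wedge \<rho> a j p * cnj (?F j p) =
        2 * \<i> * a * (cnj (?F j p) / of_real (\<rho> j p))" if "p \<in> D j" for j
      using rho_pos[OF that] by (simp add: kaehler_wedge_def power2_eq_square)
    have "two_form_inner M \<rho> (kaehler_wedge \<rho> a) ?F p = of_real (4 / (\<rho> i p)\<^sup>2) * kaehler_wedge \<rho> a i p * cnj (?F i p)"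
      unfolding two_form_inner_def
    proof (rule chart_value_eq[OF p])
      fix j assume j: "p \<in> D j"
      have "cnj (?F j p) / of_real (\<rho> j p) = cnj (?F i p) / of_real (\<rho> i p)"
        using curvature_transition[OF p j] rho_transition[OF p j] transition_deriv_nonzero[OF p j] r by simp
      then show "of_real (4 / (\<rho> j p)\<^sup>2) * kaehler_wedge \<rho> a j p * cnj (?F j p) =
          of_real (4 / (\<rho> i p)\<^sup>2) * kaehler_wedge \<rho> a i p * cnj (?F i p)"
        unfolding val[OF j] val[OF p] by simp
    qed
    then show ?thesis unfolding val[OF p] by simp
  qed
  have "Lambda M \<rho> ?F p = - 2 * \<i> / of_real (\<rho> i p) * ?F i p"
    unfolding Lambda_def inner
  proof (rule the_equality)
    fix c assume "\<forall>a. 2 * \<i> / of_real (\<rho> i p) * a * cnj (?F i p) = a * cnj c"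
    then have "2 * \<i> / of_real (\<rho> i p) * cnj (?F i p) = cnj c" by (metis mult_1 mult_1_right)
    then have "cnj (2 * \<i> / of_real (\<rho> i p) * cnj (?F i p)) = c" by simp
    then show "c = - 2 * \<i> / of_real (\<rho> i p) * ?F i p" by simp
  qed simp
  then have "\<i> * Lambda M \<rho> ?F p = - (\<i> * \<i>) * (2 / of_real (\<rho> i p) * ?F i p)"
    by (simp add: field_simps del: i_squared)
  then show ?thesis by simp
qed

section \<open>The formal adjoint\<close>

lemma Omega00_sec: "s \<in> Omega00 M E \<Longrightarrow> sec W s"
  unfolding Omega00_def using sec_subset[of UNIV s W] by simp

lemma Omega01_form:
  assumes "\<psi> \<in> Omega01 M E"
  shows "sec (D i) (\<psi> i)" "p \<notin> D i \<Longrightarrow> \<psi> i p = 0"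
    "p \<in> D i \<Longrightarrow> p \<in> D j \<Longrightarrow> \<psi> j p = scl E (cnj (T i j p)) (\<psi> i p)"
  using assms unfolding Omega01_def form01_def Int_UNIV_left by blast+

lemma Omega01_fibre: "\<psi> \<in> Omega01 M E \<Longrightarrow> p \<in> D i \<Longrightarrow> \<psi> i p \<in> fibre E p"
  using sec_fibre[OF Omega01_form(1)] .

lemma C1_form10_h:
  assumes s: "\<And>i. sec (D i) (s i)" "\<And>i. sec (D i) (t i)"
    and tr: "\<And>i j p. p \<in> D i \<Longrightarrow> p \<in> D j \<Longrightarrow> h p (s j p) (t j p) = T i j p * h p (s i p) (t i p)"
  shows "C1_form10 (\<lambda>i p. h p (s i p) (t i p))"
  unfolding C1_form10_def
proof (intro conjI allI ballI)
  fix i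
  have "smooth_fun M (D i) (\<lambda>p. h p (s i p) (t i p))" by (rule h_smooth[OF open_dom s])
  then have "C_k_on 1 (z i ` (D i \<inter> D i)) ((\<lambda>p. h p (s i p) (t i p)) \<circ> zinv i)"
    unfolding smooth_fun_iff C_fun_def by blast
  then show "C_k_on 1 (z i ` D i) ((\<lambda>p. h p (s i p) (t i p)) \<circ> zinv i)" by simp
qed (use tr in blast)

text \<open>Integration by parts predicts \<open>-(2/\<rho>\<^sub>i)\<close> times the covariant derivative of \<open>\<psi>\<^sub>i\<close> along \<open>\<partial>/\<partial>z\<^sub>i\<close>.\<close>

definition adjoint_formula :: "('i \<Rightarrow> 'm \<Rightarrow> 'v) \<Rightarrow> 'm \<Rightarrow> 'v" where
  "adjoint_formula \<psi> p = chart_value M (\<lambda>i. scl E (of_real (- 2 / \<rho> i p)) (d10 A (\<psi> i) i p)) p"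

text \<open>As \<open>\<psi>\<^sub>j =\<close> conj\<open>(T) \<psi>\<^sub>i\<close> with an antiholomorphic factor, the derivative along \<open>\<partial>/\<partial>z\<^sub>j\<close> produces
  \<open>\<bar>T\<bar>\<^sup>2\<close>, which the metric cancels.\<close>

lemma adjoint_formula_eq:
  assumes \<psi>: "\<psi> \<in> Omega01 M E" and p: "p \<in> D i"
  shows "adjoint_formula \<psi> p = scl E (of_real (- 2 / \<rho> i p)) (d10 A (\<psi> i) i p)"
  unfolding adjoint_formula_def
proof (rule chart_value_eq[OF p])
  fix j assume j: "p \<in> D j"
  let ?N = "D i \<inter> D j"
  have N: "open ?N" "p \<in> ?N" using open_dom p j by blast+
  have sN: "sec ?N (\<psi> i)" "sec ?N (\<psi> j)"
    by (rule sec_subset[OF Omega01_form(1)[OF \<psi>]], blast)+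
  have tr: "\<forall>q\<in>?N. \<psi> j q = scl E (cnj (T i j q)) (\<psi> i q)"
    using Omega01_form(3)[OF \<psi>] by blast
  have T: "smooth_fun M ?N (\<lambda>q. cnj (T i j q))"
    by (intro smooth_funI C_fun_cnj N C_fun_transition_deriv)
  have "d10 A (\<psi> j) j p = scl E (cnj (T i j p) * T i j p) (d10 A (\<psi> i) i p)"
    unfolding d_local(1)[OF N(1) sN(2) tr N(2) j] d_leibniz(1)[OF N(1) T sN(1) N(2) j]
      d_transition(1)[OF N(1) sN(1) N(2) p j] del_cnj_transition_deriv[OF p j] by simp
  also have "cnj (T i j p) * T i j p = of_real ((cmod (T i j p))\<^sup>2)"
    using complex_norm_square[of "T i j p"] by (simp add: mult.commute)
  finally show "scl E (of_real (- 2 / \<rho> j p)) (d10 A (\<psi> j) j p) = scl E (of_real (- 2 / \<rho> i p)) (d10 A (\<psi> i) i p)"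
    using rho_transition[OF p j] transition_deriv_nonzero[OF p j] rho_pos[OF p] by simp
qed

lemma d10_eq_adjoint_formula:
  assumes \<psi>: "\<psi> \<in> Omega01 M E" and p: "p \<in> D i"
  shows "d10 A (\<psi> i) i p = scl E (of_real (- \<rho> i p / 2)) (adjoint_formula \<psi> p)"
  unfolding adjoint_formula_eq[OF assms] using rho_pos[OF p] by simp

lemma adjoint_formula_Omega00:
  assumes \<psi>: "\<psi> \<in> Omega01 M E"
  shows "adjoint_formula \<psi> \<in> Omega00 M E"
proof -
  have "sec (D i) (adjoint_formula \<psi>)" for i
  proof (rule sec_cong[OF open_dom])
    show "adjoint_formula \<psi> p = scl E (-2 * inverse (of_real (\<rho> i p))) (d10 A (\<psi> i) i p)" if "p \<in> D i" for p
      using adjoint_formula_eq[OF \<psi> that] by (simp add: divide_inverse)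
    have r: "C_fun k (D i) (\<lambda>p. of_real (\<rho> i p))" for k
      using kaehler unfolding kaehler_metric_def smooth_fun_iff by blast
    have "smooth_fun M (D i) (\<lambda>p. -2 * inverse (of_real (\<rho> i p)))"
      by (intro smooth_funI C_fun_mult C_fun_const C_fun_inverse open_dom r)
         (use rho_pos[of _ i] in force)
    moreover have "sec (D i) (d10 A (\<psi> i) i)" using d_sec(1)[OF open_dom Omega01_form(1)[OF \<psi>], of i i] by simp
    ultimately show "sec (D i) (\<lambda>p. scl E (-2 * inverse (of_real (\<rho> i p))) (d10 A (\<psi> i) i p))"
      by (rule sec_scl[OF open_dom])
  qed
  then show ?thesis unfolding Omega00_def using sec_UNIV by blast
qed

lemma h_continuous:
  assumes "s \<in> Omega00 M E" "t \<in> Omega00 M E"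
  shows "continuous_on UNIV (\<lambda>p. h p (s p) (t p))"
  using h_smooth[OF open_UNIV Omega00_sec[OF assms(1)] Omega00_sec[OF assms(2)]]
  by (auto simp: smooth_fun_iff intro: C_fun_continuous)

text \<open>Stokes' theorem for the \<open>(1,0)\<close>-form \<open>h(t, \<psi>)\<close>.\<close>

lemma adjoint_formula_L2:
  assumes t: "t \<in> Omega00 M E" and \<psi>: "\<psi> \<in> Omega01 M E"
  shows "L2_inner01 M \<rho> h (dbar M A t) \<psi> = L2_inner00 M \<rho> h t (adjoint_formula \<psi>)"
proof -
  define \<xi> where "\<xi> i p = h p (t p) (\<psi> i p)" for i p
  have st: "sec (D i) t" for i using Omega00_sec[OF t] .
  have \<xi>: "C1_form10 \<xi>"
    unfolding \<xi>_def[abs_def]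
  proof (rule C1_form10_h[OF st Omega01_form(1)[OF \<psi>]])
    fix i j p assume p: "p \<in> D i" "p \<in> D j"
    show "h p (t p) (\<psi> j p) = T i j p * h p (t p) (\<psi> i p)"
      unfolding Omega01_form(3)[OF \<psi> p]
      using h_scl_right[OF Omega01_fibre[OF \<psi> p(1)] sec_fibre[OF st p(1)]] by simp
  qed
  have "chart_value M (\<lambda>i. of_real (2 / \<rho> i p) * h p (dbar M A t i p) (\<psi> i p)) p =
      2 * divergence \<xi> p + h p (t p) (adjoint_formula \<psi> p)" for p
  proof -
    obtain i where i: "p \<in> D i" using ex_dom by blast
    have db: "dbar M A t j p = d01 A t j p" if "p \<in> D j" for j
      using that by (simp add: dbar_def restrict_form_def)
    have tf: "t p \<in> fibre E p" using sec_fibre[OF st i] .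
    have df: "d01 A t j p \<in> fibre E p" if "p \<in> D j" for j
      using sec_fibre[OF d_sec(2)[OF open_UNIV Omega00_sec[OF t], of j]] that by blast
    have "chart_value M (\<lambda>i. of_real (2 / \<rho> i p) * h p (dbar M A t i p) (\<psi> i p)) p =
        of_real (2 / \<rho> i p) * h p (dbar M A t i p) (\<psi> i p)"
    proof (rule chart_value_eq[OF i])
      fix j assume j: "p \<in> D j"
      have "h p (d01 A t j p) (\<psi> j p) = cnj (T i j p) * (T i j p * h p (d01 A t i p) (\<psi> i p))"
        unfolding d_transition(2)[OF open_UNIV Omega00_sec[OF t] UNIV_I i j] Omega01_form(3)[OF \<psi> i j]
        using h_scl[OF df[OF i] fibre_scl[OF Omega01_fibre[OF \<psi> i]]]
          h_scl_right[OF Omega01_fibre[OF \<psi> i] df[OF i]] by simp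
      also have "\<dots> = of_real ((cmod (T i j p))\<^sup>2) * h p (d01 A t i p) (\<psi> i p)"
        using complex_norm_square[of "T i j p"] by (simp add: mult_ac)
      finally show "of_real (2 / \<rho> j p) * h p (dbar M A t j p) (\<psi> j p) =
          of_real (2 / \<rho> i p) * h p (dbar M A t i p) (\<psi> i p)"
        unfolding db[OF i] db[OF j]
        using rho_transition[OF i j] transition_deriv_nonzero[OF i j] rho_pos[OF i] by simp
    qed
    also have "\<dots> = of_real (2 / \<rho> i p) * h p (d01 A t i p) (\<psi> i p)" by (simp add: db[OF i])
    also have "\<dots> = 2 * divergence \<xi> p + h p (t p) (adjoint_formula \<psi> p)"
    proof -
      have d10f: "d10 A (\<psi> i) i p \<in> fibre E p"
        using sec_fibre[OF d_sec(1)[OF open_dom Omega01_form(1)[OF \<psi>]], of p i i] i by blast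
      have "h p (t p) (adjoint_formula \<psi> p) = - of_real (2 / \<rho> i p) * h p (t p) (d10 A (\<psi> i) i p)"
        unfolding adjoint_formula_eq[OF \<psi> i] h_scl_right[OF d10f tf] by simp
      moreover have "delbar M i (\<xi> i) p = h p (d01 A t i p) (\<psi> i p) + h p (t p) (d10 A (\<psi> i) i p)"
        unfolding \<xi>_def[abs_def] by (rule delbar_h[OF open_dom st Omega01_form(1)[OF \<psi>] i i])
      then have "divergence \<xi> p = (h p (d01 A t i p) (\<psi> i p) + h p (t p) (d10 A (\<psi> i) i p)) / of_real (\<rho> i p)"
        by (simp only: divergence_eq[OF \<xi> i])
      ultimately show ?thesis by (simp add: add_divide_distrib algebra_simps)
    qed
    finally show ?thesis .
  qed
  then show ?thesis
    unfolding L2_inner01_def L2_inner00_def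
    using integrable_continuous[OF continuous_divergence[OF \<xi>]] integral_divergence_eq_0[OF \<xi>]
      integrable_continuous[OF h_continuous[OF t adjoint_formula_Omega00[OF \<psi>]]] by simp
qed

text \<open>Two adjoints differ by a section orthogonal to every section, in particular to itself.\<close>

lemma dbar_adjoint_eq:
  assumes \<psi>: "\<psi> \<in> Omega01 M E"
  shows "dbar_adjoint M \<rho> E h A \<psi> = adjoint_formula \<psi>"
  unfolding dbar_adjoint_def
proof (rule the_equality)
  let ?\<sigma> = "adjoint_formula \<psi>"
  note \<sigma> = adjoint_formula_Omega00[OF \<psi>]
  show "?\<sigma> \<in> Omega00 M E \<and> (\<forall>t\<in>Omega00 M E. L2_inner01 M \<rho> h (dbar M A t) \<psi> = L2_inner00 M \<rho> h t ?\<sigma>)"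
    using \<sigma> adjoint_formula_L2[OF _ \<psi>] by blast
  fix \<tau> assume "\<tau> \<in> Omega00 M E \<and> (\<forall>t\<in>Omega00 M E. L2_inner01 M \<rho> h (dbar M A t) \<psi> = L2_inner00 M \<rho> h t \<tau>)"
  then have \<tau>: "\<tau> \<in> Omega00 M E" "\<And>t. t \<in> Omega00 M E \<Longrightarrow> L2_inner00 M \<rho> h t \<tau> = L2_inner00 M \<rho> h t ?\<sigma>"
    using adjoint_formula_L2[OF _ \<psi>] by auto
  define \<delta> where "\<delta> p = \<tau> p + scl E (- 1) (?\<sigma> p)" for p
  have \<delta>: "\<delta> \<in> Omega00 M E"
    unfolding Omega00_def \<delta>_def[abs_def]
    by (rule CollectI)
      (rule sec_add[OF open_UNIV Omega00_sec[OF \<tau>(1)] sec_scl[OF open_UNIV smooth_fun_const Omega00_sec[OF \<sigma>]]])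
  have f: "\<tau> p \<in> fibre E p" "?\<sigma> p \<in> fibre E p" "\<delta> p \<in> fibre E p" for p
    using sec_fibre[OF Omega00_sec[of _ UNIV]] \<tau>(1) \<sigma> \<delta> by blast+
  have "h p (\<delta> p) (\<delta> p) = h p (\<delta> p) (\<tau> p) - h p (\<delta> p) (?\<sigma> p)" for p
  proof -
    have "h p (\<delta> p) (\<delta> p) = h p (\<delta> p) (\<tau> p + scl E (- 1) (?\<sigma> p))"
      by (simp only: \<delta>_def)
    also have "\<dots> = h p (\<delta> p) (\<tau> p) + h p (\<delta> p) (scl E (- 1) (?\<sigma> p))"
      by (rule h_add_right[OF f(1) fibre_scl[OF f(2)] f(3)])
    also have "h p (\<delta> p) (scl E (- 1) (?\<sigma> p)) = - h p (\<delta> p) (?\<sigma> p)"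
      using h_scl_right[OF f(2,3), of p "- 1"] by simp
    finally show ?thesis by simp
  qed
  then have "(LINT p|dA. h p (\<delta> p) (\<delta> p)) = L2_inner00 M \<rho> h \<delta> \<tau> - L2_inner00 M \<rho> h \<delta> ?\<sigma>"
    unfolding L2_inner00_def
    using integrable_continuous[OF h_continuous[OF \<delta> \<tau>(1)]] integrable_continuous[OF h_continuous[OF \<delta> \<sigma>]]
    by simp
  then have 0: "Re (LINT p|dA. h p (\<delta> p) (\<delta> p)) = 0" using \<tau>(2)[OF \<delta>] by simp
  have "\<delta> p = 0" for p
    using continuous_nonneg_integral_0[OF h_continuous[OF \<delta> \<delta>] h_nonneg[OF f(3)] 0, of p] h_pos[OF f(3), of p]
    by (cases "\<delta> p = 0") auto
  then show "\<tau> = ?\<sigma>" by (simp add: \<delta>_def fun_eq_iff)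
qed

section \<open>The eigenvalue estimate\<close>

text \<open>With \<open>\<nu> = \<mu>/\<surd>2\<close> the two equations say \<open>\<partial>\<close>bar\<open>\<^sup>*\<partial>\<close>bar\<open> \<phi> = \<nu>\<^sup>2 \<phi>\<close>. Stokes' theorem for the \<open>(1,0)\<close>-form
  \<open>h(\<partial>\<phi>, \<phi>)\<close>, with the derivatives interchanged at the price of the curvature, is the identity
  \<open>\<nu>\<^sup>2 \<parallel>\<phi>\<parallel>\<^sup>2 = \<parallel>\<partial>\<phi>\<parallel>\<^sup>2 - \<integral> i\<Lambda>F \<bar>\<phi>\<bar>\<^sup>2\<close>. Its real part gives the bound; an integrated pointwise inequality
  avoids splitting the integral.\<close>

lemma eigensection_bound:
  assumes \<phi>: "\<phi> \<in> Omega00 M E" "\<phi> q \<noteq> 0" and \<psi>: "\<psi> \<in> Omega01 M E"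
    and d: "\<And>i p. p \<in> D i \<Longrightarrow> d01 A \<phi> i p = scl E \<nu> (\<psi> i p)"
    and ad: "\<And>p. adjoint_formula \<psi> p = scl E \<nu> (\<phi> p)"
    and F0: "\<And>p. Re (\<i> * Lambda M \<rho> (curvature M E A) p) \<le> F0"
  shows "- F0 \<le> Re (\<nu>\<^sup>2)"
proof (rule ccontr)
  assume neg: "\<not> ?thesis"
  define k where "k = - Re (\<nu>\<^sup>2) - F0"
  have k: "k > 0" using neg by (simp add: k_def)
  define \<xi> where "\<xi> i p = h p (d10 A \<phi> i p) (\<phi> p)" for i p
  note s\<phi> = Omega00_sec[OF \<phi>(1)]
  have s1: "sec (D i) (d10 A \<phi> i)" for i using d_sec(1)[OF open_UNIV s\<phi>, of i] by simp
  have f: "\<phi> p \<in> fibre E p" for p using sec_fibre[OF s\<phi>, of p UNIV] by simp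
  have f1: "d10 A \<phi> i p \<in> fibre E p" if "p \<in> D i" for i p using sec_fibre[OF s1 that] .
  have \<xi>: "C1_form10 \<xi>"
    unfolding \<xi>_def[abs_def]
  proof (rule C1_form10_h[OF s1 s\<phi>])
    fix i j p assume p: "p \<in> D i" "p \<in> D j"
    show "h p (d10 A \<phi> j p) (\<phi> p) = T i j p * h p (d10 A \<phi> i p) (\<phi> p)"
      unfolding d_transition(1)[OF open_UNIV s\<phi> UNIV_I p] by (rule h_scl[OF f1[OF p(1)] f])
  qed
  have pointwise: "k * Re (h p (\<phi> p) (\<phi> p)) \<le> Re (2 * divergence \<xi> p)" for p
  proof -
    obtain i where i: "p \<in> D i" using ex_dom by blast
    let ?u = "h p (\<phi> p) (\<phi> p)" and ?F = "curvature M E A i p"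
    have r: "\<rho> i p > 0" using rho_pos[OF i] .
    have s2: "sec (D i) (d01 A \<phi> i)" using d_sec(2)[OF open_UNIV s\<phi>, of i] by simp
    have loc: "\<forall>q\<in>D i. d01 A \<phi> i q = scl E \<nu> (\<psi> i q)" using d by blast
    have "d10 A (d01 A \<phi> i) i p = scl E (- of_real (\<rho> i p / 2) * \<nu>\<^sup>2) (\<phi> p)"
      unfolding d_local(1)[OF open_dom s2 loc i i] d_const_scl(1)[OF open_dom Omega01_form(1)[OF \<psi>] i i]
        d10_eq_adjoint_formula[OF \<psi> i] ad by (simp add: power2_eq_square mult_ac)
    then have "d01 A (d10 A \<phi> i) i p = scl E (- of_real (\<rho> i p / 2) * \<nu>\<^sup>2 - ?F) (\<phi> p)"
      using curvature_eq[OF i open_UNIV UNIV_I s\<phi>]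
      by (simp add: fibres.scale_left_diff_distrib algebra_simps)
    then have "delbar M i (\<xi> i) p = (- of_real (\<rho> i p / 2) * \<nu>\<^sup>2 - ?F) * ?u + h p (d10 A \<phi> i p) (d10 A \<phi> i p)"
      unfolding \<xi>_def[abs_def] delbar_h[OF open_dom s1 s\<phi> i i] using h_scl[OF f f] by simp
    then have "2 * divergence \<xi> p = (- \<nu>\<^sup>2 - of_real (2 / \<rho> i p) * ?F) * ?u
        + of_real (2 / \<rho> i p) * h p (d10 A \<phi> i p) (d10 A \<phi> i p)"
      unfolding divergence_eq[OF \<xi> i] using r by (simp add: field_simps)
    also have "\<dots> = (- \<nu>\<^sup>2 - \<i> * Lambda M \<rho> (curvature M E A) p) * ?u
        + of_real (2 / \<rho> i p) * h p (d10 A \<phi> i p) (d10 A \<phi> i p)"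
      by (simp only: Lambda_curvature[OF i])
    finally have "Re (2 * divergence \<xi> p) = (- Re (\<nu>\<^sup>2) - Re (\<i> * Lambda M \<rho> (curvature M E A) p)) * Re ?u
        + 2 / \<rho> i p * Re (h p (d10 A \<phi> i p) (d10 A \<phi> i p))"
      using h_real[OF f, of p] by simp
    moreover have "k * Re ?u \<le> (- Re (\<nu>\<^sup>2) - Re (\<i> * Lambda M \<rho> (curvature M E A) p)) * Re ?u"
      by (rule mult_right_mono) (use F0[of p] h_nonneg[OF f] in \<open>auto simp: k_def\<close>)
    moreover have "0 \<le> 2 / \<rho> i p * Re (h p (d10 A \<phi> i p) (d10 A \<phi> i p))"
      using r h_nonneg[OF f1[OF i]] by simp
    ultimately show ?thesis by linarith
  qed
  note iu = integrable_continuous[OF h_continuous[OF \<phi>(1) \<phi>(1)]]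
    and i\<xi> = integrable_continuous[OF continuous_divergence[OF \<xi>]]
  have "(LINT p|dA. k * Re (h p (\<phi> p) (\<phi> p))) \<le> (LINT p|dA. Re (2 * divergence \<xi> p))"
    by (rule integral_mono) (use iu i\<xi> pointwise in \<open>auto intro!: integrable_mult_right integrable_Re\<close>)
  also have "\<dots> = 0" using i\<xi> integral_divergence_eq_0[OF \<xi>] by simp
  finally have "(LINT p|dA. Re (h p (\<phi> p) (\<phi> p))) \<le> 0" using k by (simp add: mult_le_0_iff)
  moreover have "(LINT p|dA. Re (h p (\<phi> p) (\<phi> p))) \<ge> 0"
    by (rule Bochner_Integration.integral_nonneg) (rule h_nonneg[OF f])
  ultimately have "Re (LINT p|dA. h p (\<phi> p) (\<phi> p)) = 0" using iu by simp
  from continuous_nonneg_integral_0[OF h_continuous[OF \<phi>(1) \<phi>(1)] h_nonneg[OF f] this, of q]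
  show False using h_pos[OF f \<phi>(2)] by simp
qed

end

section \<open>The theorem\<close>

theorem mainTheorem2:
  fixes M :: "('i, 'm::t2_space) surface"
    and \<rho> :: "'i \<Rightarrow> 'm \<Rightarrow> real"
    and E :: "('b, 'm, 'v::ab_group_add) line_bundle"
    and h :: "'m \<Rightarrow> 'v \<Rightarrow> 'v \<Rightarrow> complex"
    and A :: "('i, 'm, 'v) connection"
    and F0 :: real
    and \<mu> :: complex
  assumes "riemann_surface M"
    and "compact (UNIV :: 'm set)"
    and "connected (UNIV :: 'm set)"
    and "kaehler_metric M \<rho>"
    and "holomorphic_line_bundle M E"
    and "hermitian_metric M E h"
    and "chern_connection M E h A"
    and F0_attained: "\<exists>p. Re (\<i> * Lambda M \<rho> (curvature M E A) p) = F0"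
    and F0_upper: "\<forall>p. Re (\<i> * Lambda M \<rho> (curvature M E A) p) \<le> F0"
    and "F0 \<le> 0"
    and "dirac_eigenvalue M \<rho> E h A \<mu>"
    and "\<mu> \<noteq> 0"
  shows "cmod \<mu> \<ge> sqrt (- 2 * F0)"
proof -
  interpret hermitian_line_bundle M \<rho> E h A
    using assms by unfold_locales (auto simp: chern_connection_def)
  obtain \<phi> \<psi> where \<phi>: "\<phi> \<in> Omega00 M E" and \<psi>: "\<psi> \<in> Omega01 M E"
    and nz: "(\<phi>, \<psi>) \<noteq> (\<lambda>p. 0, \<lambda>i p. 0)"
    and eig: "dirac M \<rho> E h A (\<phi>, \<psi>) = (\<lambda>p. scl E \<mu> (\<phi> p), \<lambda>i p. scl E \<mu> (\<psi> i p))"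
    using assms(11) unfolding dirac_eigenvalue_def by blast
  define \<nu> where "\<nu> = \<mu> / of_real (sqrt 2)"
  have solve: "v = scl E \<nu> w" if "scl E (of_real (sqrt 2)) v = scl E \<mu> w" for v w
  proof -
    have "scl E (1 / of_real (sqrt 2)) (scl E (of_real (sqrt 2)) v) = scl E \<nu> w"
      unfolding that by (simp add: \<nu>_def)
    then show ?thesis by simp
  qed
  have ad: "adjoint_formula \<psi> p = scl E \<nu> (\<phi> p)" for p
    using eig by (intro solve) (simp add: dirac_def dbar_adjoint_eq[OF \<psi>] fun_eq_iff)
  have d: "d01 A \<phi> i p = scl E \<nu> (\<psi> i p)" if "p \<in> D i" for i p
  proof (rule solve)
    have "scl E (of_real (sqrt 2)) (dbar M A \<phi> i p) = scl E \<mu> (\<psi> i p)"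
      using eig by (simp add: dirac_def fun_eq_iff)
    then show "scl E (of_real (sqrt 2)) (d01 A \<phi> i p) = scl E \<mu> (\<psi> i p)"
      using that by (simp add: dbar_def restrict_form_def)
  qed
  \<comment> \<open>If \<open>\<phi>\<close> vanished, \<open>\<partial>\<close>bar\<open> \<phi> = \<nu> \<psi>\<close> would force \<open>\<psi> = 0\<close>; this is where \<open>\<mu> \<noteq> 0\<close> enters.\<close>
  have "\<exists>q. \<phi> q \<noteq> 0"
  proof (rule ccontr)
    assume "\<not> ?thesis"
    then have \<phi>0: "\<phi> = (\<lambda>p. 0)" by auto
    have "\<psi> i p = 0" for i p
    proof (cases "p \<in> D i")
      case True
      have "d01 A (\<lambda>q. scl E 0 (\<phi> q)) i p = scl E 0 (d01 A \<phi> i p)"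
        by (rule d_const_scl(2)[OF open_UNIV Omega00_sec[OF \<phi>] UNIV_I True])
      then have "d01 A \<phi> i p = 0" unfolding \<phi>0 by simp
      then show ?thesis using d[OF True] \<open>\<mu> \<noteq> 0\<close> by (simp add: \<nu>_def)
    next
      case False
      then show ?thesis by (rule Omega01_form(2)[OF \<psi>])
    qed
    then have "\<psi> = (\<lambda>i p. 0)" by (intro ext)
    then show False using nz \<phi>0 by simp
  qed
  then obtain q where q: "\<phi> q \<noteq> 0" by blast
  have "- F0 \<le> Re (\<nu>\<^sup>2)"
    by (rule eigensection_bound[OF \<phi> q \<psi> d ad]) (use F0_upper in auto)
  also have "Re (\<nu>\<^sup>2) = Re (\<mu>\<^sup>2) / 2"
    by (simp add: \<nu>_def power_divide of_real_power[symmetric] del: of_real_power)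
  also have "Re (\<mu>\<^sup>2) \<le> (cmod \<mu>)\<^sup>2"
    using complex_Re_le_cmod[of "\<mu>\<^sup>2"] by (simp add: norm_power)
  finally have "- 2 * F0 \<le> (cmod \<mu>)\<^sup>2" by simp
  then show ?thesis by (simp add: real_le_lsqrt)
qed

end
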